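(* Let $C = 11\cdot 195^2 = 418{,}275$. Let $G_1=(V_1,E_1)$ and $G_2=(V_2,E_2)$ be graphs on $n$ vertices each with $\Delta(G_1),\Delta(G_2)\le n-2$. If $|E_1|+|E_2|+\max\{\Delta(G_1),\Delta(G_2)\}\le 3n-C$, then $G_1$ and $G_2$ pack.
   Context: Two $n$-vertex graphs $G_1=(V_1,E_1)$ and $G_2=(V_2,E_2)$ pack if there is a bijection $f:V_1\to V_2$ such that $uv\in E_1$ implies $f(u)f(v)\notin E_2$. $\Delta(G)$ denotes the maximum degree of $G$. *)

theory Defs
  imports Main
begin

definition simple_graph :: "'a set \<Rightarrow> 'a set set \<Rightarrow> bool" where
  "simple_graph V E \<longleftrightarrow> finite V \<and> (\<forall>e\<in>E. e \<subseteq> V \<and> card e = 2)"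

definition degree :: "'a set set \<Rightarrow> 'a \<Rightarrow> nat" where
  "degree E v = card {e \<in> E. v \<in> e}"

definition max_degree :: "'a set \<Rightarrow> 'a set set \<Rightarrow> nat" where
  "max_degree V E = Max (insert 0 (degree E ` V))"

definition packs :: "'a set \<Rightarrow> 'a set set \<Rightarrow> 'b set \<Rightarrow> 'b set set \<Rightarrow> bool" where
  "packs V1 E1 V2 E2 \<longleftrightarrow>
     (\<exists>f. bij_betw f V1 V2 \<and> (\<forall>u\<in>V1. \<forall>v\<in>V1. {u, v} \<in> E1 \<longrightarrow> {f u, f v} \<notin> E2))"

end

theory Submission
  imports Defs Complex_Main "HOL-Combinatorics.Permutations"
begin

text \<open>Call a vertex of degree at least \<open>n / 3000\<close> a hub. A partial packing that covers the hubs of \<open>G2\<close> and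
  leaves few positions forbidden extends to a packing: place the remaining vertices of \<open>G1\<close> with many
  forbidden positions, then those of degree at least 87 (greedily, onto vertices of degree at most 19),
  then the vertices of \<open>G2\<close> with many forbidden positions; the rest has small degrees, and a
  bijection with fewest conflicts can be improved by exchanging two images until none is left.

  The hubs of \<open>G2\<close> are placed on vertices of \<open>G1\<close> whose neighbours are nearly all of small degree. If
  \<open>G1\<close> has 36020 vertices of degree at most one, with no hub neighbour and distinct neighbours, these
  do. If neither graph has them, both have almost \<open>n\<close> edges outside their hubs, hence at most about
  \<open>2 n\<close> edges, and many vertices of \<open>G1\<close> have at most one hub neighbour and few others. Either many share
  the same hub, and placing that hub on a vertex of \<open>G2\<close> of degree at most four makes it harmless, or
  no hub sees many of them, and the greedy embedding spreads the load.

  A vertex of degree more than \<open>0.85 n\<close> is first sent to a vertex of \<open>G2\<close> of small degree. When \<open>G2\<close>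
  has an isolated vertex or fewer than \<open>n - 200\<close> edges, and also when there are at most \<open>1.4 n\<close> edges in
  all, a random completion has on average less than one conflict; otherwise the previous method applies.\<close>

section \<open>Neighbourhoods and degrees\<close>

text \<open>Once sparse pairs are settled, 1.4 n < |E1| + |E2| \<le> 3 n - 418275 gives only n >
  261000, so 18000 hubs or a multiple of sqrt (2 |E|) are not small beside n by themselves. The
  additive constant makes them small: 2 e \<le> 6 n - 836550 implies 2 e * 92000 \<le> n^2, because
  6 n - 828000 is the tangent of n^2 / 92000 at 276000, and 2 e \<le> 4 n - 720000 implies 2 e *
  180000 \<le> n^2 by the tangent at 360000. For moderate degrees the second bound presupposes that
  the other graph has nearly n edges, one reason for settling the case of many leaves first.

  The threshold n / 3000 is a compromise: there are at most 18000 hubs, while the exchange argument,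
  with degrees at most 86 on one side and n / 3000 on the other, excludes about 2 * 86 * n / 3000 <
  0.06 n partners for edges between unplaced vertices.

  The main obstacle is a vertex adjacent to the preimages of several hubs, which can lose nearly all
  targets. Degree sums control how many vertices suffer this. A single large degree cannot be
  averaged away, hence the exceptional alternative in \<open>greedy_embedding\<close> and the
  separate case above 0.85 n.\<close>

definition nb :: "'a set set \<Rightarrow> 'a \<Rightarrow> 'a set" where
  "nb E v = {u. {v, u} \<in> E}"

abbreviation deg :: "'a set set \<Rightarrow> 'a \<Rightarrow> nat" where
  "deg E v \<equiv> card (nb E v)"

lemma nb_iff: "u \<in> nb E v \<longleftrightarrow> {v, u} \<in> E"
  by (simp add: nb_def)

lemma nb_sym: "u \<in> nb E v \<longleftrightarrow> v \<in> nb E u"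
  by (simp add: nb_def insert_commute)

lemma simple_graph_finite: "simple_graph V E \<Longrightarrow> finite V"
  by (simp add: simple_graph_def)

lemma simple_graph_finite_edges: "simple_graph V E \<Longrightarrow> finite E"
  unfolding simple_graph_def by (rule finite_subset[of E "Pow V"]) auto

lemma simple_graph_nb_subset: "simple_graph V E \<Longrightarrow> nb E v \<subseteq> V"
  unfolding simple_graph_def nb_def by blast

lemma simple_graph_nb_self: "simple_graph V E \<Longrightarrow> v \<notin> nb E v"
  unfolding simple_graph_def nb_def by force

lemma simple_graph_nb_finite: "simple_graph V E \<Longrightarrow> finite (nb E v)"
  using simple_graph_nb_subset simple_graph_finite finite_subset by metis

lemma simple_graph_nb_outside: "simple_graph V E \<Longrightarrow> v \<notin> V \<Longrightarrow> nb E v = {}"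
  unfolding simple_graph_def nb_def by auto

lemma degree_card_nb: assumes "simple_graph V E" shows "degree E v = deg E v"
proof -
  have "bij_betw (\<lambda>u. {v, u}) (nb E v) {e \<in> E. v \<in> e}"
    unfolding bij_betw_def
  proof
    show "inj_on (\<lambda>u. {v, u}) (nb E v)"
      by (auto simp: inj_on_def doubleton_eq_iff)
    show "(\<lambda>u. {v, u}) ` nb E v = {e \<in> E. v \<in> e}"
    proof (intro equalityI subsetI)
      fix e assume "e \<in> {e \<in> E. v \<in> e}"
      then have e: "e \<in> E" "v \<in> e" "card e = 2"
        using assms by (auto simp: simple_graph_def)
      then obtain a b where "e = {a, b}" by (auto simp: card_2_iff)
      then show "e \<in> (\<lambda>u. {v, u}) ` nb E v"
        using e by (auto simp: nb_def insert_commute)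
    qed (auto simp: nb_def)
  qed
  then show ?thesis by (simp add: degree_def bij_betw_same_card)
qed

section \<open>Double counting of edges\<close>

lemma card_arcs:
  assumes "finite E" "\<And>e. e \<in> E \<Longrightarrow> card e = 2"
  shows "card {(x, u). {x, u} \<in> E} = 2 * card E" "finite {(x, u). {x, u} \<in> E}"
proof -
  have A: "{(x, u). {x, u} \<in> E} = (\<Union>e\<in>E. {(x, u). {x, u} = e})" by auto
  have B: "card {(x, u). {x, u} = e} = 2 \<and> finite {(x, u). {x, u} = e}" if e: "e \<in> E" for e
  proof -
    obtain a b where ab: "e = {a, b}" "a \<noteq> b" using assms(2)[OF e] by (auto simp: card_2_iff)
    then have "{(x, u). {x, u} = e} = {(a, b), (b, a)}" by (auto simp: doubleton_eq_iff)
    then show ?thesis using ab by auto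
  qed
  have "card (\<Union>e\<in>E. {(x, u). {x, u} = e}) = (\<Sum>e\<in>E. card {(x, u). {x, u} = e})"
    by (rule card_UN_disjoint) (use assms B in auto)
  then show "card {(x, u). {x, u} \<in> E} = 2 * card E" using A B by simp
  show "finite {(x, u). {x, u} \<in> E}" unfolding A using assms B by blast
qed

lemma sum_card_nb:
  assumes sg: "simple_graph V E" and S: "S \<subseteq> V"
  shows "(\<Sum>v\<in>S. card (nb E v \<inter> T v)) = card {(x, u). {x, u} \<in> E \<and> x \<in> S \<and> u \<in> T x}"
proof -
  have "{(x, u). {x, u} \<in> E \<and> x \<in> S \<and> u \<in> T x} = Sigma S (\<lambda>x. nb E x \<inter> T x)"
    by (auto simp: nb_def)
  moreover have "finite S" using S sg simple_graph_finite finite_subset by metis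
  ultimately show ?thesis using simple_graph_nb_finite[OF sg] by simp
qed

lemma handshake:
  assumes sg: "simple_graph V E"
  shows "(\<Sum>v\<in>V. deg E v) = 2 * card E"
proof -
  have "{(x, u). {x, u} \<in> E \<and> x \<in> V \<and> u \<in> UNIV} = {(x, u). {x, u} \<in> E}"
    using sg by (auto simp: simple_graph_def)
  then show ?thesis
    using sum_card_nb[OF sg, of V "\<lambda>_. UNIV"] card_arcs(1)[OF simple_graph_finite_edges[OF sg]] sg
    by (simp add: simple_graph_def)
qed

lemma sum_degree_le:
  assumes sg: "simple_graph V E" and S: "S \<subseteq> V"
  shows "(\<Sum>v\<in>S. deg E v) \<le> 2 * card E"
  using handshake[OF sg] sum_mono2[OF simple_graph_finite[OF sg] S, of "\<lambda>v. deg E v"] by simp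

lemma card_high_degree:
  assumes sg: "simple_graph V E" and d: "\<And>v. v \<in> S \<Longrightarrow> d \<le> real (deg E v)" and S: "S \<subseteq> V"
  shows "d * real (card S) \<le> 2 * real (card E)"
proof -
  have "d * real (card S) = (\<Sum>v\<in>S. d)" by simp
  also have "\<dots> \<le> (\<Sum>v\<in>S. real (deg E v))" using d by (intro sum_mono) auto
  also have "\<dots> \<le> real (2 * card E)"
    using sum_degree_le[OF sg S] by (simp flip: of_nat_sum del: of_nat_mult)
  finally show ?thesis by simp
qed

text \<open>Weight 1 for a neighbour inside \<open>S\<close> and weight 2 for one outside makes
  every edge that meets \<open>S\<close> contribute exactly 2, whether it is seen from both ends or
  from one. The discharging arguments below (leaves, light vertices, spread candidates) start from
  this identity.\<close>

lemma sum_degree_touching: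
  assumes sg: "simple_graph V E" and S: "S \<subseteq> V"
  shows "(\<Sum>v\<in>S. card (nb E v \<inter> S) + 2 * card (nb E v - S)) = 2 * card {e \<in> E. e \<inter> S \<noteq> {}}"
proof -
  let ?E = "{e \<in> E. e \<inter> S \<noteq> {}}"
  have fE: "finite ?E" using sg by (simp add: simple_graph_finite_edges)
  have two: "card e = 2" if "e \<in> ?E" for e using that sg by (auto simp: simple_graph_def)
  have fin: "finite {(x, u). {x, u} \<in> E}" using card_arcs(2)[OF simple_graph_finite_edges[OF sg]] sg by (simp add: simple_graph_def)
  let ?A = "{(x, u). {x, u} \<in> E \<and> x \<in> S \<and> u \<in> S}"
  let ?B = "{(x, u). {x, u} \<in> E \<and> x \<in> S \<and> u \<in> - S}"
  let ?C = "{(x, u). {x, u} \<in> E \<and> x \<in> - S \<and> u \<in> S}"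
  have fABC: "finite ?A" "finite ?B" "finite ?C"
    by (rule finite_subset[OF _ fin]; auto)+
  have BC: "card ?B = card ?C"
  proof -
    have "?C = prod.swap ` ?B" by (auto simp: insert_commute image_def)
    then show ?thesis by (simp add: card_image inj_on_def)
  qed
  have "{(x, u). {x, u} \<in> ?E} = ?A \<union> (?B \<union> ?C)" by auto
  moreover have "card (?A \<union> (?B \<union> ?C)) = card ?A + (card ?B + card ?C)"
    using fABC by (subst card_Un_disjoint, auto)+
  ultimately have "2 * card ?E = card ?A + 2 * card ?B" using card_arcs(1)[OF fE two] BC by simp
  moreover have "(\<Sum>v\<in>S. card (nb E v \<inter> S)) = card ?A"
    using sum_card_nb[OF sg S, of "\<lambda>_. S"] by simp
  moreover have "(\<Sum>v\<in>S. card (nb E v - S)) = card ?B"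
    using sum_card_nb[OF sg S, of "\<lambda>_. - S"] by (simp add: Diff_eq)
  ultimately show ?thesis by (simp add: sum.distrib flip: sum_distrib_left)
qed

lemma max_degree_ge:
  assumes sg: "simple_graph V E"
  shows "deg E v \<le> max_degree V E"
proof (cases "v \<in> V")
  case True
  then show ?thesis using sg simple_graph_finite[OF sg]
    by (auto simp: max_degree_def degree_card_nb[OF sg, symmetric] intro!: Max_ge)
next
  case False
  then show ?thesis using simple_graph_nb_outside[OF sg] by simp
qed

lemma max_degree_attained:
  assumes sg: "simple_graph V E" and ne: "V \<noteq> {}"
  obtains v where "v \<in> V" "deg E v = max_degree V E"
proof -
  have "Max (insert 0 (degree E ` V)) \<in> insert 0 (degree E ` V)"
    using simple_graph_finite[OF sg] by (intro Max_in) auto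
  then consider "max_degree V E = 0" | v where "v \<in> V" "max_degree V E = degree E v"
    unfolding max_degree_def by auto
  then show ?thesis
  proof cases
    case 1
    obtain v where "v \<in> V" using ne by auto
    then show ?thesis using that[of v] max_degree_ge[OF sg, of v] 1 by simp
  next
    case 2
    then show ?thesis using that degree_card_nb[OF sg] by metis
  qed
qed

section \<open>Partial packings\<close>

definition partial_packing ::
  "'a set \<Rightarrow> 'a set set \<Rightarrow> 'b set \<Rightarrow> 'b set set \<Rightarrow> ('a \<times> 'b) set \<Rightarrow> bool" where
  "partial_packing V1 E1 V2 E2 M \<longleftrightarrow> M \<subseteq> V1 \<times> V2 \<and>
     (\<forall>x y x' y'. (x, y) \<in> M \<longrightarrow> (x', y') \<in> M \<longrightarrow>
        (x = x' \<longleftrightarrow> y = y') \<and> ({x, x'} \<in> E1 \<longrightarrow> {y, y'} \<notin> E2))"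

text \<open>An unplaced \<open>u\<close> must not be sent into \<open>forb E1 E2 M u\<close>; \<open>load\<close> bounds the size of this set and,
  unlike it, is additive in \<open>M\<close>.\<close>

definition load :: "'a set set \<Rightarrow> 'b set set \<Rightarrow> ('a \<times> 'b) set \<Rightarrow> 'a \<Rightarrow> nat" where
  "load E1 E2 M u = (\<Sum>p \<in> {p \<in> M. fst p \<in> nb E1 u}. deg E2 (snd p))"

definition forb :: "'a set set \<Rightarrow> 'b set set \<Rightarrow> ('a \<times> 'b) set \<Rightarrow> 'a \<Rightarrow> 'b set" where
  "forb E1 E2 M u = (\<Union>p \<in> {p \<in> M. fst p \<in> nb E1 u}. nb E2 (snd p))"

lemma partial_packing_finite:
  assumes "partial_packing V1 E1 V2 E2 M" "finite V1" "finite V2"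
  shows "finite M"
  using assms unfolding partial_packing_def by (meson finite_SigmaI finite_subset)

lemma partial_packing_converseI:
  assumes "partial_packing V1 E1 V2 E2 M"
  shows "partial_packing V2 E2 V1 E1 (M\<inverse>)"
  unfolding partial_packing_def
proof (intro conjI allI impI)
  show "M\<inverse> \<subseteq> V2 \<times> V1" using assms by (auto simp: partial_packing_def)
  fix x y x' y' assume "(x, y) \<in> M\<inverse>" "(x', y') \<in> M\<inverse>"
  then have *: "(y, x) \<in> M" "(y', x') \<in> M" by auto
  show "(x = x') = (y = y')" using assms * unfolding partial_packing_def by blast
  assume "{x, x'} \<in> E2" then show "{y, y'} \<notin> E1"
    using assms * unfolding partial_packing_def by blast
qed

lemma partial_packing_card:
  assumes "partial_packing V1 E1 V2 E2 M"
  shows "card (Domain M) = card M" "card (Range M) = card M"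
proof -
  have "inj_on fst M" "inj_on snd M"
    using assms unfolding inj_on_def partial_packing_def by (metis prod.collapse)+
  then show "card (Domain M) = card M" "card (Range M) = card M"
    by (metis Domain_fst card_image, metis Range_snd card_image)
qed

lemma partial_packing_empty: "partial_packing V1 E1 V2 E2 {}"
  by (simp add: partial_packing_def)

lemma forb_iff: "y \<in> forb E1 E2 M u \<longleftrightarrow> (\<exists>x' y'. (x', y') \<in> M \<and> {u, x'} \<in> E1 \<and> {y', y} \<in> E2)"
  by (auto simp: forb_def nb_def)

text \<open>Forbiddenness is a symmetric relation of pairs. The exchange argument uses this to
  bound, from the side of the second graph, the vertices that may not receive a given image.\<close>

lemma forb_converse: "y \<in> forb E1 E2 M u \<longleftrightarrow> u \<in> forb E2 E1 (M\<inverse>) y"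
  by (auto simp: forb_iff insert_commute)

lemma partial_packing_insert:
  assumes "partial_packing V1 E1 V2 E2 M" "simple_graph V1 E1"
    and "u \<in> V1 - Domain M" "y \<in> V2 - Range M" "y \<notin> forb E1 E2 M u"
  shows "partial_packing V1 E1 V2 E2 (insert (u, y) M)"
proof -
  have "{u, u} \<notin> E1" using simple_graph_nb_self[OF assms(2)] by (simp add: nb_def)
  then show ?thesis
    using assms(1,3,4,5) unfolding partial_packing_def forb_iff
    by (auto simp: insert_commute Domain_iff Range_iff)
qed

lemma load_insert:
  assumes "finite M" "(x, y) \<notin> M"
  shows "load E1 E2 (insert (x, y) M) u = load E1 E2 M u + (if x \<in> nb E1 u then deg E2 y else 0)"
proof -
  have "{p \<in> insert (x, y) M. fst p \<in> nb E1 u} =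
      (if x \<in> nb E1 u then insert (x, y) {p \<in> M. fst p \<in> nb E1 u} else {p \<in> M. fst p \<in> nb E1 u})"
    by auto
  then show ?thesis using assms by (auto simp: load_def)
qed

lemma load_Un:
  assumes "finite M" "finite M'" "M \<inter> M' = {}"
  shows "load E1 E2 (M \<union> M') u = load E1 E2 M u + load E1 E2 M' u"
proof -
  have "{p \<in> M \<union> M'. fst p \<in> nb E1 u} = {p \<in> M. fst p \<in> nb E1 u} \<union> {p \<in> M'. fst p \<in> nb E1 u}" by auto
  then show ?thesis using assms by (auto simp: load_def intro!: sum.union_disjoint)
qed

lemma load_extend:
  assumes "finite M'" "M \<subseteq> M'"
  shows "load E1 E2 M' u = load E1 E2 M u + load E1 E2 (M' - M) u"
  using load_Un[of M "M' - M" E1 E2 u] assms by (simp add: finite_subset Un_absorb1)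

lemma card_forb_le_load:
  assumes "finite M"
  shows "card (forb E1 E2 M u) \<le> load E1 E2 M u"
  unfolding forb_def load_def by (rule card_UN_le) (use assms in simp)

lemma load_eq_sum:
  assumes "finite M"
  shows "load E1 E2 M u = (\<Sum>p\<in>M. if fst p \<in> nb E1 u then deg E2 (snd p) else 0)"
  unfolding load_def using assms by (simp add: sum.inter_filter)

lemma load_le_count:
  assumes fin: "finite M" and pp: "partial_packing V1 E1 V2 E2 M"
    and D: "\<And>x y. (x, y) \<in> M \<Longrightarrow> x \<in> nb E1 u \<Longrightarrow> deg E2 y \<le> D"
  shows "load E1 E2 M u \<le> card (Domain M \<inter> nb E1 u) * D"
proof -
  have inj: "inj_on fst {p \<in> M. fst p \<in> nb E1 u}"
    using pp unfolding inj_on_def partial_packing_def by (metis (lifting) mem_Collect_eq prod.collapse)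
  have "fst ` {p \<in> M. fst p \<in> nb E1 u} = Domain M \<inter> nb E1 u" by force
  then have "card {p \<in> M. fst p \<in> nb E1 u} = card (Domain M \<inter> nb E1 u)"
    using card_image[OF inj] by simp
  moreover have "deg E2 (snd p) \<le> D" if "p \<in> {p \<in> M. fst p \<in> nb E1 u}" for p
    using D[of "fst p" "snd p"] that by simp
  ultimately show ?thesis unfolding load_def
    using sum_bounded_above[of "{p \<in> M. fst p \<in> nb E1 u}" "\<lambda>p. deg E2 (snd p)" D] by simp
qed

lemma full_packing_packs:
  assumes pp: "partial_packing V1 E1 V2 E2 M" and fin: "finite V1" "finite V2"
    and c: "card M = card V1" "card V1 = card V2"
  shows "packs V1 E1 V2 E2"
proof -
  have sub: "Domain M \<subseteq> V1" "Range M \<subseteq> V2" using pp by (auto simp: partial_packing_def)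
  have D: "Domain M = V1" "Range M = V2"
    using sub partial_packing_card[OF pp] c fin by (simp_all add: card_subset_eq)
  have "\<forall>x\<in>V1. \<exists>y. (x, y) \<in> M" using D by blast
  then obtain f where f: "\<And>x. x \<in> V1 \<Longrightarrow> (x, f x) \<in> M" by metis
  have "bij_betw f V1 V2"
    unfolding bij_betw_def
  proof
    show inj: "inj_on f V1" using f pp unfolding inj_on_def partial_packing_def by blast
    have "f ` V1 \<subseteq> V2" using f sub by blast
    then show "f ` V1 = V2" using inj fin c by (simp add: card_image card_subset_eq)
  qed
  then show ?thesis using f pp unfolding packs_def partial_packing_def by blast
qed

lemma packs_sym:
  assumes "packs V1 E1 V2 E2"
  shows "packs V2 E2 V1 E1"
proof -
  obtain f where f: "bij_betw f V1 V2" "\<And>u v. u \<in> V1 \<Longrightarrow> v \<in> V1 \<Longrightarrow> {u, v} \<in> E1 \<Longrightarrow> {f u, f v} \<notin> E2"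
    using assms unfolding packs_def by blast
  let ?g = "inv_into V1 f"
  have "bij_betw ?g V2 V1" using f(1) by (rule bij_betw_inv_into)
  moreover have "\<forall>u\<in>V2. \<forall>v\<in>V2. {u, v} \<in> E2 \<longrightarrow> {?g u, ?g v} \<notin> E1"
  proof (intro ballI impI)
    fix u v assume uv: "u \<in> V2" "v \<in> V2" "{u, v} \<in> E2"
    then have "?g u \<in> V1" "?g v \<in> V1" "f (?g u) = u" "f (?g v) = v"
      using f(1) bij_betw_inv_into[OF f(1)] by (auto simp: bij_betw_inv_into_right bij_betw_apply)
    then show "{?g u, ?g v} \<notin> E1" using f(2)[of "?g u" "?g v"] uv by auto
  qed
  ultimately show ?thesis unfolding packs_def by blast
qed

section \<open>Greedy embeddings\<close>

text \<open>Every placed pair adds the degree of its image to the load of each neighbour of its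
  first component; summing over the pairs first gives the right-hand side. With \<open>k\<close> the
  number of neighbouring candidates it bounds the blocked targets in
  \<open>greedy_embedding\<close>, with constant \<open>k\<close> it yields
  \<open>card_high_load\<close>.\<close>

lemma sum_load_weighted:
  assumes sg: "simple_graph V1 E1" and fin: "finite M" and S: "S \<subseteq> V1"
  shows "(\<Sum>u\<in>S. load E1 E2 M u * k u) =
    (\<Sum>p\<in>M. (\<Sum>u\<in>nb E1 (fst p) \<inter> S. k u) * deg E2 (snd p))"
proof -
  have fS: "finite S" using S sg simple_graph_finite finite_subset by metis
  have "(\<Sum>u\<in>S. load E1 E2 M u * k u) =
      (\<Sum>u\<in>S. \<Sum>p\<in>M. if fst p \<in> nb E1 u then k u * deg E2 (snd p) else 0)"
    unfolding load_eq_sum[OF fin] by (auto simp: sum_distrib_right intro!: sum.cong)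
  also have "\<dots> = (\<Sum>p\<in>M. \<Sum>u\<in>S. if fst p \<in> nb E1 u then k u * deg E2 (snd p) else 0)"
    by (rule sum.swap)
  also have "\<dots> = (\<Sum>p\<in>M. (\<Sum>u\<in>nb E1 (fst p) \<inter> S. k u) * deg E2 (snd p))"
  proof (rule sum.cong[OF refl])
    fix p assume "p \<in> M"
    have "{u \<in> S. fst p \<in> nb E1 u} = nb E1 (fst p) \<inter> S" using nb_sym[of _ E1] by blast
    then show "(\<Sum>u\<in>S. if fst p \<in> nb E1 u then k u * deg E2 (snd p) else 0)
        = (\<Sum>u\<in>nb E1 (fst p) \<inter> S. k u) * deg E2 (snd p)"
      using fS by (simp add: sum_distrib_right flip: sum.inter_filter)
  qed
  finally show ?thesis .
qed

text \<open>A positive sum of degrees dominates one of its terms. When vertices are placed by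
  decreasing degree, this compares an old load with the next increment.\<close>

lemma load_pos_witness:
  assumes "finite M" "0 < load E1 E2 M u"
  obtains x y where "(x, y) \<in> M" "x \<in> nb E1 u" "deg E2 y \<le> load E1 E2 M u"
proof -
  let ?S = "{p \<in> M. fst p \<in> nb E1 u}"
  have "?S \<noteq> {}" using assms(2) unfolding load_def by (metis less_irrefl sum.empty)
  then obtain p where p: "p \<in> ?S" by auto
  then have "deg E2 (snd p) \<le> load E1 E2 M u"
    unfolding load_def using assms(1) by (intro member_le_sum) auto
  then show ?thesis using that[of "fst p" "snd p"] p by simp
qed

text \<open>Vertices of \<open>B\<close> are embedded greedily into \<open>L\<close> by decreasing degree. A target is avoided when it
  is adjacent to an unused vertex whose load has already reached \<open>\<gamma> / 2\<close>; by the ordering, a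
  vertex with positive smaller load receives an increment below \<open>\<gamma> / 2\<close>.\<close>

lemma greedy_embedding:
  fixes \<gamma> \<omega> bb :: real and l :: nat
  assumes sg1: "simple_graph V1 E1" and sg2: "simple_graph V2 E2"
    and pp: "partial_packing V1 E1 V2 E2 M"
    and L: "L \<subseteq> V2 - Range M"
    and l: "\<And>w. w \<in> L \<Longrightarrow> card (nb E2 w \<inter> L) \<le> l"
    and om: "\<And>w. w \<in> L \<Longrightarrow> real (\<Sum>y\<in>nb E2 w - Range M. card (nb E2 y \<inter> L)) \<le> \<omega>"
    and pos: "\<gamma> > 0" "\<omega> \<ge> 0" "bb \<ge> 0"
    and B: "B \<subseteq> V1 - Domain M"
    and bb: "bb * bb \<ge> 2 * real (card E1) \<or> bb \<ge> real (card B)"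
    and room: "\<And>v. v \<in> B \<Longrightarrow> real (card (forb E1 E2 M v \<inter> L)) + real (card B) + real l * bb
      + 2 / \<gamma> * \<omega> * real (\<Sum>v\<in>B. deg E1 v) \<le> real (card L)"
  shows "\<exists>M'. partial_packing V1 E1 V2 E2 M' \<and> M \<subseteq> M' \<and> M' - M \<subseteq> B \<times> L \<and>
     Domain M' = Domain M \<union> B \<and>
     (\<forall>y\<in>V2 - Range M'. real (load E2 E1 ((M' - M)\<inverse>) y) \<le> \<gamma> \<or>
        (\<exists>v w. (v, w) \<in> M' - M \<and> w \<in> nb E2 y \<and> load E2 E1 ((M' - M)\<inverse>) y = deg E1 v))"
  using B bb room
proof (induction "card B" arbitrary: B)
  case 0
  have "finite B" using 0(2) simple_graph_finite[OF sg1] finite_subset by blast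
  then have "B = {}" using 0(1) by simp
  then show ?case using pp pos by (intro exI[of _ M]) (auto simp: load_def)
next
  case (Suc k)
  have fin1: "finite V1" and fin2: "finite V2" using sg1 sg2 simple_graph_finite by auto
  have fB: "finite B" using Suc(3) fin1 finite_subset by blast
  have fL: "finite L" using L fin2 finite_subset by blast
  have "B \<noteq> {}" using Suc(2) by auto
  \<comment> \<open>A vertex of least degree is split off and placed last, so the induction places
    \<open>B\<close> by decreasing degree.\<close>
  then obtain v where v: "v \<in> B" and vmin: "\<And>v'. v' \<in> B \<Longrightarrow> deg E1 v \<le> deg E1 v'"
    using ex_min_if_finite[of "(\<lambda>v. deg E1 v) ` B"] fB
    by (metis (no_types, lifting) ex_is_arg_min_if_finite is_arg_min_linorder)
  define B' where "B' = B - {v}"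
  have cB': "card B' = k" "card B = Suc k" using Suc(2) v fB by (auto simp: B'_def)
  have fB': "finite B'" using fB by (simp add: B'_def)
  have sumB': "(\<Sum>v\<in>B'. deg E1 v) \<le> (\<Sum>v\<in>B. deg E1 v)"
    by (rule sum_mono2[OF fB]) (auto simp: B'_def)
  have "\<exists>M'. partial_packing V1 E1 V2 E2 M' \<and> M \<subseteq> M' \<and> M' - M \<subseteq> B' \<times> L \<and>
     Domain M' = Domain M \<union> B' \<and>
     (\<forall>y\<in>V2 - Range M'. real (load E2 E1 ((M' - M)\<inverse>) y) \<le> \<gamma> \<or>
        (\<exists>v w. (v, w) \<in> M' - M \<and> w \<in> nb E2 y \<and> load E2 E1 ((M' - M)\<inverse>) y = deg E1 v))"
  proof (rule Suc(1))
    show "k = card B'" using cB' by simp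
    show "B' \<subseteq> V1 - Domain M" using Suc(3) by (auto simp: B'_def)
    show "2 * real (card E1) \<le> bb * bb \<or> real (card B') \<le> bb"
      using Suc(4) cB' by auto
    fix u assume "u \<in> B'"
    then have u: "u \<in> B" by (simp add: B'_def)
    have "2 / \<gamma> * \<omega> * real (\<Sum>v\<in>B'. deg E1 v) \<le> 2 / \<gamma> * \<omega> * real (\<Sum>v\<in>B. deg E1 v)"
      using pos sumB' by (intro mult_left_mono) (auto simp del: of_nat_sum)
    then show "real (card (forb E1 E2 M u \<inter> L)) + real (card B') + real l * bb
      + 2 / \<gamma> * \<omega> * real (\<Sum>v\<in>B'. deg E1 v) \<le> real (card L)"
      using Suc(5)[OF u] cB' by simp
  qed
  then obtain M' where M': "partial_packing V1 E1 V2 E2 M'" "M \<subseteq> M'" "M' - M \<subseteq> B' \<times> L"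
     "Domain M' = Domain M \<union> B'"
     "\<forall>y\<in>V2 - Range M'. real (load E2 E1 ((M' - M)\<inverse>) y) \<le> \<gamma> \<or>
        (\<exists>v w. (v, w) \<in> M' - M \<and> w \<in> nb E2 y \<and> load E2 E1 ((M' - M)\<inverse>) y = deg E1 v)"
    by blast
  define D where "D = M' - M"
  define A where "A = load E2 E1 (D\<inverse>)"
  have fM': "finite M'" using partial_packing_finite[OF M'(1) fin1 fin2] .
  have fD: "finite D" using fM' by (simp add: D_def)
  have DB: "D \<subseteq> B' \<times> L" using M'(3) by (simp add: D_def)
  have injf: "inj_on fst M'"
    using M'(1) unfolding inj_on_def partial_packing_def by (metis prod.collapse)
  have injD: "inj_on fst D" by (rule inj_on_subset[OF injf]) (auto simp: D_def)
  define U where "U = {y \<in> V2 - Range M'. \<gamma> / 2 \<le> real (A y)}"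
  have fU: "finite U" using fin2 by (simp add: U_def)
  define Z where "Z = (forb E1 E2 M' v \<inter> L) \<union> (Range M' \<inter> L) \<union> (\<Union>y\<in>U. nb E2 y \<inter> L)"
  have Z1: "card (Range M' \<inter> L) \<le> k"
  proof -
    have "Range M' \<inter> L \<subseteq> snd ` D" using L by (force simp: D_def Range_iff)
    then have "card (Range M' \<inter> L) \<le> card D"
      using fD by (meson card_image_le card_mono finite_imageI le_trans)
    also have "card D = card (fst ` D)" using injD by (simp add: card_image)
    also have "\<dots> \<le> card B'" using DB fB' by (intro card_mono) auto
    finally show ?thesis using cB' by simp
  qed
  define c where "c = card (nb E1 v \<inter> B')"
  \<comment> \<open>The \<open>c\<close> neighbours of \<open>v\<close> in \<open>B'\<close> all
    have degree at least that of \<open>v\<close>, which is at least c; hence c^2 is at most the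
    degree sum 2 |E1|.\<close>
  have cbb: "real c \<le> bb"
  proof (rule disjE[OF Suc(4)])
    assume *: "2 * real (card E1) \<le> bb * bb"
    have c1: "c \<le> deg E1 v"
      unfolding c_def using simple_graph_nb_finite[OF sg1] by (intro card_mono) auto
    have "c * deg E1 v = (\<Sum>v'\<in>nb E1 v \<inter> B'. deg E1 v)" by (simp add: c_def)
    also have "\<dots> \<le> (\<Sum>v'\<in>nb E1 v \<inter> B'. deg E1 v')"
      using vmin by (intro sum_mono) (auto simp: B'_def)
    also have "\<dots> \<le> 2 * card E1"
      using sum_degree_le[OF sg1, of "nb E1 v \<inter> B'"] simple_graph_nb_subset[OF sg1] by blast
    finally have "c * c \<le> 2 * card E1" using c1 by (meson le_trans mult_le_mono2)
    then have "real c * real c \<le> bb * bb" using * by (metis of_nat_le_iff of_nat_mult of_nat_numeral order_trans)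
    then show ?thesis using pos(3) by (metis abs_le_square_iff abs_of_nat abs_of_nonneg power2_eq_square)
  next
    assume *: "real (card B) \<le> bb"
    have "c \<le> card B'" unfolding c_def using fB' by (intro card_mono) auto
    then show ?thesis using * cB' by simp
  qed
  have Z2: "card (forb E1 E2 M' v \<inter> L) \<le> card (forb E1 E2 M v \<inter> L) + l * c"
  proof -
    let ?D = "{p \<in> D. fst p \<in> nb E1 v}"
    have sub: "forb E1 E2 M' v \<inter> L \<subseteq> (forb E1 E2 M v \<inter> L) \<union> (\<Union>p\<in>?D. nb E2 (snd p) \<inter> L)"
      by (auto simp: forb_def D_def)
    have "card (\<Union>p\<in>?D. nb E2 (snd p) \<inter> L) \<le> (\<Sum>p\<in>?D. card (nb E2 (snd p) \<inter> L))"
      using fD by (intro card_UN_le) auto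
    also have "\<dots> \<le> (\<Sum>p\<in>?D. l)" using DB l by (intro sum_mono) auto
    also have "\<dots> = card ?D * l" by simp
    also have "card ?D = card (fst ` ?D)"
      using inj_on_subset[OF injD, of ?D] by (simp add: card_image)
    also have "\<dots> \<le> c" unfolding c_def using DB fB' by (intro card_mono) auto
    finally have "card (\<Union>p\<in>?D. nb E2 (snd p) \<inter> L) \<le> l * c" by (simp add: mult.commute)
    moreover have "card (forb E1 E2 M' v \<inter> L) \<le> card ((forb E1 E2 M v \<inter> L) \<union> (\<Union>p\<in>?D. nb E2 (snd p) \<inter> L))"
      using sub fL fD by (intro card_mono) auto
    ultimately show ?thesis using card_Un_le[of "forb E1 E2 M v \<inter> L" "\<Union>p\<in>?D. nb E2 (snd p) \<inter> L"] by linarith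
  qed
  have Z3: "real (card (\<Union>y\<in>U. nb E2 y \<inter> L)) \<le> 2 / \<gamma> * \<omega> * real (\<Sum>v\<in>B. deg E1 v)"
  proof -
    have "real (card (\<Union>y\<in>U. nb E2 y \<inter> L)) \<le> (\<Sum>y\<in>U. real (card (nb E2 y \<inter> L)))"
      using card_UN_le[OF fU, of "\<lambda>y. nb E2 y \<inter> L"] by (simp flip: of_nat_sum)
    also have "\<dots> \<le> (\<Sum>y\<in>U. 2 / \<gamma> * real (A y * card (nb E2 y \<inter> L)))"
    proof (rule sum_mono)
      fix y assume "y \<in> U"
      then have "1 \<le> 2 / \<gamma> * real (A y)" using pos by (auto simp: U_def field_simps)
      then show "real (card (nb E2 y \<inter> L)) \<le> 2 / \<gamma> * real (A y * card (nb E2 y \<inter> L))"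
        using mult_right_mono[of 1 "2 / \<gamma> * real (A y)" "real (card (nb E2 y \<inter> L))"] by simp
    qed
    also have "\<dots> = 2 / \<gamma> * real (\<Sum>y\<in>U. A y * card (nb E2 y \<inter> L))"
      by (simp add: sum_distrib_left)
    also have "\<dots> \<le> 2 / \<gamma> * (\<omega> * real (\<Sum>v\<in>B. deg E1 v))"
    proof (rule mult_left_mono)
      have U2: "U \<subseteq> V2" by (auto simp: U_def)
      have "(\<Sum>y\<in>U. A y * card (nb E2 y \<inter> L)) =
          (\<Sum>p\<in>D\<inverse>. (\<Sum>y\<in>nb E2 (fst p) \<inter> U. card (nb E2 y \<inter> L)) * deg E1 (snd p))"
        unfolding A_def by (rule sum_load_weighted[OF sg2]) (use fD U2 in auto)
      then have "real (\<Sum>y\<in>U. A y * card (nb E2 y \<inter> L)) =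
          (\<Sum>p\<in>D\<inverse>. real (\<Sum>y\<in>nb E2 (fst p) \<inter> U. card (nb E2 y \<inter> L)) * real (deg E1 (snd p)))"
        by simp
      also have "\<dots> \<le> (\<Sum>p\<in>D\<inverse>. \<omega> * real (deg E1 (snd p)))"
      proof (intro sum_mono mult_right_mono)
        fix p assume "p \<in> D\<inverse>"
        then have w: "fst p \<in> L" using DB by auto
        have "(\<Sum>y\<in>nb E2 (fst p) \<inter> U. card (nb E2 y \<inter> L)) \<le> (\<Sum>y\<in>nb E2 (fst p) - Range M. card (nb E2 y \<inter> L))"
          using simple_graph_nb_finite[OF sg2] M'(2) by (intro sum_mono2) (auto simp: U_def)
        then show "real (\<Sum>y\<in>nb E2 (fst p) \<inter> U. card (nb E2 y \<inter> L)) \<le> \<omega>"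
          using om[OF w] by (meson of_nat_le_iff order_trans)
      qed simp
      also have "\<dots> = \<omega> * (\<Sum>p\<in>D\<inverse>. real (deg E1 (snd p)))" by (simp add: sum_distrib_left)
      also have "(\<Sum>p\<in>D\<inverse>. real (deg E1 (snd p))) = (\<Sum>p\<in>D. real (deg E1 (fst p)))"
      proof -
        have "D\<inverse> = prod.swap ` D" by auto
        moreover have "inj_on prod.swap D" by (auto simp: inj_on_def)
        ultimately show ?thesis by (simp add: sum.reindex)
      qed
      also have "\<dots> = (\<Sum>v\<in>fst ` D. real (deg E1 v))" using injD by (simp add: sum.reindex)
      also have "\<omega> * \<dots> \<le> \<omega> * (\<Sum>v\<in>B. real (deg E1 v))"
        using DB fB pos by (intro mult_left_mono sum_mono2) (auto simp: B'_def)
      finally show "real (\<Sum>y\<in>U. A y * card (nb E2 y \<inter> L)) \<le> \<omega> * real (\<Sum>v\<in>B. deg E1 v)" by simp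
    qed (use pos in simp)
    finally show ?thesis by simp
  qed
  have "real (card Z) < real (card L)"
  proof -
    have "card Z \<le> card (forb E1 E2 M' v \<inter> L) + card (Range M' \<inter> L) + card (\<Union>y\<in>U. nb E2 y \<inter> L)"
      unfolding Z_def by (meson card_Un_le add_mono le_trans order_refl)
    then have "real (card Z) \<le> real (card (forb E1 E2 M v \<inter> L)) + real l * real c + real k
       + 2 / \<gamma> * \<omega> * real (\<Sum>v\<in>B. deg E1 v)"
      using Z1 Z2 Z3 by (simp flip: of_nat_add of_nat_mult add: of_nat_le_iff del: of_nat_sum)
    moreover have "real l * real c \<le> real l * bb" using cbb by (intro mult_left_mono) auto
    ultimately show ?thesis using Suc(5)[OF v] cB' by (simp del: of_nat_sum)
  qed
  moreover have "Z \<subseteq> L" by (auto simp: Z_def)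
  ultimately obtain w where w: "w \<in> L" "w \<notin> Z" by (metis less_irrefl subsetI subset_antisym)
  have wV: "w \<in> V2 - Range M'" "w \<notin> forb E1 E2 M' v" "\<And>y. y \<in> U \<Longrightarrow> w \<notin> nb E2 y"
    using w L by (auto simp: Z_def)
  have vV: "v \<in> V1 - Domain M'" using v Suc(3) M'(4) by (auto simp: B'_def)
  define M'' where "M'' = insert (v, w) M'"
  have ppM'': "partial_packing V1 E1 V2 E2 M''"
    unfolding M''_def using partial_packing_insert[OF M'(1) sg1 vV wV(1) wV(2)] .
  have vwM: "(v, w) \<notin> M'" using vV by auto
  have diff: "M'' - M = insert (v, w) D" using vwM M'(2) by (auto simp: M''_def D_def)
  have loadM'': "load E2 E1 ((M'' - M)\<inverse>) y = A y + (if w \<in> nb E2 y then deg E1 v else 0)" for y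
  proof -
    have "(insert (v, w) D)\<inverse> = insert (w, v) (D\<inverse>)" by auto
    moreover have "(w, v) \<notin> D\<inverse>" using vwM by (auto simp: D_def)
    ultimately show ?thesis unfolding diff A_def using load_insert[of "D\<inverse>" w v] fD by simp
  qed
  have "\<forall>y\<in>V2 - Range M''. real (load E2 E1 ((M'' - M)\<inverse>) y) \<le> \<gamma> \<or>
        (\<exists>v w. (v, w) \<in> M'' - M \<and> w \<in> nb E2 y \<and> load E2 E1 ((M'' - M)\<inverse>) y = deg E1 v)"
  proof
    fix y assume "y \<in> V2 - Range M''"
    then have y: "y \<in> V2 - Range M'" by (auto simp: M''_def)
    show "real (load E2 E1 ((M'' - M)\<inverse>) y) \<le> \<gamma> \<or>
        (\<exists>v w. (v, w) \<in> M'' - M \<and> w \<in> nb E2 y \<and> load E2 E1 ((M'' - M)\<inverse>) y = deg E1 v)"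
    proof (cases "w \<in> nb E2 y")
      case False
      then have eq: "load E2 E1 ((M'' - M)\<inverse>) y = load E2 E1 ((M' - M)\<inverse>) y"
        using loadM'' by (simp add: A_def D_def)
      have sub: "M' - M \<subseteq> M'' - M" by (auto simp: M''_def)
      show ?thesis unfolding eq using M'(5) y sub by blast
    next
      case True
      then have "y \<notin> U" using wV(3) by blast
      then have Ay: "real (A y) < \<gamma> / 2" using y by (auto simp: U_def)
      show ?thesis
      proof (cases "A y = 0")
        case True
        then have "load E2 E1 ((M'' - M)\<inverse>) y = deg E1 v" using loadM'' \<open>w \<in> nb E2 y\<close> by simp
        then show ?thesis using diff \<open>w \<in> nb E2 y\<close> by blast
      next
        case False
        \<comment> \<open>A positive old load is at least the degree of an earlier vertex, hence at
          least the degree of \<open>v\<close>. So the old load and the increment are both below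
          \<gamma> / 2.\<close>
        then obtain w' v' where "(w', v') \<in> D\<inverse>" "deg E1 v' \<le> A y"
          using load_pos_witness[of "D\<inverse>" E2 E1 y] fD unfolding A_def by (metis finite_converse gr0I)
        then have "deg E1 v \<le> A y" using DB vmin[of v'] by (auto simp: B'_def)
        then have "real (load E2 E1 ((M'' - M)\<inverse>) y) \<le> \<gamma>" using loadM''[of y] Ay by (auto split: if_splits)
        then show ?thesis by blast
      qed
    qed
  qed
  moreover have "M'' - M \<subseteq> B \<times> L" using diff DB v w by (auto simp: B'_def)
  moreover have "Domain M'' = Domain M \<union> B" using M'(4) v by (auto simp: M''_def B'_def)
  ultimately show ?case using ppM'' M'(2) by (intro exI[of _ M'']) (auto simp: M''_def)
qed

text \<open>For few vertices the load need not be controlled: \<gamma> is taken so large that the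
  load term of \<open>room\<close> is at most 1, which the strict inequality absorbs, and
  \<open>card B\<close> bounds the number of placed neighbours.\<close>

lemma greedy_embedding_few:
  assumes sg1: "simple_graph V1 E1" and sg2: "simple_graph V2 E2"
    and pp: "partial_packing V1 E1 V2 E2 M"
    and L: "L \<subseteq> V2 - Range M" and B: "B \<subseteq> V1 - Domain M"
    and l: "\<And>w. w \<in> L \<Longrightarrow> deg E2 w \<le> l"
    and room: "\<And>v. v \<in> B \<Longrightarrow> card (forb E1 E2 M v \<inter> L) + card B + l * card B < card L"
  shows "\<exists>M'. partial_packing V1 E1 V2 E2 M' \<and> M \<subseteq> M' \<and> M' - M \<subseteq> B \<times> L \<and>
     Domain M' = Domain M \<union> B"
proof -
  have fin1: "finite V1" and fin2: "finite V2" using sg1 sg2 simple_graph_finite by auto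
  have fL: "finite L" using L fin2 finite_subset by blast
  define \<omega> where "\<omega> = real (\<Sum>w\<in>L. \<Sum>y\<in>nb E2 w - Range M. card (nb E2 y \<inter> L))"
  define S where "S = real (\<Sum>v\<in>B. deg E1 v)"
  define \<gamma> where "\<gamma> = 2 * \<omega> * S + 1"
  have nn: "\<omega> \<ge> 0" "S \<ge> 0" unfolding \<omega>_def S_def by (rule of_nat_0_le_iff)+
  then have "\<omega> * S \<ge> 0" by simp
  then have g: "\<gamma> > 0" "2 / \<gamma> * \<omega> * S \<le> 1" by (auto simp: \<gamma>_def field_simps)
  have "\<exists>M'. partial_packing V1 E1 V2 E2 M' \<and> M \<subseteq> M' \<and> M' - M \<subseteq> B \<times> L \<and>
     Domain M' = Domain M \<union> B \<and>
     (\<forall>y\<in>V2 - Range M'. real (load E2 E1 ((M' - M)\<inverse>) y) \<le> \<gamma> \<or>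
        (\<exists>v w. (v, w) \<in> M' - M \<and> w \<in> nb E2 y \<and> load E2 E1 ((M' - M)\<inverse>) y = deg E1 v))"
  proof (rule greedy_embedding[OF sg1 sg2 pp L _ _ g(1) nn(1) _ B, where bb = "real (card B)" and l = l])
    fix w assume w: "w \<in> L"
    show "card (nb E2 w \<inter> L) \<le> l"
      using l[OF w] simple_graph_nb_finite[OF sg2] by (meson Int_lower1 card_mono le_trans)
    have "(\<Sum>y\<in>nb E2 w - Range M. card (nb E2 y \<inter> L))
        \<le> (\<Sum>w\<in>L. \<Sum>y\<in>nb E2 w - Range M. card (nb E2 y \<inter> L))"
      using w fL by (intro member_le_sum) auto
    then show "real (\<Sum>y\<in>nb E2 w - Range M. card (nb E2 y \<inter> L)) \<le> \<omega>"
      unfolding \<omega>_def by (simp only: of_nat_le_iff)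
  next
    fix v assume "v \<in> B"
    then have "real (card (forb E1 E2 M v \<inter> L)) + real (card B) + real l * real (card B) + 1 \<le> real (card L)"
      using room[of v] by (simp flip: of_nat_mult of_nat_add of_nat_Suc)
    then show "real (card (forb E1 E2 M v \<inter> L)) + real (card B) + real l * real (card B)
      + 2 / \<gamma> * \<omega> * real (\<Sum>v\<in>B. deg E1 v) \<le> real (card L)"
      using g(2) unfolding S_def by linarith
  qed auto
  then show ?thesis by blast
qed

section \<open>Completion by exchanges\<close>

text \<open>A completion with the fewest violated constraints violates none: fewer vertices \<open>x\<close> than there are
  unplaced ones are excluded from exchanging images with a vertex involved in a violation.\<close>

lemma swap_completion:
  assumes sg1: "simple_graph V1 E1" and sg2: "simple_graph V2 E2" and cV: "card V1 = card V2"
    and pp: "partial_packing V1 E1 V2 E2 M"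
    and q: "\<And>u. u \<in> V1 - Domain M \<Longrightarrow> deg E1 u \<le> q"
    and D: "\<And>y. y \<in> V2 - Range M \<Longrightarrow> deg E2 y \<le> D"
    and g: "\<And>u. u \<in> V1 - Domain M \<Longrightarrow> card (forb E1 E2 M u) \<le> g"
    and f: "\<And>y. y \<in> V2 - Range M \<Longrightarrow> card (forb E2 E1 (M\<inverse>) y) \<le> f"
    and room: "g + f + 2 * q * D + q + 1 + card M < card V1"
  shows "packs V1 E1 V2 E2"
proof -
  have fin1: "finite V1" and fin2: "finite V2" using sg1 sg2 simple_graph_finite by auto
  have fM: "finite M" using partial_packing_finite[OF pp fin1 fin2] .
  have sub: "Domain M \<subseteq> V1" "Range M \<subseteq> V2" using pp by (auto simp: partial_packing_def)
  define R1 where "R1 = V1 - Domain M"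
  define R2 where "R2 = V2 - Range M"
  have fR: "finite R1" "finite R2" using fin1 fin2 by (auto simp: R1_def R2_def)
  have cR1: "card R1 = card V1 - card M"
    using sub fin1 partial_packing_card[OF pp] by (simp add: R1_def card_Diff_subset finite_subset)
  have cR: "card R1 = card R2"
    using cR1 sub fin2 partial_packing_card[OF pp] cV by (simp add: R2_def card_Diff_subset finite_subset)
  \<comment> \<open>Ordered pairs: a violated edge appears from both ends, so a violation can always
    be charged to its first vertex.\<close>
  define viol where "viol h = {(u, x). u \<in> R1 \<and> x \<in> R1 \<and> x \<in> nb E1 u \<and> h x \<in> nb E2 (h u)}" for h :: "'a \<Rightarrow> 'b"
  define lviol where "lviol h = {u \<in> R1. h u \<in> forb E1 E2 M u}" for h :: "'a \<Rightarrow> 'b"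
  have fviol: "finite (viol h)" "finite (lviol h)" for h
    using fR by (auto simp: viol_def lviol_def intro: finite_subset[of _ "R1 \<times> R1"])
  obtain h0 where "bij_betw h0 R1 R2" using finite_same_card_bij fR cR by blast
  then obtain h where h: "bij_betw h R1 R2"
      and hmin: "\<And>h'. bij_betw h' R1 R2 \<Longrightarrow> card (viol h) + card (lviol h) \<le> card (viol h') + card (lviol h')"
    using ex_has_least_nat[of "\<lambda>h. bij_betw h R1 R2" h0 "\<lambda>h. card (viol h) + card (lviol h)"] by blast
  have inj: "inj_on h R1" and hR: "\<And>x. x \<in> R1 \<Longrightarrow> h x \<in> R2" using h by (auto simp: bij_betw_def)
  have pre: "card {w \<in> R1. h w \<in> S} \<le> card S" if "finite S" for S
    using card_inj_on_le[of h "{w \<in> R1. h w \<in> S}" S] inj that by (auto simp: inj_on_def)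
  have none: "viol h = {} \<and> lviol h = {}"
  proof (rule ccontr)
    assume "\<not> ?thesis"
    then obtain u where u: "u \<in> R1" and uv: "u \<in> lviol h \<or> (\<exists>x. (u, x) \<in> viol h)"
      by (auto simp: viol_def lviol_def)
    \<comment> \<open>Bad partners for an exchange with \<open>u\<close>: \<open>u\<close> and its
      neighbours (\<open>?Z1\<close>), vertices whose image is forbidden for \<open>u\<close>
      (\<open>?Z2\<close>), vertices for which the image of \<open>u\<close> is forbidden
      (\<open>?Z3\<close>), vertices whose image would conflict at \<open>u\<close> with a neighbour
      of \<open>u\<close> (\<open>?Z4\<close>), and vertices that would get a conflict by receiving
      \<open>h u\<close> (\<open>?Z5\<close>).\<close>
    let ?Z1 = "insert u (nb E1 u)"
    let ?Z2 = "{w \<in> R1. h w \<in> forb E1 E2 M u}"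
    let ?Z3 = "forb E2 E1 (M\<inverse>) (h u)"
    let ?Z4 = "{w \<in> R1. h w \<in> (\<Union>x\<in>nb E1 u \<inter> R1. nb E2 (h x))}"
    let ?Z5 = "\<Union>x\<in>{x \<in> R1. h x \<in> nb E2 (h u)}. nb E1 x"
    have ffor: "finite (forb E1 E2 M v)" "finite (forb E2 E1 (M\<inverse>) y)" for v y
      using fM simple_graph_nb_finite[OF sg1] simple_graph_nb_finite[OF sg2] by (auto simp: forb_def)
    have c1: "card ?Z1 \<le> q + 1"
      using q[of u] u simple_graph_nb_finite[OF sg1, of u] simple_graph_nb_self[OF sg1, of u]
      by (simp add: R1_def)
    have c2: "card ?Z2 \<le> g" using pre[OF ffor(1)[of u]] g[of u] u unfolding R1_def by linarith
    have c3: "card ?Z3 \<le> f" using f[of "h u"] hR[OF u] by (simp add: R2_def)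
    have c4: "card ?Z4 \<le> q * D"
    proof -
      have "card ?Z4 \<le> card (\<Union>x\<in>nb E1 u \<inter> R1. nb E2 (h x))"
        using simple_graph_nb_finite[OF sg1] simple_graph_nb_finite[OF sg2] by (intro pre) auto
      also have "\<dots> \<le> (\<Sum>x\<in>nb E1 u \<inter> R1. deg E2 (h x))"
        using simple_graph_nb_finite[OF sg1] by (intro card_UN_le) auto
      also have "\<dots> \<le> (\<Sum>x\<in>nb E1 u \<inter> R1. D)" using D hR by (intro sum_mono) (auto simp: R2_def)
      also have "\<dots> = card (nb E1 u \<inter> R1) * D" by simp
      also have "card (nb E1 u \<inter> R1) \<le> q"
        using q[of u] u card_mono[of "nb E1 u" "nb E1 u \<inter> R1"] simple_graph_nb_finite[OF sg1, of u]
        by (auto simp: R1_def)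
      finally show ?thesis by simp
    qed
    have c5: "card ?Z5 \<le> q * D"
    proof -
      have "card ?Z5 \<le> (\<Sum>x\<in>{x \<in> R1. h x \<in> nb E2 (h u)}. deg E1 x)"
        using fR by (intro card_UN_le) auto
      also have "\<dots> \<le> (\<Sum>x\<in>{x \<in> R1. h x \<in> nb E2 (h u)}. q)" using q by (intro sum_mono) (auto simp: R1_def)
      also have "\<dots> = card {x \<in> R1. h x \<in> nb E2 (h u)} * q" by simp
      also have "card {x \<in> R1. h x \<in> nb E2 (h u)} \<le> D"
        using pre[OF simple_graph_nb_finite[OF sg2, of "h u"]] D[of "h u"] hR[OF u]
        unfolding R2_def by linarith
      finally show ?thesis by (simp add: mult.commute)
    qed
    define Z where "Z = ?Z1 \<union> ?Z2 \<union> ?Z3 \<union> ?Z4 \<union> ?Z5"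
    have "card Z \<le> card ?Z1 + card ?Z2 + card ?Z3 + card ?Z4 + card ?Z5"
      unfolding Z_def by (meson card_Un_le add_mono le_trans order_refl)
    then have "card Z < card R1" using c1 c2 c3 c4 c5 room cR1 by linarith
    moreover have "finite Z"
      using ffor fR simple_graph_nb_finite[OF sg1] by (auto simp: Z_def)
    ultimately have "\<not> R1 \<subseteq> Z" using card_mono[of Z R1] by linarith
    then obtain w where "w \<in> R1" "w \<notin> Z" by blast
    then have w: "w \<in> R1" "w \<notin> ?Z1" "w \<notin> ?Z2" "w \<notin> ?Z3" "w \<notin> ?Z4" "w \<notin> ?Z5"
      by (simp_all only: Z_def Un_iff de_Morgan_disj simp_thms)
    define h' where "h' = h \<circ> Transposition.transpose u w"
    have h'v: "h' u = h w" "h' w = h u" "\<And>x. x \<noteq> u \<Longrightarrow> x \<noteq> w \<Longrightarrow> h' x = h x"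
      by (auto simp: h'_def transpose_def)
    have bij': "bij_betw h' R1 R2"
    proof -
      have "bij_betw (Transposition.transpose u w) R1 R1"
        using permutes_imp_bij[OF permutes_swap_id[OF u w(1)]] .
      then show ?thesis unfolding h'_def using h by (rule bij_betw_trans)
    qed
    have uw: "w \<noteq> u" "w \<notin> nb E1 u" "u \<notin> nb E1 w" using w nb_sym[of u E1 w] by auto
    have n1: "h s \<notin> nb E2 (h w)" if "s \<in> R1" "s \<in> nb E1 u" for s
      using w that nb_sym[of "h s" E2 "h w"] by auto
    have n2: "h s \<notin> nb E2 (h u)" if "s \<in> R1" "s \<in> nb E1 w" for s
      using w that nb_sym[of s E1 w] by auto
    have vsub1: "p \<noteq> u \<and> p \<noteq> w" if "(p, s) \<in> viol h'" for p s
    proof -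
      have s: "s \<in> R1" "s \<in> nb E1 p" "h' s \<in> nb E2 (h' p)" using that by (auto simp: viol_def)
      have "s \<noteq> p" using s simple_graph_nb_self[OF sg1] by metis
      show ?thesis
      proof
        show "p \<noteq> u"
        proof
          assume p: "p = u"
          then have "s \<noteq> w" using s uw by auto
          then have "h' s = h s" using h'v(3) p \<open>s \<noteq> p\<close> by simp
          then show False using n1[of s] s p h'v(1) by simp
        qed
        show "p \<noteq> w"
        proof
          assume p: "p = w"
          then have "s \<noteq> u" using s uw by auto
          then have "h' s = h s" using h'v(3) p \<open>s \<noteq> p\<close> by simp
          then show False using n2[of s] s p h'v(2) by simp
        qed
      qed
    qed
    have vsym: "(s, p) \<in> viol h'" if "(p, s) \<in> viol h'" for p s
      using that nb_sym[of s E1 p] nb_sym[of "h' s" E2 "h' p"] by (auto simp: viol_def)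
    \<comment> \<open>After the exchange no violation involves \<open>u\<close> or \<open>w\<close>,
      and all other images are unchanged. So violations can only disappear, and those at
      \<open>u\<close> do.\<close>
    have vsub: "viol h' \<subseteq> viol h - {u} \<times> UNIV"
    proof
      fix ps assume ps: "ps \<in> viol h'"
      obtain p s where [simp]: "ps = (p, s)" by force
      have "p \<noteq> u \<and> p \<noteq> w" "s \<noteq> u \<and> s \<noteq> w" using vsub1 vsym ps by auto
      then show "ps \<in> viol h - {u} \<times> UNIV" using ps h'v(3) by (auto simp: viol_def)
    qed
    have nl: "h w \<notin> forb E1 E2 M u" "h u \<notin> forb E1 E2 M w"
      using w forb_converse[of "h u" E1 E2 M w] by auto
    have lsub: "lviol h' \<subseteq> lviol h - {u}"
    proof
      fix p assume p: "p \<in> lviol h'"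
      then have "p \<noteq> u" "p \<noteq> w" using nl h'v by (auto simp: lviol_def)
      then show "p \<in> lviol h - {u}" using p h'v(3) by (auto simp: lviol_def)
    qed
    have "card (viol h') + card (lviol h') < card (viol h) + card (lviol h)"
    proof (cases "u \<in> lviol h")
      case True
      then have "card (lviol h') < card (lviol h)" using lsub fviol by (intro psubset_card_mono) auto
      moreover have "card (viol h') \<le> card (viol h)" using vsub fviol by (intro card_mono) auto
      ultimately show ?thesis by simp
    next
      case False
      then have "card (viol h') < card (viol h)" using uv vsub fviol by (intro psubset_card_mono) auto
      moreover have "card (lviol h') \<le> card (lviol h)" using lsub fviol by (intro card_mono) auto
      ultimately show ?thesis by simp
    qed
    then show False using hmin[OF bij'] by simp
  qed
  define M' where "M' = M \<union> (\<lambda>u. (u, h u)) ` R1"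
  have "partial_packing V1 E1 V2 E2 M'"
    unfolding partial_packing_def
  proof (intro conjI allI impI)
    show "M' \<subseteq> V1 \<times> V2" using pp hR by (auto simp: M'_def partial_packing_def R1_def R2_def)
    fix x y x' y' assume a: "(x, y) \<in> M'" "(x', y') \<in> M'"
    then consider "(x, y) \<in> M" "(x', y') \<in> M" | "(x, y) \<in> M" "x' \<in> R1" "y' = h x'"
      | "x \<in> R1" "y = h x" "(x', y') \<in> M" | "x \<in> R1" "y = h x" "x' \<in> R1" "y' = h x'"
      by (auto simp: M'_def)
    then have "(x = x') = (y = y') \<and> ({x, x'} \<in> E1 \<longrightarrow> {y, y'} \<notin> E2)"
    proof cases
      case 1 then show ?thesis using pp unfolding partial_packing_def by blast
    next
      case 2
      then have "y' \<notin> forb E1 E2 M x'" using none by (auto simp: lviol_def)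
      then show ?thesis using 2 hR[of x'] by (auto simp: forb_iff R1_def R2_def insert_commute)
    next
      case 3
      then have "y \<notin> forb E1 E2 M x" using none by (auto simp: lviol_def)
      then show ?thesis using 3 hR[of x] by (auto simp: forb_iff R1_def R2_def insert_commute)
    next
      case 4
      then have "(x, x') \<notin> viol h" using none by auto
      then show ?thesis using 4 inj by (auto simp: viol_def nb_def inj_on_def)
    qed
    then show "(x = x') = (y = y')" "{x, x'} \<in> E1 \<Longrightarrow> {y, y'} \<notin> E2" by auto
  qed
  moreover have "card M' = card V1"
  proof -
    have "card M' = card M + card R1"
      unfolding M'_def using fM fR
      by (subst card_Un_disjoint) (auto simp: card_image inj_on_def R1_def)
    then show ?thesis using cR1 room by simp
  qed
  ultimately show ?thesis using full_packing_packs fin1 fin2 cV by blast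
qed

section \<open>Leaves with distinct neighbours\<close>

text \<open>\<open>R\<close> consists of the isolated vertices outside \<open>H\<close> and of one
  leaf for each vertex outside \<open>H\<close> that has leaf neighbours there. If few such
  representatives exist, the vertices outside \<open>H\<close> carry edge weight 2 on average, up to
  a small defect, and this forces many edges that leave or avoid \<open>H\<close>.\<close>

lemma leaf_representatives:
  assumes sg: "simple_graph V E" and H: "H \<subseteq> V"
  obtains R where "R \<subseteq> V - H" "\<And>x. x \<in> R \<Longrightarrow> nb E x \<inter> H = {} \<and> deg E x \<le> 1"
    "\<And>u. card (nb E u \<inter> R) \<le> 1" "card (V - H) \<le> card R + card {e \<in> E. \<not> e \<subseteq> H}"
proof -
  define W where "W = V - H"
  have fin: "finite V" using sg simple_graph_finite by auto
  have fW: "finite W" using fin by (simp add: W_def)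
  have fnb: "finite (nb E x)" for x using simple_graph_nb_finite[OF sg] .
  define Iso where "Iso = {x \<in> W. nb E x = {}}"
  define Lf where "Lf = {x \<in> W. \<exists>z\<in>W. nb E x = {z}}"
  define Z where "Z = {z \<in> W. nb E z \<inter> Lf \<noteq> {}}"
  have fS: "finite Iso" "finite Lf" "finite Z" using fW by (auto simp: Iso_def Lf_def Z_def)
  define r where "r z = (SOME x. x \<in> nb E z \<inter> Lf)" for z
  have r: "r z \<in> nb E z \<inter> Lf" if "z \<in> Z" for z
  proof -
    have "\<exists>x. x \<in> nb E z \<inter> Lf" using that by (auto simp: Z_def)
    then show ?thesis unfolding r_def by (rule someI_ex)
  qed
  have rn: "nb E (r z) = {z}" if "z \<in> Z" for z
    using r[OF that] nb_sym[of z E "r z"] by (auto simp: Lf_def)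
  have injr: "inj_on r Z" using rn by (metis inj_onI singleton_inject)
  define R where "R = Iso \<union> r ` Z"
  have RW: "R \<subseteq> W" using r by (auto simp: R_def Iso_def Lf_def)
  have Rn: "nb E x \<inter> H = {} \<and> deg E x \<le> 1" if xR: "x \<in> R" for x
  proof (cases "x \<in> Iso")
      case False
      then obtain z where "z \<in> Z" "x = r z" using xR by (auto simp: R_def)
      then show ?thesis using rn by (auto simp: Z_def W_def)
    qed (auto simp: Iso_def)
  have Ru: "card (nb E u \<inter> R) \<le> 1" for u
  proof -
    have "nb E u \<inter> R \<subseteq> {r u}"
    proof
      fix x assume x: "x \<in> nb E u \<inter> R"
      then have u: "u \<in> nb E x" using nb_sym[of x E u] by simp
      then obtain z where "z \<in> Z" "x = r z" using x by (auto simp: R_def Iso_def)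
      then show "x \<in> {r u}" using rn u by auto
    qed
    then show ?thesis using card_mono[of "{r u}" "nb E u \<inter> R"] by simp
  qed
  have cR: "card R = card Iso + card Z"
  proof -
    have "Iso \<inter> r ` Z = {}" using rn by (auto simp: Iso_def)
    then show ?thesis unfolding R_def using fS injr by (simp add: card_Un_disjoint card_image)
  qed
  define w where "w x = card (nb E x \<inter> W) + 2 * card (nb E x - W)" for x
  have wsum: "(\<Sum>x\<in>W. w x) = 2 * card {e \<in> E. \<not> e \<subseteq> H}"
  proof -
    have "{e \<in> E. e \<inter> W \<noteq> {}} = {e \<in> E. \<not> e \<subseteq> H}"
      using sg by (auto simp: simple_graph_def W_def)
    then show ?thesis using sum_degree_touching[OF sg, of W] by (auto simp: w_def W_def)
  qed
  define m where "m z = card (nb E z \<inter> Lf)" for z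
  have Lfc: "card Lf \<le> (\<Sum>z\<in>Z. m z)"
  proof -
    have "Lf \<subseteq> (\<Union>z\<in>Z. nb E z \<inter> Lf)"
    proof
      fix x assume x: "x \<in> Lf"
      then obtain z where z: "z \<in> W" "nb E x = {z}" by (auto simp: Lf_def)
      then have "x \<in> nb E z" using nb_sym[of x E z] by simp
      then show "x \<in> (\<Union>z\<in>Z. nb E z \<inter> Lf)" using x z by (auto simp: Z_def)
    qed
    then have "card Lf \<le> card (\<Union>z\<in>Z. nb E z \<inter> Lf)" using fS by (intro card_mono) auto
    also have "\<dots> \<le> (\<Sum>z\<in>Z. m z)" unfolding m_def using fS by (intro card_UN_le)
    finally show ?thesis .
  qed
  \<comment> \<open>Discharging: a vertex has weight at least 2 unless it is isolated or lies in
    \<open>Lf\<close>, where the weight is 1 and a credit of 1 is given. The total credit is repaid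
    by the terms \<open>m z\<close>: a vertex of \<open>Z\<close> can afford \<open>m z\<close>, the
    number of its leaves, since its weight is at least that and it earns 2 for its
    representative.\<close>
  have pt: "2 + (if x \<in> Z then m x else 0) \<le>
      (if x \<in> Iso then 2 else 0) + (if x \<in> Z then 2 else 0) + w x + (if x \<in> Lf then 1 else 0)"
    if x: "x \<in> W" for x
  proof -
    have split: "deg E x = card (nb E x \<inter> W) + card (nb E x - W)"
      using fnb card_Int_Diff by blast
    have mw: "m x \<le> card (nb E x \<inter> W)" unfolding m_def using fnb by (intro card_mono) (auto simp: Lf_def)
    consider "nb E x = {}" | "x \<in> Lf" | "deg E x = 1" "x \<notin> Lf" | "deg E x \<ge> 2" "x \<notin> Lf" "x \<notin> Iso"
    proof -
      have "nb E x = {} \<or> deg E x = 1 \<or> deg E x \<ge> 2"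
        using fnb[of x] card_0_eq[of "nb E x"] by linarith
      then show ?thesis using that by (auto simp: Iso_def)
    qed
    then show ?thesis
    proof cases
      case 1 then show ?thesis using x by (auto simp: Iso_def Z_def)
    next
      case 2
      then have "deg E x = 1" by (auto simp: Lf_def)
      then show ?thesis using 2 split mw by (auto simp: w_def)
    next
      case 3
      then obtain z where z: "nb E x = {z}" by (auto simp: card_1_singleton_iff)
      then have "z \<notin> W" using 3 x by (auto simp: Lf_def)
      then have "nb E x - W = {z}" "nb E x \<inter> W = {}" using z by auto
      then have "w x = 2" "m x = 0" using mw by (auto simp: w_def)
      then show ?thesis by auto
    next
      case 4 then show ?thesis using split mw by (auto simp: w_def)
    qed
  qed
  have tot: "(\<Sum>x\<in>W. 2 + (if x \<in> Z then m x else 0)) \<le>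
      (\<Sum>x\<in>W. (if x \<in> Iso then 2 else 0) + (if x \<in> Z then 2 else 0) + w x + (if x \<in> Lf then 1 else 0))"
    using pt by (intro sum_mono) auto
  have restr: "(\<Sum>x\<in>W. if x \<in> S then f x else 0) = (\<Sum>x\<in>S. f x)"
    if "S \<subseteq> W" for S and f :: "'a \<Rightarrow> nat"
    using sum.inter_restrict[OF fW, of f S] that by (simp add: Int_absorb1)
  have "Iso \<subseteq> W" "Z \<subseteq> W" "Lf \<subseteq> W" by (auto simp: Iso_def Z_def Lf_def)
  then have "(\<Sum>x\<in>W. if x \<in> Z then m x else 0) = (\<Sum>z\<in>Z. m z)"
    "(\<Sum>x\<in>W. if x \<in> Iso then 2 else (0::nat)) = 2 * card Iso"
    "(\<Sum>x\<in>W. if x \<in> Z then 2 else (0::nat)) = 2 * card Z"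
    "(\<Sum>x\<in>W. if x \<in> Lf then 1 else (0::nat)) = card Lf"
    using restr by simp_all
  with tot have "2 * card W + (\<Sum>z\<in>Z. m z) \<le> 2 * card Iso + 2 * card Z + (\<Sum>x\<in>W. w x) + card Lf"
    by (simp only: sum.distrib) simp
  then have "card W \<le> card R + card {e \<in> E. \<not> e \<subseteq> H}" using Lfc wsum cR by linarith
  then show ?thesis using that[of R] RW Rn Ru by (auto simp: W_def)
qed

section \<open>Random completions\<close>

text \<open>Composition with \<open>q\<close> maps the fibre of \<open>f\<close> over
  \<open>a\<close> injectively into the fibre over \<open>b\<close>. Transitivity in both directions
  makes all fibres equally large.\<close>

lemma card_permutes_symmetric:
  assumes S: "finite S" and T: "finite T" and cov: "\<And>p. p permutes S \<Longrightarrow> f p \<in> T"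
    and tr: "\<And>a b. a \<in> T \<Longrightarrow> b \<in> T \<Longrightarrow> \<exists>q. q permutes S \<and> (\<forall>p. p permutes S \<longrightarrow> f p = a \<longrightarrow> f (q \<circ> p) = b)"
    and a: "a \<in> T"
  shows "card {p. p permutes S \<and> f p = a} * card T = fact (card S)"
proof -
  have finP: "finite {p. p permutes S}" using S by (rule finite_permutations)
  have le: "card {p. p permutes S \<and> f p = a} \<le> card {p. p permutes S \<and> f p = b}"
    if ab: "a \<in> T" "b \<in> T" for a b
  proof -
    obtain q where q: "q permutes S" "\<And>p. p permutes S \<Longrightarrow> f p = a \<Longrightarrow> f (q \<circ> p) = b"
      using tr[OF ab] by blast
    have "inj_on ((\<circ>) q) {p. p permutes S \<and> f p = a}"
      using permutes_inj[OF q(1)] by (auto simp: inj_on_def fun_eq_iff)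
    moreover have "(\<circ>) q ` {p. p permutes S \<and> f p = a} \<subseteq> {p. p permutes S \<and> f p = b}"
      using q permutes_compose by blast
    moreover have "finite {p. p permutes S \<and> f p = b}" using finP by (rule finite_subset[rotated]) auto
    ultimately show ?thesis by (rule card_inj_on_le)
  qed
  have eq: "card {p. p permutes S \<and> f p = b} = card {p. p permutes S \<and> f p = a}" if "b \<in> T" for b
    by (intro le_antisym le a that)
  have "{p. p permutes S} = (\<Union>b\<in>T. {p. p permutes S \<and> f p = b})" using cov by auto
  then have "fact (card S) = card (\<Union>b\<in>T. {p. p permutes S \<and> f p = b})"
    using card_permutations[OF refl S] by simp
  also have "\<dots> = (\<Sum>b\<in>T. card {p. p permutes S \<and> f p = b})"
    by (rule card_UN_disjoint) (use T finP in \<open>auto intro: finite_subset[OF _ finP]\<close>)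
  also have "\<dots> = (\<Sum>b\<in>T. card {p. p permutes S \<and> f p = a})" using eq by (intro sum.cong) auto
  finally show ?thesis by (simp add: mult.commute)
qed

lemma card_permutes_point:
  assumes S: "finite S" and u: "u \<in> S" and y: "y \<in> S"
  shows "card {p. p permutes S \<and> p u = y} * card S = fact (card S)"
proof (rule card_permutes_symmetric[OF S S _ _ y, of "\<lambda>p. p u"])
  show "p u \<in> S" if "p permutes S" for p using permutes_in_image[OF that] u by simp
  fix a b assume "a \<in> S" "b \<in> S"
  then show "\<exists>q. q permutes S \<and> (\<forall>p. p permutes S \<longrightarrow> p u = a \<longrightarrow> (q \<circ> p) u = b)"
    by (intro exI[of _ "Transposition.transpose a b"]) (auto simp: permutes_swap_id)
qed

lemma card_permutes_pair:
  assumes S: "finite S" and e: "e \<subseteq> S" "card e = 2" and e': "e' \<subseteq> S" "card e' = 2"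
  shows "card {p. p permutes S \<and> p ` e = e'} * (card S * (card S - 1)) = 2 * fact (card S)"
proof -
  have "card {p. p permutes S \<and> p ` e = e'} * card {d. d \<subseteq> S \<and> card d = 2} = fact (card S)"
  proof (rule card_permutes_symmetric[OF S, of _ "\<lambda>p. p ` e"])
    show "finite {d. d \<subseteq> S \<and> card d = 2}" using S by simp
    show "p ` e \<in> {d. d \<subseteq> S \<and> card d = 2}" if "p permutes S" for p
      using e permutes_image[OF that] permutes_inj[OF that]
      by (auto simp: card_image inj_on_subset)
    show "e' \<in> {d. d \<subseteq> S \<and> card d = 2}" using e' by simp
    fix a b assume ab: "a \<in> {d. d \<subseteq> S \<and> card d = 2}" "b \<in> {d. d \<subseteq> S \<and> card d = 2}"
    then obtain a1 a2 b1 b2 where ab': "a = {a1, a2}" "a1 \<noteq> a2" "b = {b1, b2}" "b1 \<noteq> b2"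
      by (auto simp: card_2_iff)
    then have inS: "a1 \<in> S" "a2 \<in> S" "b1 \<in> S" "b2 \<in> S" using ab by auto
    \<comment> \<open>\<open>t\<close> brings a1 to b1; the second transposition brings the image of
      a2 to b2 and fixes b1, which differs from both points it moves.\<close>
    define t where "t = Transposition.transpose a1 b1"
    define q where "q = Transposition.transpose (t a2) b2 \<circ> t"
    have t: "t permutes S" "t a1 = b1" using inS by (auto simp: t_def permutes_swap_id)
    then have ta2: "t a2 \<in> S" "t a2 \<noteq> b1"
      using inS permutes_in_image[OF t(1)] permutes_inj[OF t(1)] ab' by (auto dest: injD)
    have "q permutes S" unfolding q_def using t ta2 inS by (intro permutes_compose permutes_swap_id)
    moreover have "q ` a = b" using t ta2 ab' by (auto simp: q_def transpose_def)
    moreover have "(q \<circ> p) ` e = q ` (p ` e)" for p by (rule image_comp[symmetric])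
    ultimately show "\<exists>q. q permutes S \<and> (\<forall>p. p permutes S \<longrightarrow> p ` e = a \<longrightarrow> (q \<circ> p) ` e = b)"
      by metis
  qed
  moreover have "card {d. d \<subseteq> S \<and> card d = 2} * 2 = card S * (card S - 1)"
  proof -
    have "even (card S * (card S - 1))" by (cases "card S") auto
    then show ?thesis using n_subsets[OF S, of 2] choose_two[of "card S"] by (metis dvd_div_mult_self)
  qed
  moreover have "X * N = 2 * f" if "X * T = f" "T * 2 = N" for N f X T :: nat
    using that by auto
  ultimately show ?thesis by blast
qed

text \<open>The hypothesis says that a uniformly random bijection has on average fewer than one
  violated constraint.\<close>

lemma random_bijection:
  assumes fin: "finite R1" "finite R2" "card R1 = card R2"
    and F1: "finite F1" "\<And>e. e \<in> F1 \<Longrightarrow> e \<subseteq> R1 \<and> card e = 2"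
    and F2: "finite F2" "\<And>e. e \<in> F2 \<Longrightarrow> e \<subseteq> R2 \<and> card e = 2"
    and Fb: "Fb \<subseteq> R1 \<times> R2"
    and lt: "2 * card F1 * card F2 + card Fb * (card R2 - 1) < card R2 * (card R2 - 1)"
  obtains h where "bij_betw h R1 R2" "\<And>e. e \<in> F1 \<Longrightarrow> h ` e \<notin> F2" "\<And>u. u \<in> R1 \<Longrightarrow> (u, h u) \<notin> Fb"
proof -
  \<comment> \<open>A uniform bijection is a fixed \<open>g\<close> followed by a uniform
    permutation of \<open>R2\<close>. Below, \<open>B1\<close> counts violated edges and
    \<open>B2\<close> forbidden pairs.\<close>
  obtain g where g: "bij_betw g R1 R2" using finite_same_card_bij fin by blast
  define P where "P = {p. p permutes R2}"
  define r where "r = card R2"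
  have finP: "finite P" unfolding P_def using fin(2) by (rule finite_permutations)
  have cP: "card P = fact r" unfolding P_def r_def using fin(2) by (intro card_permutations) auto
  have fFb: "finite Fb" using Fb fin by (meson finite_SigmaI finite_subset)
  define B1 where "B1 p = card {ee \<in> F1 \<times> F2. p ` g ` fst ee = snd ee}" for p
  define B2 where "B2 p = card {uy \<in> Fb. p (g (fst uy)) = snd uy}" for p
  have s1: "(\<Sum>p\<in>P. B1 p) * (r * (r - 1)) = 2 * card F1 * card F2 * fact r"
  proof -
    have "(\<Sum>p\<in>P. B1 p) = (\<Sum>ee\<in>F1 \<times> F2. card {p \<in> P. p ` g ` fst ee = snd ee})"
      unfolding B1_def by (rule sum_multicount_gen) (use finP F1 F2 in auto)
    then have "(\<Sum>p\<in>P. B1 p) * (r * (r - 1)) =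
        (\<Sum>ee\<in>F1 \<times> F2. card {p \<in> P. p ` g ` fst ee = snd ee} * (r * (r - 1)))"
      by (simp add: sum_distrib_right)
    also have "\<dots> = (\<Sum>ee\<in>F1 \<times> F2. 2 * fact r)"
    proof (rule sum.cong[OF refl])
      fix ee assume ee: "ee \<in> F1 \<times> F2"
      have fe: "fst ee \<subseteq> R1" "card (fst ee) = 2" using ee F1(2)[of "fst ee"] by auto
      then have "g ` fst ee \<subseteq> R2" "card (g ` fst ee) = 2"
        using g by (auto simp: bij_betw_def card_image inj_on_subset)
      then show "card {p \<in> P. p ` g ` fst ee = snd ee} * (r * (r - 1)) = 2 * fact r"
        using card_permutes_pair[OF fin(2), of "g ` fst ee" "snd ee"] ee F2(2) by (auto simp: P_def r_def)
    qed
    finally show ?thesis by (simp add: card_cartesian_product)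
  qed
  have s2: "(\<Sum>p\<in>P. B2 p) * r = card Fb * fact r"
  proof -
    have "(\<Sum>p\<in>P. B2 p) = (\<Sum>uy\<in>Fb. card {p \<in> P. p (g (fst uy)) = snd uy})"
      unfolding B2_def by (rule sum_multicount_gen) (use finP fFb in auto)
    then have "(\<Sum>p\<in>P. B2 p) * r = (\<Sum>uy\<in>Fb. card {p \<in> P. p (g (fst uy)) = snd uy} * r)"
      by (simp add: sum_distrib_right)
    also have "\<dots> = (\<Sum>uy\<in>Fb. fact r)"
    proof (rule sum.cong[OF refl])
      fix uy assume uy: "uy \<in> Fb"
      then have "g (fst uy) \<in> R2" "snd uy \<in> R2" using Fb g by (auto simp: bij_betw_def)
      then show "card {p \<in> P. p (g (fst uy)) = snd uy} * r = fact r"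
        using card_permutes_point[OF fin(2)] by (auto simp: P_def r_def)
    qed
    finally show ?thesis by simp
  qed
  \<comment> \<open>The probabilities are 2 / (r (r - 1)) for a pair of edges and 1 / r for a
    forbidden pair; denominators are cleared.\<close>
  have "(\<Sum>p\<in>P. B1 p + B2 p) * (r * (r - 1)) = (2 * card F1 * card F2 + card Fb * (r - 1)) * fact r"
  proof -
    have "(\<Sum>p\<in>P. B1 p + B2 p) * (r * (r - 1)) =
        (\<Sum>p\<in>P. B1 p) * (r * (r - 1)) + (\<Sum>p\<in>P. B2 p) * r * (r - 1)"
      by (simp only: sum.distrib distrib_right mult.assoc)
    then show ?thesis unfolding s1 s2 by (simp add: algebra_simps)
  qed
  also have "\<dots> < r * (r - 1) * fact r" using lt by (simp add: r_def)
  finally have "(\<Sum>p\<in>P. B1 p + B2 p) < card P" using cP by (simp add: mult.commute)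
  have "\<exists>p\<in>P. B1 p + B2 p = 0"
  proof (rule ccontr)
    assume "\<not> ?thesis"
    then have "(\<Sum>p\<in>P. 1) \<le> (\<Sum>p\<in>P. B1 p + B2 p)" by (intro sum_mono) (simp add: Suc_le_eq)
    then show False using \<open>(\<Sum>p\<in>P. B1 p + B2 p) < card P\<close> by simp
  qed
  then obtain p where p: "p permutes R2" "B1 p = 0" "B2 p = 0" by (auto simp: P_def)
  have z1: "{ee \<in> F1 \<times> F2. p ` g ` fst ee = snd ee} = {}" using p(2) F1 F2 by (simp add: B1_def)
  have z2: "{uy \<in> Fb. p (g (fst uy)) = snd uy} = {}" using p(3) fFb by (simp add: B2_def)
  show ?thesis
  proof (rule that[of "p \<circ> g"])
    show "bij_betw (p \<circ> g) R1 R2" using g permutes_imp_bij[OF p(1)] by (rule bij_betw_trans)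
    show "(p \<circ> g) ` e \<notin> F2" if "e \<in> F1" for e
    proof
      assume *: "(p \<circ> g) ` e \<in> F2"
      have "(p \<circ> g) ` e = p ` g ` e" by (rule image_comp[symmetric])
      then have "(e, (p \<circ> g) ` e) \<in> {ee \<in> F1 \<times> F2. p ` g ` fst ee = snd ee}" using * that by simp
      then show False using z1 by simp
    qed
    show "(u, (p \<circ> g) u) \<notin> Fb" if "u \<in> R1" for u using z2 by auto
  qed
qed

text \<open>Edges disjoint from the placed part are counted by \<open>a\<close> and
  \<open>b\<close>; edges between placed and unplaced vertices turn into the forbidden pairs counted
  by \<open>c\<close>.\<close>

lemma random_completion:
  assumes sg1: "simple_graph V1 E1" and sg2: "simple_graph V2 E2" and cV: "card V1 = card V2"
    and pp: "partial_packing V1 E1 V2 E2 M"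
    and r: "r = card V1 - card M"
    and a: "card {e \<in> E1. e \<inter> Domain M = {}} \<le> a" and b: "card {e \<in> E2. e \<inter> Range M = {}} \<le> b"
    and c: "card {(u, y). u \<in> V1 - Domain M \<and> y \<in> V2 - Range M \<and> y \<in> forb E1 E2 M u} \<le> c"
    and lt: "2 * a * b + c * (r - 1) < r * (r - 1)"
  shows "packs V1 E1 V2 E2"
proof -
  have fin1: "finite V1" and fin2: "finite V2" using sg1 sg2 simple_graph_finite by auto
  have fM: "finite M" using partial_packing_finite[OF pp fin1 fin2] .
  have sub: "Domain M \<subseteq> V1" "Range M \<subseteq> V2" using pp by (auto simp: partial_packing_def)
  define R1 where "R1 = V1 - Domain M"
  define R2 where "R2 = V2 - Range M"
  have fR: "finite R1" "finite R2" using fin1 fin2 by (auto simp: R1_def R2_def)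
  have cR1: "card R1 = r"
    using sub fin1 partial_packing_card[OF pp] r by (simp add: R1_def card_Diff_subset finite_subset)
  have cR2: "card R2 = r"
    using sub fin2 partial_packing_card[OF pp] cV r by (simp add: R2_def card_Diff_subset finite_subset)
  define F1 where "F1 = {e \<in> E1. e \<inter> Domain M = {}}"
  define F2 where "F2 = {e \<in> E2. e \<inter> Range M = {}}"
  define Fb where "Fb = {(u, y). u \<in> R1 \<and> y \<in> R2 \<and> y \<in> forb E1 E2 M u}"
  have lt': "2 * card F1 * card F2 + card Fb * (card R2 - 1) < card R2 * (card R2 - 1)"
  proof -
    have "2 * card F1 * card F2 + card Fb * (r - 1) \<le> 2 * a * b + c * (r - 1)"
      using a b c by (intro add_mono mult_mono) (auto simp: F1_def F2_def Fb_def R1_def R2_def)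
    then show ?thesis using lt cR2 by simp
  qed
  obtain h where h: "bij_betw h R1 R2" "\<And>e. e \<in> F1 \<Longrightarrow> h ` e \<notin> F2" "\<And>u. u \<in> R1 \<Longrightarrow> (u, h u) \<notin> Fb"
  proof (rule random_bijection[OF fR _ _ _ _ _ _ lt'])
    show "card R1 = card R2" using cR1 cR2 by simp
    show "finite F1" "finite F2"
      using simple_graph_finite_edges[OF sg1] simple_graph_finite_edges[OF sg2] by (auto simp: F1_def F2_def)
    show "e \<subseteq> R1 \<and> card e = 2" if "e \<in> F1" for e
      using that sg1 by (auto simp: F1_def R1_def simple_graph_def)
    show "e \<subseteq> R2 \<and> card e = 2" if "e \<in> F2" for e
      using that sg2 by (auto simp: F2_def R2_def simple_graph_def)
    show "Fb \<subseteq> R1 \<times> R2" by (auto simp: Fb_def)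
  qed blast
  have hR: "\<And>x. x \<in> R1 \<Longrightarrow> h x \<in> R2" and inj: "inj_on h R1" using h(1) by (auto simp: bij_betw_def)
  define M' where "M' = M \<union> (\<lambda>u. (u, h u)) ` R1"
  have "partial_packing V1 E1 V2 E2 M'"
    unfolding partial_packing_def
  proof (intro conjI allI impI)
    show "M' \<subseteq> V1 \<times> V2" using pp hR by (auto simp: M'_def partial_packing_def R1_def R2_def)
    fix x y x' y' assume a: "(x, y) \<in> M'" "(x', y') \<in> M'"
    then consider "(x, y) \<in> M" "(x', y') \<in> M" | "(x, y) \<in> M" "x' \<in> R1" "y' = h x'"
      | "x \<in> R1" "y = h x" "(x', y') \<in> M" | "x \<in> R1" "y = h x" "x' \<in> R1" "y' = h x'"
      by (auto simp: M'_def)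
    then have "(x = x') = (y = y') \<and> ({x, x'} \<in> E1 \<longrightarrow> {y, y'} \<notin> E2)"
    proof cases
      case 1 then show ?thesis using pp unfolding partial_packing_def by blast
    next
      case 2
      then have "y' \<notin> forb E1 E2 M x'" using h(3)[of x'] hR by (auto simp: Fb_def)
      then show ?thesis using 2 hR[of x'] by (auto simp: forb_iff R1_def R2_def insert_commute)
    next
      case 3
      then have "y \<notin> forb E1 E2 M x" using h(3)[of x] hR by (auto simp: Fb_def)
      then show ?thesis using 3 hR[of x] by (auto simp: forb_iff R1_def R2_def insert_commute)
    next
      case 4
      have "{x, x'} \<in> F1" if "{x, x'} \<in> E1" using that 4 by (auto simp: F1_def R1_def)
      then have "{x, x'} \<in> E1 \<longrightarrow> {y, y'} \<notin> F2" using h(2)[of "{x, x'}"] 4 by auto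
      moreover have "{y, y'} \<inter> Range M = {}" using 4 hR by (auto simp: R2_def)
      ultimately have "{x, x'} \<in> E1 \<longrightarrow> {y, y'} \<notin> E2" unfolding F2_def by blast
      moreover have "(x = x') = (y = y')" using 4 inj unfolding inj_on_def by blast
      ultimately show ?thesis by blast
    qed
    then show "(x = x') = (y = y')" "{x, x'} \<in> E1 \<Longrightarrow> {y, y'} \<notin> E2" by auto
  qed
  moreover have "card M' = card V1"
  proof -
    have "card M' = card M + card R1"
      unfolding M'_def using fM fR
      by (subst card_Un_disjoint) (auto simp: card_image inj_on_def R1_def)
    moreover have "card M \<le> card V1"
      using sub fin1 partial_packing_card(1)[OF pp] card_mono by metis
    ultimately show ?thesis using cR1 r by simp
  qed
  ultimately show ?thesis using full_packing_packs fin1 fin2 cV by blast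
qed

section \<open>Completing a packing of the hubs\<close>

lemma greedy_embedding_few_conv:
  assumes sg1: "simple_graph V1 E1" and sg2: "simple_graph V2 E2"
    and pp: "partial_packing V1 E1 V2 E2 M"
    and L: "L \<subseteq> V1 - Domain M" and B: "B \<subseteq> V2 - Range M"
    and l: "\<And>w. w \<in> L \<Longrightarrow> deg E1 w \<le> l"
    and room: "\<And>v. v \<in> B \<Longrightarrow> card (forb E2 E1 (M\<inverse>) v \<inter> L) + card B + l * card B < card L"
  shows "\<exists>M'. partial_packing V1 E1 V2 E2 M' \<and> M \<subseteq> M' \<and> M' - M \<subseteq> L \<times> B \<and>
     Range M' = Range M \<union> B"
proof -
  obtain M' where M': "partial_packing V2 E2 V1 E1 M'" "M\<inverse> \<subseteq> M'" "M' - M\<inverse> \<subseteq> B \<times> L"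
     "Domain M' = Domain (M\<inverse>) \<union> B"
    using greedy_embedding_few[OF sg2 sg1 partial_packing_converseI[OF pp], of L B l] L B l room by auto
  then show ?thesis
    by (intro exI[of _ "M'\<inverse>"]) (auto dest: partial_packing_converseI)
qed

lemma greedy_embedding_conv:
  fixes \<gamma> \<omega> bb :: real and l :: nat
  assumes sg1: "simple_graph V1 E1" and sg2: "simple_graph V2 E2"
    and pp: "partial_packing V1 E1 V2 E2 M"
    and L: "L \<subseteq> V1 - Domain M"
    and l: "\<And>w. w \<in> L \<Longrightarrow> card (nb E1 w \<inter> L) \<le> l"
    and om: "\<And>w. w \<in> L \<Longrightarrow> real (\<Sum>y\<in>nb E1 w - Domain M. card (nb E1 y \<inter> L)) \<le> \<omega>"
    and pos: "\<gamma> > 0" "\<omega> \<ge> 0" "bb \<ge> 0"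
    and B: "B \<subseteq> V2 - Range M"
    and bb: "bb * bb \<ge> 2 * real (card E2) \<or> bb \<ge> real (card B)"
    and room: "\<And>v. v \<in> B \<Longrightarrow> real (card (forb E2 E1 (M\<inverse>) v \<inter> L)) + real (card B) + real l * bb
      + 2 / \<gamma> * \<omega> * real (\<Sum>v\<in>B. deg E2 v) \<le> real (card L)"
  shows "\<exists>M'. partial_packing V1 E1 V2 E2 M' \<and> M \<subseteq> M' \<and> M' - M \<subseteq> L \<times> B \<and>
     Range M' = Range M \<union> B \<and>
     (\<forall>u\<in>V1 - Domain M'. real (load E1 E2 (M' - M) u) \<le> \<gamma> \<or>
        (\<exists>w v. (w, v) \<in> M' - M \<and> w \<in> nb E1 u \<and> load E1 E2 (M' - M) u = deg E2 v))"
proof -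
  obtain M' where M': "partial_packing V2 E2 V1 E1 M'" "M\<inverse> \<subseteq> M'" "M' - M\<inverse> \<subseteq> B \<times> L"
     "Domain M' = Domain (M\<inverse>) \<union> B"
     "\<forall>u\<in>V1 - Range M'. real (load E1 E2 ((M' - M\<inverse>)\<inverse>) u) \<le> \<gamma> \<or>
        (\<exists>v w. (v, w) \<in> M' - M\<inverse> \<and> w \<in> nb E1 u \<and> load E1 E2 ((M' - M\<inverse>)\<inverse>) u = deg E2 v)"
    using greedy_embedding[OF sg2 sg1 partial_packing_converseI[OF pp], of L l \<omega> \<gamma> bb B]
      L l om pos B bb room by auto
  have eq: "(M' - M\<inverse>)\<inverse> = M'\<inverse> - M" by auto
  show ?thesis
  proof (intro exI[of _ "M'\<inverse>"] conjI ballI)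
    fix u assume "u \<in> V1 - Domain (M'\<inverse>)"
    then have "u \<in> V1 - Range M'" by simp
    from M'(5)[rule_format, OF this]
    show "real (load E1 E2 (M'\<inverse> - M) u) \<le> \<gamma> \<or>
        (\<exists>w v. (w, v) \<in> M'\<inverse> - M \<and> w \<in> nb E1 u \<and> load E1 E2 (M'\<inverse> - M) u = deg E2 v)"
      unfolding eq by auto
  qed (use M' in \<open>auto dest: partial_packing_converseI\<close>)
qed

section \<open>Bounds on loads and on the number of vertices of large degree or load\<close>

lemma partial_packing_subset:
  assumes pp: "partial_packing V1 E1 V2 E2 M" and sub: "M' \<subseteq> M"
  shows "partial_packing V1 E1 V2 E2 M'"
  unfolding partial_packing_def
proof (intro conjI allI impI)
  show "M' \<subseteq> V1 \<times> V2" using assms by (auto simp: partial_packing_def)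
  fix x y x' y' assume "(x, y) \<in> M'" "(x', y') \<in> M'"
  then have *: "(x, y) \<in> M" "(x', y') \<in> M" using sub by auto
  then show "(x = x') = (y = y')" using pp unfolding partial_packing_def by blast
  show "{y, y'} \<notin> E2" if "{x, x'} \<in> E1" using * that pp unfolding partial_packing_def by blast
qed

lemma load_bound:
  assumes fin: "finite M" and pp: "partial_packing V1 E1 V2 E2 M"
    and D: "\<And>x y. (x, y) \<in> M \<Longrightarrow> deg E2 y \<le> D"
    and k: "card (Domain M \<inter> nb E1 u) \<le> k"
  shows "load E1 E2 M u \<le> k * D"
proof -
  have "load E1 E2 M u \<le> card (Domain M \<inter> nb E1 u) * D"
    using load_le_count[OF fin pp, where u = u and D = D] D by blast
  then show ?thesis using mult_le_mono1[OF k, of D] by linarith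
qed

text \<open>Only incidences inside \<open>S\<close> are counted twice, and there are at most |S|^2
  of them. For bounded \<open>S\<close> this gains almost a factor of two over
  \<open>sum_degree_le\<close>.\<close>

lemma sum_degree_le_edges:
  assumes sg: "simple_graph V E" and S: "S \<subseteq> V"
  shows "(\<Sum>v\<in>S. deg E v) \<le> card E + card S * card S"
proof -
  have fS: "finite S" using S sg simple_graph_finite finite_subset by metis
  have fnb: "finite (nb E v)" for v using simple_graph_nb_finite[OF sg] .
  have "(\<Sum>v\<in>S. card (nb E v \<inter> S)) \<le> (\<Sum>v\<in>S. card S)"
    using fS by (intro sum_mono card_mono) auto
  then have 1: "(\<Sum>v\<in>S. card (nb E v \<inter> S)) \<le> card S * card S" by simp
  have 2: "(\<Sum>v\<in>S. deg E v) = (\<Sum>v\<in>S. card (nb E v \<inter> S)) + (\<Sum>v\<in>S. card (nb E v - S))"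
    using card_Int_Diff[OF fnb] by (simp add: sum.distrib[symmetric])
  have 3: "(\<Sum>v\<in>S. card (nb E v \<inter> S)) + 2 * (\<Sum>v\<in>S. card (nb E v - S)) \<le> 2 * card E"
  proof -
    have "card {e \<in> E. e \<inter> S \<noteq> {}} \<le> card E"
      using simple_graph_finite_edges[OF sg] by (intro card_mono) auto
    then show ?thesis using sum_degree_touching[OF sg S] by (simp add: sum.distrib sum_distrib_left)
  qed
  show ?thesis using 1 2 3 by linarith
qed

text \<open>The preceding bound is applied to exactly k + 1 of the vertices, so that the quadratic
  term stays a constant.\<close>

lemma card_high_degree_le:
  assumes sg: "simple_graph V E" and S: "S \<subseteq> V" and d: "\<And>v. v \<in> S \<Longrightarrow> d \<le> real (deg E v)"
    and k: "real (card E) + real (Suc k) * real (Suc k) < real (Suc k) * d"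
  shows "card S \<le> k"
proof (rule ccontr)
  assume "\<not> ?thesis"
  then obtain T where T: "T \<subseteq> S" "card T = Suc k"
    by (metis not_less_eq_eq obtain_subset_with_card_n)
  have "real (Suc k) * d = (\<Sum>v\<in>T. d)" using T by simp
  also have "\<dots> \<le> (\<Sum>v\<in>T. real (deg E v))" using T d by (intro sum_mono) auto
  also have "\<dots> = real (\<Sum>v\<in>T. deg E v)" by simp
  also have "\<dots> \<le> real (card E + card T * card T)"
    using sum_degree_le_edges[OF sg, of T] T S unfolding of_nat_le_iff by blast
  finally show False using k unfolding T(2) of_nat_add of_nat_mult by linarith
qed

lemma card_unplaced:
  assumes sg1: "simple_graph V1 E1" and sg2: "simple_graph V2 E2"
    and pp: "partial_packing V1 E1 V2 E2 M"
  shows "card (V1 - Domain M) + card M = card V1" "card (V2 - Range M) + card M = card V2"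
proof -
  have fin: "finite V1" "finite V2" using sg1 sg2 simple_graph_finite by auto
  have sub: "Domain M \<subseteq> V1" "Range M \<subseteq> V2" using pp by (auto simp: partial_packing_def)
  have "card (Domain M) \<le> card V1" "card (Range M) \<le> card V2"
    using sub fin by (simp_all add: card_mono)
  then show "card (V1 - Domain M) + card M = card V1" "card (V2 - Range M) + card M = card V2"
    using sub fin partial_packing_card[OF pp] by (simp_all add: card_Diff_subset finite_subset)
qed

lemma card_add_placed:
  assumes "finite V1" "finite V2" "partial_packing V1 E1 V2 E2 M'" "partial_packing V1 E1 V2 E2 M"
  shows "Domain M' = Domain M \<union> B \<Longrightarrow> card M' \<le> card M + card B"
    and "Range M' = Range M \<union> C \<Longrightarrow> card M' \<le> card M + card C"
  using partial_packing_card[OF assms(3)] partial_packing_card[OF assms(4)]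
    card_Un_le[of "Domain M" B] card_Un_le[of "Range M" C] by auto

text \<open>Every vertex of \<open>Y\<close> is adjacent to the image of a vertex of
  \<open>Big\<close>, and each such image has at most \<open>l\<close> neighbours.\<close>

lemma card_touched_le:
  assumes fin: "finite D" and pp: "partial_packing V1 E1 V2 E2 D"
    and big: "finite Big" "\<And>v w y. (v, w) \<in> D \<Longrightarrow> w \<in> nb E2 y \<Longrightarrow> y \<in> Y \<Longrightarrow> \<theta> \<le> real (deg E1 v) \<Longrightarrow> v \<in> Big"
    and l: "\<And>v w. (v, w) \<in> D \<Longrightarrow> deg E2 w \<le> l" and fnb: "\<And>w. finite (nb E2 w)"
    and Y: "\<And>y. y \<in> Y \<Longrightarrow> \<exists>v w. (v, w) \<in> D \<and> w \<in> nb E2 y \<and> \<theta> \<le> real (deg E1 v)"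
  shows "card Y \<le> card Big * l"
proof -
  let ?D = "{p \<in> D. fst p \<in> Big}"
  have inj: "inj_on fst D"
    using pp unfolding inj_on_def partial_packing_def by (metis prod.collapse)
  have "Y \<subseteq> (\<Union>p\<in>?D. nb E2 (snd p))"
  proof
    fix y assume y: "y \<in> Y"
    then obtain v w where vw: "(v, w) \<in> D" "w \<in> nb E2 y" "\<theta> \<le> real (deg E1 v)" using Y by blast
    then have "v \<in> Big" "y \<in> nb E2 w" using big(2) y nb_sym[of w E2 y] by auto
    then show "y \<in> (\<Union>p\<in>?D. nb E2 (snd p))" using vw by force
  qed
  then have "card Y \<le> card (\<Union>p\<in>?D. nb E2 (snd p))" using fin fnb by (intro card_mono) auto
  also have "\<dots> \<le> (\<Sum>p\<in>?D. deg E2 (snd p))" using fin by (intro card_UN_le) auto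
  also have "\<dots> \<le> (\<Sum>p\<in>?D. l)" using l by (intro sum_mono) auto
  also have "\<dots> = card ?D * l" by simp
  also have "card ?D = card (fst ` ?D)" using inj_on_subset[OF inj, of ?D] by (simp add: card_image)
  also have "\<dots> \<le> card Big" using big(1) by (intro card_mono) auto
  finally show ?thesis by simp
qed

text \<open>The hypotheses form a budget: \<open>h3\<close>, \<open>h5\<close> and \<open>h6\<close>
  leave targets for the vertices still to be placed, \<open>h4\<close> allows the overloaded ones to
  be placed crudely, and \<open>h7\<close> caps the load that a single placed vertex creates in the
  other direction.\<close>

lemma packs_of_partial_packing:
  fixes n :: nat
  assumes sg1: "simple_graph V1 E1" and sg2: "simple_graph V2 E2"
    and cV: "card V1 = n" "card V2 = n" and n: "261000 \<le> n"
    and tot: "\<And>v. card E1 + card E2 + deg E1 v \<le> 3 * n"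
    and e1: "2 * real (card E1) * 92000 \<le> real n * real n"
    and pp: "partial_packing V1 E1 V2 E2 M"
    and h1: "real (card M) \<le> (34 / 1000) * n"
    and h2: "\<And>y. y \<in> V2 - Range M \<Longrightarrow> 3000 * deg E2 y < n"
    and h3: "\<And>u. u \<in> V1 - Domain M \<Longrightarrow> real (load E1 E2 M u) \<le> (88 / 100) * n"
    and h4: "card {u \<in> V1 - Domain M. 3000 * deg E1 u < n \<and> real (load E1 E2 M u) > (3 / 10) * n} \<le> 60"
    and h5: "\<And>u. u \<in> V1 - Domain M \<Longrightarrow> n \<le> 3000 * deg E1 u \<Longrightarrow>
      real (load E1 E2 M u) + card E2 / 10 + (96 / 1000) * card E1 + 19 * sqrt (2 * real (card E1)) + card M + (25 / 1000) * n \<le> n"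
    and h6: "\<And>y. y \<in> V2 - Range M \<Longrightarrow> real (load E2 E1 (M\<inverse>) y) \<le> (1 / 100) * n"
    and h7: "\<And>v. v \<in> V1 - Domain M \<Longrightarrow> real (deg E1 v) \<le> (85 / 100) * n"
  shows "packs V1 E1 V2 E2"
proof -
  have fin1: "finite V1" and fin2: "finite V2" using sg1 sg2 simple_graph_finite by auto
  have fnb1: "finite (nb E1 v)" for v using simple_graph_nb_finite[OF sg1] .
  have fnb2: "finite (nb E2 v)" for v using simple_graph_nb_finite[OF sg2] .
  note fpp = partial_packing_finite[OF _ fin1 fin2]
  define N where "N = n div 3000"
  have N: "3000 * N \<le> n" by (simp add: N_def)
  have small: "d \<le> N" if "3000 * d < n" for d using that by (simp add: N_def)
  have nr: "261000 \<le> real n" using n by simp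
  have Nr: "3000 * real N \<le> real n" using N by (metis of_nat_le_iff of_nat_mult of_nat_numeral)
  define s where "s = sqrt (2 * real (card E1))"
  have s0: "s \<ge> 0" "s * s = 2 * card E1" by (simp_all add: s_def)
  have s: "303 * s \<le> n"
  proof -
    have "(303 * s) * (303 * s) \<le> real n * real n" using e1 s0 by simp
    then show ?thesis using s0(1) by (metis abs_le_square_iff abs_of_nat abs_of_nonneg mult_nonneg_nonneg
        power2_eq_square zero_le_numeral)
  qed
  have er: "real (card E1) + real (card E2) + real (deg E1 v) \<le> 3 * real n" for v
    using tot[of v] by linarith
  have er0: "real (card E1) + real (card E2) \<le> 3 * real n" using er[of undefined] by linarith

  \<comment> \<open>At most 60 non-hubs, placed on non-hubs: this adds at most 60 N \<le> 0.02 n to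
    every load on either side.\<close>
  define U where "U = {u \<in> V1 - Domain M. 3000 * deg E1 u < n \<and> real (load E1 E2 M u) > (3 / 10) * n}"
  have cU: "card U \<le> 60" using h4 by (simp add: U_def)
  have cX: "card (V2 - Range M) + card M = n" using card_unplaced(2)[OF sg1 sg2 pp] cV by simp
  have "\<exists>M2. partial_packing V1 E1 V2 E2 M2 \<and> M \<subseteq> M2 \<and> M2 - M \<subseteq> U \<times> (V2 - Range M) \<and>
     Domain M2 = Domain M \<union> U"
  proof (rule greedy_embedding_few[OF sg1 sg2 pp order_refl, where l = N])
    show "U \<subseteq> V1 - Domain M" by (auto simp: U_def)
    show "deg E2 w \<le> N" if "w \<in> V2 - Range M" for w using small h2[OF that] by simp
    fix v assume v: "v \<in> U"
    have "card (forb E1 E2 M v \<inter> (V2 - Range M)) \<le> card (forb E1 E2 M v)"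
      using fpp[OF pp] fnb2 by (intro card_mono) (auto simp: forb_def)
    also have "\<dots> \<le> load E1 E2 M v" using card_forb_le_load[OF fpp[OF pp]] .
    finally have 1: "real (card (forb E1 E2 M v \<inter> (V2 - Range M))) \<le> (88 / 100) * n"
      using h3[of v] v by (auto simp: U_def)
    have "N * card U \<le> N * 60" using cU by simp
    then have "real (N * card U) \<le> real (N * 60)" by (simp only: of_nat_le_iff)
    moreover have "real (card U) \<le> 60" using cU by simp
    moreover have "real (card (V2 - Range M)) + real (card M) = real n" using cX by (simp flip: of_nat_add)
    ultimately have "real (card (forb E1 E2 M v \<inter> (V2 - Range M)) + card U + N * card U) < real (card (V2 - Range M))"
      using 1 h1 Nr nr unfolding of_nat_add of_nat_mult of_nat_numeral by linarith
    then show "card (forb E1 E2 M v \<inter> (V2 - Range M)) + card U + N * card U < card (V2 - Range M)"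
      by (simp only: of_nat_less_iff)
  qed
  then obtain M2 where M2: "partial_packing V1 E1 V2 E2 M2" "M \<subseteq> M2" "M2 - M \<subseteq> U \<times> (V2 - Range M)"
     "Domain M2 = Domain M \<union> U" by blast
  have cM2: "real (card M2) \<le> real (card M) + 60"
    using card_add_placed(1)[OF fin1 fin2 M2(1) pp M2(4)] cU by simp
  have ppD2: "partial_packing V1 E1 V2 E2 (M2 - M)" using partial_packing_subset[OF M2(1)] by simp
  have ppD2c: "partial_packing V2 E2 V1 E1 ((M2 - M)\<inverse>)" using partial_packing_converseI[OF ppD2] .
  have fD2: "finite (M2 - M)" using fpp[OF M2(1)] by simp
  have fU: "finite U" using fin1 by (simp add: U_def)
  have subR: "V2 - Range M2 \<subseteq> V2 - Range M" "V1 - Domain M2 \<subseteq> V1 - Domain M" using M2 by auto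
  have load2: "real (load E1 E2 M2 u) \<le> real (load E1 E2 M u) + (2 / 100) * n" for u
  proof -
    have "load E1 E2 (M2 - M) u \<le> 60 * N"
    proof (rule load_bound[OF fD2 ppD2])
      show "deg E2 y \<le> N" if "(x, y) \<in> M2 - M" for x y using small h2[of y] that M2(3) by auto
      have "card (Domain (M2 - M) \<inter> nb E1 u) \<le> card U" using M2(3) fU by (intro card_mono) auto
      then show "card (Domain (M2 - M) \<inter> nb E1 u) \<le> 60" using cU by simp
    qed
    then have "real (load E1 E2 (M2 - M) u) \<le> real (60 * N)" by (simp only: of_nat_le_iff)
    then show ?thesis using load_extend[OF fpp[OF M2(1)] M2(2), of E1 E2 u] Nr by simp
  qed
  have cload2: "real (load E2 E1 (M2\<inverse>) y) \<le> (3 / 100) * n" if "y \<in> V2 - Range M2" for y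
  proof -
    have "load E2 E1 ((M2 - M)\<inverse>) y \<le> 60 * N"
    proof (rule load_bound[OF _ ppD2c])
      show "finite ((M2 - M)\<inverse>)" using fD2 by simp
      show "deg E1 x \<le> N" if "(y, x) \<in> (M2 - M)\<inverse>" for x y using small that M2(3) by (auto simp: U_def)
      have "card (Domain ((M2 - M)\<inverse>) \<inter> nb E2 y) \<le> card (Domain ((M2 - M)\<inverse>))"
        using fD2 by (intro card_mono) (auto simp: Domain_fst)
      also have "\<dots> = card (Domain (M2 - M))"
        using partial_packing_card[OF ppD2] by (simp add: Range_converse)
      also have "\<dots> \<le> card U" using M2(3) fU by (intro card_mono) auto
      finally show "card (Domain ((M2 - M)\<inverse>) \<inter> nb E2 y) \<le> 60" using cU by simp
    qed
    then have "real (load E2 E1 ((M2 - M)\<inverse>) y) \<le> real (60 * N)" by (simp only: of_nat_le_iff)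
    moreover have "load E2 E1 (M2\<inverse>) y = load E2 E1 (M\<inverse>) y + load E2 E1 ((M2 - M)\<inverse>) y"
    proof -
      have "M2\<inverse> - M\<inverse> = (M2 - M)\<inverse>" "M\<inverse> \<subseteq> M2\<inverse>" using M2(2) by auto
      then show ?thesis using load_extend[of "M2\<inverse>" "M\<inverse>" E2 E1 y] fpp[OF M2(1)] by simp
    qed
    ultimately show ?thesis using h6[of y] that subR Nr by auto
  qed
  have load2s: "real (load E1 E2 M2 u) \<le> (32 / 100) * n" if "u \<in> V1 - Domain M2" "3000 * deg E1 u < n" for u
  proof -
    have "real (load E1 E2 M u) \<le> (3 / 10) * n" using that M2(4) unfolding U_def by auto
    then show ?thesis using load2[of u] by simp
  qed

  \<comment> \<open>The terms of \<open>h5\<close> arise here: at most |E2| / 10 vertices have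
    degree at least 20, 19 sqrt (2 |E1|) is l * bb, and 0.096 |E1| covers |B| \<le> 2 |E1| / 87
    together with the load term 76 |E1| / 1050. Non-hubs have room because their load is at most
    0.32 n.\<close>
  define B where "B = {v \<in> V1 - Domain M2. 87 \<le> deg E1 v}"
  define L where "L = {y \<in> V2 - Range M2. deg E2 y \<le> 19}"
  have cB: "87 * real (card B) \<le> 2 * real (card E1)"
    by (rule card_high_degree[OF sg1]) (auto simp: B_def)
  have cL: "real n \<le> real (card L) + card M2 + card E2 / 10"
  proof -
    let ?H = "{y \<in> V2. 20 \<le> deg E2 y}"
    have "20 * real (card ?H) \<le> 2 * real (card E2)" by (rule card_high_degree[OF sg2]) auto
    moreover have "V2 - Range M2 \<subseteq> L \<union> ?H" by (auto simp: L_def)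
    then have "card (V2 - Range M2) \<le> card L + card ?H"
      using fin2 by (intro order_trans[OF card_mono card_Un_le]) (auto simp: L_def)
    then have "n \<le> card L + card ?H + card M2" using card_unplaced(2)[OF sg1 sg2 M2(1)] cV by simp
    then have "real n \<le> real (card L) + real (card ?H) + real (card M2)" by (simp flip: of_nat_add)
    ultimately show ?thesis by linarith
  qed
  have npos: "real n > 0" using nr by linarith
  have "\<exists>M3. partial_packing V1 E1 V2 E2 M3 \<and> M2 \<subseteq> M3 \<and> M3 - M2 \<subseteq> B \<times> L \<and>
     Domain M3 = Domain M2 \<union> B \<and>
     (\<forall>y\<in>V2 - Range M3. real (load E2 E1 ((M3 - M2)\<inverse>) y) \<le> (35 / 100) * n \<or>
        (\<exists>v w. (v, w) \<in> M3 - M2 \<and> w \<in> nb E2 y \<and> load E2 E1 ((M3 - M2)\<inverse>) y = deg E1 v))"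
  proof (rule greedy_embedding[OF sg1 sg2 M2(1), where l = 19 and \<omega> = "19 * real N" and bb = s])
    show "L \<subseteq> V2 - Range M2" "B \<subseteq> V1 - Domain M2" by (auto simp: L_def B_def)
    show "card (nb E2 w \<inter> L) \<le> 19" if "w \<in> L" for w
      using card_mono[OF fnb2, of "nb E2 w \<inter> L" w] that by (auto simp: L_def)
    show "real (\<Sum>y\<in>nb E2 w - Range M2. card (nb E2 y \<inter> L)) \<le> 19 * real N" if w: "w \<in> L" for w
    proof -
      have "(\<Sum>y\<in>nb E2 w - Range M2. card (nb E2 y \<inter> L)) \<le> (\<Sum>y\<in>nb E2 w - Range M2. N)"
      proof (rule sum_mono)
        fix y assume "y \<in> nb E2 w - Range M2"
        then have "y \<in> V2 - Range M" using simple_graph_nb_subset[OF sg2] M2(2) by blast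
        then have "deg E2 y \<le> N" using h2 small by blast
        then show "card (nb E2 y \<inter> L) \<le> N"
          using card_mono[OF fnb2, of "nb E2 y \<inter> L" y] by (meson Int_lower1 le_trans)
      qed
      also have "\<dots> = card (nb E2 w - Range M2) * N" by simp
      also have "\<dots> \<le> 19 * N"
        using card_mono[OF fnb2, of "nb E2 w - Range M2" w] w by (intro mult_le_mono1) (auto simp: L_def)
      finally show ?thesis by (metis of_nat_le_iff of_nat_mult of_nat_numeral)
    qed
    show "2 * real (card E1) \<le> s * s \<or> real (card B) \<le> s" using s0 by simp
    fix v assume v: "v \<in> B"
    have "card (forb E1 E2 M2 v \<inter> L) \<le> card (forb E1 E2 M2 v)"
      using fpp[OF M2(1)] fnb2 by (intro card_mono) (auto simp: forb_def)
    also have "\<dots> \<le> load E1 E2 M2 v" using card_forb_le_load[OF fpp[OF M2(1)]] .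
    finally have 1: "real (card (forb E1 E2 M2 v \<inter> L)) \<le> real (load E1 E2 M2 v)" by simp
    have "(\<Sum>v\<in>B. deg E1 v) \<le> 2 * card E1" by (rule sum_degree_le[OF sg1]) (auto simp: B_def)
    then have "real (\<Sum>v\<in>B. deg E1 v) \<le> real (2 * card E1)" by (simp only: of_nat_le_iff)
    then have "2 / ((35 / 100) * real n) * (19 * real N) * real (\<Sum>v\<in>B. deg E1 v)
        \<le> 2 / ((35 / 100) * real n) * (19 * (real n / 3000)) * (2 * card E1)"
      using Nr npos by (intro mult_mono) (auto intro!: sum_nonneg)
    also have "\<dots> = 76 / 1050 * card E1" using npos by (simp add: field_simps)
    finally have 2: "2 / ((35 / 100) * real n) * (19 * real N) * real (\<Sum>v\<in>B. deg E1 v) \<le> 76 / 1050 * card E1" .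
    have 3: "real (load E1 E2 M2 v) + card E2 / 10 + (96 / 1000) * card E1 + 19 * s + card M2 \<le> n"
    proof (cases "3000 * deg E1 v < n")
      case True
      then have "real (load E1 E2 M2 v) \<le> (32 / 100) * n" using load2s v by (auto simp: B_def)
      then show ?thesis using s er0 h1 cM2 nr by linarith
    next
      case False
      then have "real (load E1 E2 M v) + card E2 / 10 + (96 / 1000) * card E1 + 19 * s + card M + (25 / 1000) * n \<le> n"
        using h5[of v] v subR unfolding s_def by (auto simp: B_def)
      then show ?thesis using load2[of v] cM2 nr by linarith
    qed
    show "real (card (forb E1 E2 M2 v \<inter> L)) + real (card B) + real 19 * s +
        2 / ((35 / 100) * real n) * (19 * real N) * real (\<Sum>v\<in>B. deg E1 v) \<le> real (card L)"
      using 1 2 3 cB cL unfolding of_nat_numeral by linarith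
  qed (use nr s0 in auto)
  then obtain M3 where M3all: "partial_packing V1 E1 V2 E2 M3 \<and> M2 \<subseteq> M3 \<and> M3 - M2 \<subseteq> B \<times> L \<and>
     Domain M3 = Domain M2 \<union> B \<and>
     (\<forall>y\<in>V2 - Range M3. real (load E2 E1 ((M3 - M2)\<inverse>) y) \<le> (35 / 100) * n \<or>
        (\<exists>v w. (v, w) \<in> M3 - M2 \<and> w \<in> nb E2 y \<and> load E2 E1 ((M3 - M2)\<inverse>) y = deg E1 v))"
    by (rule exE)
  note M3 = M3all[THEN conjunct1] M3all[THEN conjunct2, THEN conjunct1]
    M3all[THEN conjunct2, THEN conjunct2, THEN conjunct1]
    M3all[THEN conjunct2, THEN conjunct2, THEN conjunct2, THEN conjunct1]
    M3all[THEN conjunct2, THEN conjunct2, THEN conjunct2, THEN conjunct2, rule_format]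
  have heavy: "\<exists>v w. (v, w) \<in> M3 - M2 \<and> w \<in> nb E2 y \<and> load E2 E1 ((M3 - M2)\<inverse>) y = deg E1 v"
    if y: "y \<in> V2 - Range M3" and nle: "\<not> real (load E2 E1 ((M3 - M2)\<inverse>) y) \<le> (35 / 100) * n" for y
  proof (rule disjE[OF M3(5)[OF y]])
    assume "real (load E2 E1 ((M3 - M2)\<inverse>) y) \<le> (35 / 100) * n"
    then show ?thesis using nle by (rule notE[rotated])
  qed
  have cM3: "real (card M3) \<le> real (card M) + 60 + real (card B)"
    using card_add_placed(1)[OF fin1 fin2 M3(1) M2(1) M3(4)] cM2 by simp
  have ppD3: "partial_packing V1 E1 V2 E2 (M3 - M2)" using partial_packing_subset[OF M3(1)] by simp
  have fD3: "finite (M3 - M2)" using fpp[OF M3(1)] by simp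
  have light: "deg E1 u \<le> 86" if "u \<in> V1 - Domain M3" for u
    using that M3(4) by (auto simp: B_def)
  have load3: "real (load E1 E2 M3 u) \<le> (32 / 100) * n + 1634" if u: "u \<in> V1 - Domain M3" for u
  proof -
    have "load E1 E2 (M3 - M2) u \<le> 86 * 19"
    proof (rule load_bound[OF fD3 ppD3])
      show "deg E2 y \<le> 19" if "(x, y) \<in> M3 - M2" for x y using that M3(3) by (auto simp: L_def)
      show "card (Domain (M3 - M2) \<inter> nb E1 u) \<le> 86"
        using card_mono[OF fnb1, of "Domain (M3 - M2) \<inter> nb E1 u" u] light[OF u] by auto
    qed
    moreover have "real (load E1 E2 M2 u) \<le> (32 / 100) * n"
      using load2s[of u] u M3(4) light[OF u] n by auto
    ultimately show ?thesis using load_extend[OF fpp[OF M3(1)] M3(2), of E1 E2 u] by simp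
  qed
  define F where "F y = load E2 E1 (M3\<inverse>) y" for y
  have F: "real (F y) \<le> (3 / 100) * n + real (load E2 E1 ((M3 - M2)\<inverse>) y)" if y: "y \<in> V2 - Range M3" for y
  proof -
    have "M3\<inverse> - M2\<inverse> = (M3 - M2)\<inverse>" "M2\<inverse> \<subseteq> M3\<inverse>" using M3(2) by auto
    then have "F y = load E2 E1 (M2\<inverse>) y + load E2 E1 ((M3 - M2)\<inverse>) y"
      using load_extend[of "M3\<inverse>" "M2\<inverse>" E2 E1 y] fpp[OF M3(1)] by (simp add: F_def)
    then show ?thesis using cload2[of y] y M3(2) by auto
  qed
  \<comment> \<open>An increment above \<theta> \<ge> 0.35 n must be the degree of a single placed
    vertex. Few vertices have such a degree, and each was placed on a vertex with at most 19
    neighbours.\<close>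
  have hot: "card Y \<le> k * 19"
    if Y: "Y \<subseteq> V2 - Range M3" "\<And>y. y \<in> Y \<Longrightarrow> real (F y) > \<theta> + (3 / 100) * n" and th: "(35 / 100) * n \<le> \<theta>"
      and k: "real (card E1) + real (Suc k) * real (Suc k) < real (Suc k) * \<theta> \<or> (\<forall>v. real (deg E1 v) < \<theta>)" for Y k \<theta>
  proof -
    let ?Big = "{v \<in> V1. \<theta> \<le> real (deg E1 v)}"
    have "card Y \<le> card ?Big * 19"
    proof (rule card_touched_le[OF fD3 ppD3, where \<theta> = \<theta>])
      show "finite ?Big" using fin1 by simp
      show "v \<in> ?Big" if "(v, w) \<in> M3 - M2" "\<theta> \<le> real (deg E1 v)" for v w
        using that M3(1) by (auto simp: partial_packing_def)
      show "deg E2 w \<le> 19" if "(v, w) \<in> M3 - M2" for v w using that M3(3) by (auto simp: L_def)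
      show "finite (nb E2 w)" for w using fnb2 .
      fix y assume y: "y \<in> Y"
      have yU: "y \<in> V2 - Range M3" using Y(1) y by blast
      have gt: "real (load E2 E1 ((M3 - M2)\<inverse>) y) > \<theta>" using F[OF yU] Y(2)[OF y] by linarith
      then have "\<not> real (load E2 E1 ((M3 - M2)\<inverse>) y) \<le> (35 / 100) * n" using th by linarith
      from heavy[OF yU this] obtain v w where "(v, w) \<in> M3 - M2" "w \<in> nb E2 y"
        "load E2 E1 ((M3 - M2)\<inverse>) y = deg E1 v" by (elim exE conjE)
      moreover from this(3) have "\<theta> \<le> real (deg E1 v)" using gt by linarith
      ultimately show "\<exists>v w. (v, w) \<in> M3 - M2 \<and> w \<in> nb E2 y \<and> \<theta> \<le> real (deg E1 v)" by blast
    qed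
    moreover have "card ?Big \<le> k"
      using k
    proof
      assume k1: "real (card E1) + real (Suc k) * real (Suc k) < real (Suc k) * \<theta>"
      show ?thesis
      proof (rule card_high_degree_le[OF sg1 _ _ k1])
        show "?Big \<subseteq> V1" by blast
        show "\<theta> \<le> real (deg E1 v)" if "v \<in> ?Big" for v using that by blast
      qed
    next
      assume "\<forall>v. real (deg E1 v) < \<theta>"
      then have "?Big = {}" by (auto simp: not_le)
      then show ?thesis by (simp only: card.empty le0)
    qed
    ultimately show ?thesis using mult_le_mono1[of "card ?Big" k 19] by linarith
  qed
  have Fmax: "real (F y) \<le> (88 / 100) * n" if "y \<in> V2 - Range M3" for y
  proof -
    have d: "real (deg E1 v) \<le> (85 / 100) * n" if "(v, w) \<in> M3 - M2" for v w
    proof -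
      have "v \<in> V1 - Domain M2" using that M3(3) unfolding B_def by blast
      then have "v \<in> V1 - Domain M" using subR(2) by blast
      then show ?thesis by (rule h7)
    qed
    have "real (load E2 E1 ((M3 - M2)\<inverse>) y) \<le> (85 / 100) * n"
    proof (cases "real (load E2 E1 ((M3 - M2)\<inverse>) y) \<le> (35 / 100) * n")
      case True then show ?thesis using nr by linarith
    next
      case False
      from heavy[OF that this] obtain v w where "(v, w) \<in> M3 - M2"
        "load E2 E1 ((M3 - M2)\<inverse>) y = deg E1 v" by (elim exE conjE)
      then show ?thesis using d[of v w] by simp
    qed
    then show ?thesis using F[OF that] by simp
  qed
  \<comment> \<open>The thresholds are 0.61 n and 0.36 n plus 0.03 n. A vertex of degree 0.61 n
    leaves at most 2.39 n < 4 * 0.61 n edges in \<open>E1\<close>, so there are at most 3 of them;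
    likewise 2.64 n < 8 * 0.36 n gives at most 7. With 19 neighbours each this makes 57 and
    133.\<close>
  define Y1 where "Y1 = {y \<in> V2 - Range M3. real (F y) > (64 / 100) * n}"
  define Y2 where "Y2 = {y \<in> V2 - Range M3. real (F y) > (39 / 100) * n}"
  have cY1: "card Y1 \<le> 57"
  proof -
    have "card Y1 \<le> 3 * 19"
    proof (rule hot[where \<theta> = "(61 / 100) * n"])
      show "real (card E1) + real (Suc 3) * real (Suc 3) < real (Suc 3) * ((61 / 100) * n) \<or> (\<forall>v. real (deg E1 v) < (61 / 100) * n)"
      proof (cases "\<forall>v. real (deg E1 v) < (61 / 100) * n")
        case False
        then obtain v where "(61 / 100) * n \<le> real (deg E1 v)" by (auto simp: not_less)
        then have "real (card E1) \<le> (239 / 100) * n" using er[of v] by linarith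
        then show ?thesis using nr by simp
      qed simp
    qed (use nr in \<open>auto simp: Y1_def\<close>)
    then show ?thesis by simp
  qed
  have cY1r: "real (card Y1) \<le> 57" using cY1 by simp
  have e20: "real (card E2) \<ge> 0" by simp
  have cY2: "card Y2 \<le> 133"
  proof -
    have "card Y2 \<le> 7 * 19"
    proof (rule hot[where \<theta> = "(36 / 100) * n"])
      show "real (card E1) + real (Suc 7) * real (Suc 7) < real (Suc 7) * ((36 / 100) * n) \<or> (\<forall>v. real (deg E1 v) < (36 / 100) * n)"
      proof (cases "\<forall>v. real (deg E1 v) < (36 / 100) * n")
        case False
        then obtain v where "(36 / 100) * n \<le> real (deg E1 v)" by (auto simp: not_less)
        then have "real (card E1) \<le> (264 / 100) * n" using er[of v] by linarith
        then show ?thesis using nr by simp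
      qed simp
    qed (use nr in \<open>auto simp: Y2_def\<close>)
    then show ?thesis by simp
  qed
  have finc: "card (forb E2 E1 (Mx\<inverse>) y \<inter> S) \<le> load E2 E1 (Mx\<inverse>) y"
    if "partial_packing V1 E1 V2 E2 Mx" for Mx y S
  proof -
    have f: "finite (Mx\<inverse>)" using fpp[OF that] by simp
    have "card (forb E2 E1 (Mx\<inverse>) y \<inter> S) \<le> card (forb E2 E1 (Mx\<inverse>) y)"
      using f fnb1 by (intro card_mono) (auto simp: forb_def)
    then show ?thesis using card_forb_le_load[OF f, of E2 E1 y] by linarith
  qed
  have "\<exists>M4. partial_packing V1 E1 V2 E2 M4 \<and> M3 \<subseteq> M4 \<and> M4 - M3 \<subseteq> (V1 - Domain M3) \<times> Y1 \<and>
     Range M4 = Range M3 \<union> Y1"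
  proof (rule greedy_embedding_few_conv[OF sg1 sg2 M3(1) order_refl, where l = 86])
    show "Y1 \<subseteq> V2 - Range M3" by (auto simp: Y1_def)
    show "deg E1 w \<le> 86" if "w \<in> V1 - Domain M3" for w using light[OF that] .
    fix y assume y: "y \<in> Y1"
    have 1: "real (card (forb E2 E1 (M3\<inverse>) y \<inter> (V1 - Domain M3))) \<le> (88 / 100) * n"
      using finc[OF M3(1), of y "V1 - Domain M3"] Fmax[of y] y by (auto simp: Y1_def F_def)
    have 2: "real (card (V1 - Domain M3)) + real (card M3) = real n"
      using card_unplaced(1)[OF sg1 sg2 M3(1)] cV by (simp flip: of_nat_add)
    \<comment> \<open>A member of \<open>Y1\<close> reveals a vertex of degree above 0.61 n. The
      edge total then bounds \<open>E1\<close>, and with it \<open>B\<close>, better than 3 n would;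
      otherwise the room would be exceeded for the smallest n.\<close>
    have 3: "real (card E1) \<le> (239 / 100) * n"
    proof -
      have yU: "y \<in> V2 - Range M3" and Fy: "real (F y) > (64 / 100) * n" using y by (auto simp: Y1_def)
      have gt: "real (load E2 E1 ((M3 - M2)\<inverse>) y) > (61 / 100) * n" using F[OF yU] Fy by linarith
      then have "\<not> real (load E2 E1 ((M3 - M2)\<inverse>) y) \<le> (35 / 100) * n" using nr by linarith
      from heavy[OF yU this] obtain v where "load E2 E1 ((M3 - M2)\<inverse>) y = deg E1 v" by (elim exE conjE)
      then have "real (deg E1 v) > (61 / 100) * n" using gt by simp
      then show ?thesis using er[of v] by linarith
    qed
    have "real (card (forb E2 E1 (M3\<inverse>) y \<inter> (V1 - Domain M3)) + card Y1 + 86 * card Y1) < real (card (V1 - Domain M3))"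
      using 1 2 3 cY1r cM3 cB h1 nr unfolding of_nat_add of_nat_mult of_nat_numeral by linarith
    then show "card (forb E2 E1 (M3\<inverse>) y \<inter> (V1 - Domain M3)) + card Y1 + 86 * card Y1 < card (V1 - Domain M3)"
      by (simp only: of_nat_less_iff)
  qed
  then obtain M4 where M4: "partial_packing V1 E1 V2 E2 M4" "M3 \<subseteq> M4" "M4 - M3 \<subseteq> (V1 - Domain M3) \<times> Y1"
     "Range M4 = Range M3 \<union> Y1" by blast
  have cM4: "real (card M4) \<le> real (card M3) + 57"
    using card_add_placed(2)[OF fin1 fin2 M4(1) M3(1) M4(4)] cY1 by simp
  have fY: "finite Y1" "finite Y2" using fin2 by (auto simp: Y1_def Y2_def)
  have cinc: "real (load E2 E1 (Mb\<inverse>) y) \<le> real (load E2 E1 (Ma\<inverse>) y) + real k * 86"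
    if a: "partial_packing V1 E1 V2 E2 Mb" "Ma \<subseteq> Mb" "Mb - Ma \<subseteq> (V1 - Domain M3) \<times> Y" "finite Y" "card Y \<le> k"
    for Ma Mb Y k y
  proof -
    have ppd: "partial_packing V1 E1 V2 E2 (Mb - Ma)" using partial_packing_subset[OF a(1)] by simp
    have "load E2 E1 ((Mb - Ma)\<inverse>) y \<le> k * 86"
    proof (rule load_bound[OF _ partial_packing_converseI[OF ppd]])
      show "finite ((Mb - Ma)\<inverse>)" using fpp[OF a(1)] by simp
      show "deg E1 x \<le> 86" if "(y, x) \<in> (Mb - Ma)\<inverse>" for x y using that a(3) light by auto
      have "card (Domain ((Mb - Ma)\<inverse>) \<inter> nb E2 y) \<le> card Y" using a(3,4) by (intro card_mono) auto
      then show "card (Domain ((Mb - Ma)\<inverse>) \<inter> nb E2 y) \<le> k" using a(5) by simp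
    qed
    then have "real (load E2 E1 ((Mb - Ma)\<inverse>) y) \<le> real (k * 86)" by (simp only: of_nat_le_iff)
    moreover have "load E2 E1 (Mb\<inverse>) y = load E2 E1 (Ma\<inverse>) y + load E2 E1 ((Mb - Ma)\<inverse>) y"
    proof -
      have "Mb\<inverse> - Ma\<inverse> = (Mb - Ma)\<inverse>" "Ma\<inverse> \<subseteq> Mb\<inverse>" using a(2) by auto
      then show ?thesis using load_extend[of "Mb\<inverse>" "Ma\<inverse>" E2 E1 y] fpp[OF a(1)] by simp
    qed
    ultimately show ?thesis by simp
  qed
  define Y2' where "Y2' = Y2 - Y1"
  have cY2': "card Y2' \<le> 133" "finite Y2'"
    using cY2 fY card_mono[of Y2 Y2'] by (auto simp: Y2'_def)
  have "\<exists>M5. partial_packing V1 E1 V2 E2 M5 \<and> M4 \<subseteq> M5 \<and> M5 - M4 \<subseteq> (V1 - Domain M4) \<times> Y2' \<and>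
     Range M5 = Range M4 \<union> Y2'"
  proof (rule greedy_embedding_few_conv[OF sg1 sg2 M4(1) order_refl, where l = 86])
    show "Y2' \<subseteq> V2 - Range M4" using M4(4) by (auto simp: Y2'_def Y2_def)
    show "deg E1 w \<le> 86" if "w \<in> V1 - Domain M4" for w using light that M4(2) by blast
    fix y assume y: "y \<in> Y2'"
    have "real (load E2 E1 (M4\<inverse>) y) \<le> (64 / 100) * n + 57 * 86"
      using cinc[OF M4(1,2,3) fY(1) cY1, of y] y by (auto simp: Y2'_def Y1_def Y2_def F_def)
    then have 1: "real (card (forb E2 E1 (M4\<inverse>) y \<inter> (V1 - Domain M4))) \<le> (64 / 100) * n + 57 * 86"
      using finc[OF M4(1), of y "V1 - Domain M4"] by linarith
    have 2: "real (card (V1 - Domain M4)) + real (card M4) = real n"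
      using card_unplaced(1)[OF sg1 sg2 M4(1)] cV by (simp flip: of_nat_add)
    have 4: "real (card Y2') \<le> 133" using cY2' by simp
    have "real (card (forb E2 E1 (M4\<inverse>) y \<inter> (V1 - Domain M4)) + card Y2' + 86 * card Y2') < real (card (V1 - Domain M4))"
      using 1 2 4 er0 e20 cM3 cM4 cB h1 nr unfolding of_nat_add of_nat_mult of_nat_numeral by linarith
    then show "card (forb E2 E1 (M4\<inverse>) y \<inter> (V1 - Domain M4)) + card Y2' + 86 * card Y2' < card (V1 - Domain M4)"
      by (simp only: of_nat_less_iff)
  qed
  then obtain M5 where M5: "partial_packing V1 E1 V2 E2 M5" "M4 \<subseteq> M5" "M5 - M4 \<subseteq> (V1 - Domain M4) \<times> Y2'"
     "Range M5 = Range M4 \<union> Y2'" by blast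
  have cM5: "real (card M5) \<le> real (card M4) + 133"
    using card_add_placed(2)[OF fin1 fin2 M5(1) M4(1) M5(4)] cY2' by simp
  have sub5: "V1 - Domain M5 \<subseteq> V1 - Domain M3" "V2 - Range M5 \<subseteq> V2 - Range M" "M3 \<subseteq> M5"
    using M4(2) M5(2) M3(2) M2(2) by blast+
  \<comment> \<open>0.3487 exceeds 0.32 + 86 / 3000, 1634 = 86 * 19 and 16340 = (57 + 133) * 86. In
    the final count the fractions of n add up to about 0.9, and the constants, about 18300, take at
    most 0.071 n.\<close>
  define g where "g = nat \<lfloor>(3487 / 10000) * real n + 1634\<rfloor>"
  define f where "f = nat \<lfloor>(39 / 100) * real n + 16340\<rfloor>"
  show ?thesis
  proof (rule swap_completion[OF sg1 sg2 _ M5(1), where q = 86 and D = N and g = g and f = f])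
    show "card V1 = card V2" using cV by simp
    show "deg E1 u \<le> 86" if "u \<in> V1 - Domain M5" for u using light sub5(1) that by blast
    show "deg E2 y \<le> N" if "y \<in> V2 - Range M5" for y using small h2 sub5(2) that by blast
    show "card (forb E1 E2 M5 u) \<le> g" if u: "u \<in> V1 - Domain M5" for u
    proof -
      have u3: "u \<in> V1 - Domain M3" using sub5(1) u by blast
      have ppd: "partial_packing V1 E1 V2 E2 (M5 - M3)" using partial_packing_subset[OF M5(1)] by simp
      have "load E1 E2 (M5 - M3) u \<le> 86 * N"
      proof (rule load_bound[OF _ ppd])
        show "finite (M5 - M3)" using fpp[OF M5(1)] by simp
        show "deg E2 y \<le> N" if "(x, y) \<in> M5 - M3" for x y
        proof -
          have "y \<in> V2 - Range M3" using that M4(3) M5(3) by (auto simp: Y1_def Y2_def Y2'_def)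
          then show ?thesis using small h2 M3(2) M2(2) by blast
        qed
        show "card (Domain (M5 - M3) \<inter> nb E1 u) \<le> 86"
          using card_mono[OF fnb1, of "Domain (M5 - M3) \<inter> nb E1 u" u] light[OF u3] by auto
      qed
      then have "real (load E1 E2 (M5 - M3) u) \<le> real (86 * N)" by (simp only: of_nat_le_iff)
      then have "real (load E1 E2 M5 u) \<le> (3487 / 10000) * real n + 1634"
        using load_extend[OF fpp[OF M5(1)] sub5(3), of E1 E2 u] load3[OF u3] Nr by simp
      then have "load E1 E2 M5 u \<le> g" unfolding g_def by (rule le_nat_floor)
      then show ?thesis using card_forb_le_load[OF fpp[OF M5(1)], of E1 E2 u] by linarith
    qed
    show "card (forb E2 E1 (M5\<inverse>) y) \<le> f" if y: "y \<in> V2 - Range M5" for y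
    proof -
      have sub4: "M5 - M4 \<subseteq> (V1 - Domain M3) \<times> Y2'" using M5(3) M4(2) by blast
      have "y \<in> V2 - Range M3 - Y1 - Y2'" using y M4(4) M5(4) by auto
      then have "real (F y) \<le> (39 / 100) * n" by (auto simp: Y1_def Y2_def Y2'_def)
      then have "real (load E2 E1 (M5\<inverse>) y) \<le> (39 / 100) * real n + 16340"
        using cinc[OF M4(1,2,3) fY(1) cY1, of y] cinc[OF M5(1,2) sub4 cY2'(2,1), of y] by (simp add: F_def)
      then have "load E2 E1 (M5\<inverse>) y \<le> f" unfolding f_def by (rule le_nat_floor)
      then show ?thesis using finc[OF M5(1), of y UNIV] by simp
    qed
    have "real g \<le> (3487 / 10000) * real n + 1634" "real f \<le> (39 / 100) * real n + 16340"
      unfolding g_def f_def using nr by (intro of_nat_floor; simp)+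
    then have "real (g + f + 2 * 86 * N + 86 + 1 + card M5) < real (card V1)"
      using cM5 cM4 cM3 cB er0 e20 h1 nr Nr unfolding cV(1) of_nat_add of_nat_mult of_nat_numeral of_nat_1 by linarith
    then show "g + f + 2 * 86 * N + 86 + 1 + card M5 < card V1" by (simp only: of_nat_less_iff)
  qed
qed

section \<open>Placing the hubs\<close>

definition hubs :: "nat \<Rightarrow> 'a set \<Rightarrow> 'a set set \<Rightarrow> 'a set" where
  "hubs n V E = {v \<in> V. n \<le> 3000 * deg E v}"

lemma card_hubs:
  assumes "simple_graph V E"
  shows "real n * real (card (hubs n V E)) \<le> 6000 * real (card E)"
proof -
  have "real n / 3000 * real (card (hubs n V E)) \<le> 2 * real (card E)"
  proof (rule card_high_degree[OF assms])
    show "hubs n V E \<subseteq> V" by (auto simp: hubs_def)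
    fix v assume "v \<in> hubs n V E"
    then have "real n \<le> real (3000 * deg E v)" unfolding hubs_def of_nat_le_iff by simp
    then show "real n / 3000 \<le> real (deg E v)" by simp
  qed
  then show ?thesis by (simp add: field_simps)
qed

lemma few_hubs:
  assumes sg: "simple_graph V E" and n: "0 < n" and e: "2 * real (card E) * 180000 \<le> real n * real n"
  shows "60 * real (card (hubs n V E)) \<le> real n"
proof -
  have "real n * (60 * real (card (hubs n V E))) \<le> real n * real n" using card_hubs[OF sg, of n] e by linarith
  then show ?thesis using n by simp
qed

text \<open>Markov's inequality for the load, after double counting.\<close>

lemma card_high_load:
  assumes sg: "simple_graph V1 E1" and fin: "finite M" and S: "S \<subseteq> V1"
    and k: "\<And>x y. (x, y) \<in> M \<Longrightarrow> card (nb E1 x \<inter> S) \<le> k"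
    and t: "\<And>u. u \<in> S \<Longrightarrow> t \<le> real (load E1 E2 M u)"
  shows "t * real (card S) \<le> real k * (\<Sum>p\<in>M. real (deg E2 (snd p)))"
proof -
  have "t * real (card S) = (\<Sum>u\<in>S. t)" by simp
  also have "\<dots> \<le> (\<Sum>u\<in>S. real (load E1 E2 M u))" using t by (intro sum_mono) auto
  also have "\<dots> = real (\<Sum>u\<in>S. load E1 E2 M u)" by simp
  also have "(\<Sum>u\<in>S. load E1 E2 M u) = (\<Sum>p\<in>M. card (nb E1 (fst p) \<inter> S) * deg E2 (snd p))"
    using sum_load_weighted[OF sg fin S, of E2 "\<lambda>_. 1"] by simp
  also have "\<dots> \<le> (\<Sum>p\<in>M. k * deg E2 (snd p))"
    using k by (intro sum_mono mult_le_mono1) auto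
  also have "real \<dots> = real k * (\<Sum>p\<in>M. real (deg E2 (snd p)))" by (simp add: sum_distrib_left)
  finally show ?thesis by simp
qed

text \<open>\<open>M1\<close> is a preparatory packing, \<open>B\<close> the hubs of the second
  graph that it misses, and \<open>L\<close> the candidates of the first graph that receive them. By
  \<open>U0\<close> the vertices heavily loaded by \<open>M1\<close> have no neighbour in
  \<open>L\<close>, so large loads of the two stages never add up. By \<open>hubL\<close> and
  \<open>h5\<close>, a hub of the first graph is charged for the second stage only if it sees
  \<open>L\<close>.\<close>

lemma packs_via_hub_placement:
  fixes n k l :: nat and \<gamma> \<omega> bb :: real
  assumes sg1: "simple_graph V1 E1" and sg2: "simple_graph V2 E2"
    and cV: "card V1 = n" "card V2 = n" and n: "261000 \<le> n"
    and tot: "\<And>v. card E1 + card E2 + deg E1 v \<le> 3 * n"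
    and e1: "2 * real (card E1) * 92000 \<le> real n * real n"
    and pp: "partial_packing V1 E1 V2 E2 M1"
    and B: "B = hubs n V2 E2 - Range M1"
    and cM1: "card M1 \<le> 10" and cB: "real (card B) + 10 \<le> (34 / 1000) * n"
    and L: "L \<subseteq> V1 - Domain M1"
    and U0: "card {u \<in> V1 - Domain M1. real (load E1 E2 M1 u) > (2 / 100) * n} \<le> 12"
      "\<And>u. u \<in> V1 - Domain M1 \<Longrightarrow> real (load E1 E2 M1 u) > (2 / 100) * n \<Longrightarrow> nb E1 u \<inter> L = {}"
      "\<And>u. u \<in> V1 - Domain M1 \<Longrightarrow> real (load E1 E2 M1 u) \<le> (7 / 10) * n"
    and F0: "\<And>y. y \<in> V2 - Range M1 \<Longrightarrow> real (load E2 E1 (M1\<inverse>) y) \<le> (5 / 1000) * n"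
    and k: "\<And>x. x \<in> L \<Longrightarrow> card (nb E1 x - Domain M1) \<le> k"
    and d4: "\<And>x. x \<in> L \<Longrightarrow> deg E1 x \<le> 4"
    and l: "\<And>x. x \<in> L \<Longrightarrow> card (nb E1 x \<inter> L) \<le> l"
    and om: "\<And>x. x \<in> L \<Longrightarrow> real (\<Sum>u\<in>nb E1 x - Domain M1. card (nb E1 u \<inter> L)) \<le> \<omega>"
    and pos: "0 < \<gamma>" "\<gamma> \<le> (8 / 10) * n" "0 \<le> \<omega>" "0 \<le> bb"
    and bb: "2 * real (card E2) \<le> bb * bb \<or> real (card B) \<le> bb"
    and room: "\<And>h. h \<in> B \<Longrightarrow> real (card (forb E2 E1 (M1\<inverse>) h \<inter> L)) + real (card B) + real l * bb
      + 2 / \<gamma> * \<omega> * real (\<Sum>h\<in>B. deg E2 h) \<le> real (card L)"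
    and sumB: "real k * real (\<Sum>h\<in>B. deg E2 h) \<le> 12 * n"
    and dB: "(\<forall>x\<in>L. nb E1 x \<subseteq> Domain M1) \<or> (\<forall>h\<in>B. real (deg E2 h) \<le> (85 / 100) * n)"
    and hubL: "\<And>u. u \<in> V1 - Domain M1 \<Longrightarrow> n \<le> 3000 * deg E1 u \<Longrightarrow> nb E1 u \<inter> L \<noteq> {} \<Longrightarrow>
      \<gamma> \<le> (54 / 100) * n \<and> (\<forall>h\<in>B. real (deg E2 h) \<le> (54 / 100) * n)"
    and h5: "\<And>u. u \<in> V1 - Domain M1 \<Longrightarrow> n \<le> 3000 * deg E1 u \<Longrightarrow>
      real (load E1 E2 M1 u) + (if nb E1 u \<inter> L = {} then 0 else (54 / 100) * n) + card E2 / 10 + (96 / 1000) * card E1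
        + 19 * sqrt (2 * real (card E1)) + card B + 10 + (25 / 1000) * n \<le> n"
    and h7: "\<And>v. v \<in> V1 - Domain M1 \<Longrightarrow> real (deg E1 v) \<le> (85 / 100) * n"
  shows "packs V1 E1 V2 E2"
proof -
  have fin1: "finite V1" and fin2: "finite V2" using sg1 sg2 simple_graph_finite by auto
  have fnb1: "finite (nb E1 v)" for v using simple_graph_nb_finite[OF sg1] .
  have fnb2: "finite (nb E2 v)" for v using simple_graph_nb_finite[OF sg2] .
  have nr: "261000 \<le> real n" using n by simp
  have fB: "finite B" using fin2 B by (auto simp: hubs_def)
  have "\<exists>M. partial_packing V1 E1 V2 E2 M \<and> M1 \<subseteq> M \<and> M - M1 \<subseteq> L \<times> B \<and>
     Range M = Range M1 \<union> B \<and>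
     (\<forall>u\<in>V1 - Domain M. real (load E1 E2 (M - M1) u) \<le> \<gamma> \<or>
        (\<exists>w v. (w, v) \<in> M - M1 \<and> w \<in> nb E1 u \<and> load E1 E2 (M - M1) u = deg E2 v))"
  proof (rule greedy_embedding_conv[OF sg1 sg2 pp L l om pos(1,3,4) _ bb room])
    show "B \<subseteq> V2 - Range M1" unfolding B by (auto simp: hubs_def)
  qed
  then obtain M where Mall: "partial_packing V1 E1 V2 E2 M \<and> M1 \<subseteq> M \<and> M - M1 \<subseteq> L \<times> B \<and>
     Range M = Range M1 \<union> B \<and>
     (\<forall>u\<in>V1 - Domain M. real (load E1 E2 (M - M1) u) \<le> \<gamma> \<or>
        (\<exists>w v. (w, v) \<in> M - M1 \<and> w \<in> nb E1 u \<and> load E1 E2 (M - M1) u = deg E2 v))"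
    by (rule exE)
  note M = Mall[THEN conjunct1] Mall[THEN conjunct2, THEN conjunct1]
    Mall[THEN conjunct2, THEN conjunct2, THEN conjunct1]
    Mall[THEN conjunct2, THEN conjunct2, THEN conjunct2, THEN conjunct1]
    Mall[THEN conjunct2, THEN conjunct2, THEN conjunct2, THEN conjunct2, rule_format]
  have fM: "finite M" using partial_packing_finite[OF M(1) fin1 fin2] .
  define A where "A = load E1 E2 (M - M1)"
  have lM: "load E1 E2 M u = load E1 E2 M1 u + A u" for u
    unfolding A_def by (rule load_extend[OF fM M(2)])
  have A0: "A u = 0" if "nb E1 u \<inter> L = {}" for u
  proof -
    have "{p \<in> M - M1. fst p \<in> nb E1 u} = {}" using M(3) that by auto
    then show ?thesis unfolding A_def load_def by (simp only: sum.empty)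
  qed
  have sub: "V1 - Domain M \<subseteq> V1 - Domain M1" "V2 - Range M \<subseteq> V2 - Range M1" using M(2) by blast+
  have Abound: "real (A u) \<le> t"
    if u: "u \<in> V1 - Domain M" "nb E1 u \<inter> L \<noteq> {}" and t: "\<gamma> \<le> t" "\<forall>h\<in>B. real (deg E2 h) \<le> t" for u t
  proof (rule disjE[OF M(5)[OF u(1)]])
    assume "real (load E1 E2 (M - M1) u) \<le> \<gamma>" then show ?thesis using t by (simp add: A_def)
  next
    assume "\<exists>w v. (w, v) \<in> M - M1 \<and> w \<in> nb E1 u \<and> load E1 E2 (M - M1) u = deg E2 v"
    then obtain w v where wv: "(w, v) \<in> M - M1" "load E1 E2 (M - M1) u = deg E2 v" by (elim exE conjE)
    then have "v \<in> B" using M(3) by blast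
    then show ?thesis using t wv(2) by (simp add: A_def)
  qed
  have cM: "card M \<le> card M1 + card B"
    using card_add_placed(2)[OF fin1 fin2 M(1) pp M(4)] .
  have inj: "inj_on snd (M - M1)"
    using M(1) unfolding inj_on_def partial_packing_def by (metis DiffD1 prod.collapse)
  have sumM: "(\<Sum>p\<in>M - M1. real (deg E2 (snd p))) \<le> real (\<Sum>h\<in>B. deg E2 h)"
  proof -
    have "(\<Sum>p\<in>M - M1. real (deg E2 (snd p))) = (\<Sum>h\<in>snd ` (M - M1). real (deg E2 h))"
      using inj by (simp add: sum.reindex)
    also have "\<dots> \<le> (\<Sum>h\<in>B. real (deg E2 h))"
      using M(3) fB by (intro sum_mono2) auto
    finally show ?thesis by simp
  qed
  show ?thesis
  proof (rule packs_of_partial_packing[OF sg1 sg2 cV n tot e1 M(1)])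
    show "real (card M) \<le> (34 / 1000) * real n" using cM cM1 cB by linarith
    show "3000 * deg E2 y < n" if "y \<in> V2 - Range M" for y
      using that M(4) unfolding B hubs_def by auto
    show "real (load E1 E2 M u) \<le> (88 / 100) * real n" if u: "u \<in> V1 - Domain M" for u
    proof (cases "nb E1 u \<inter> L = {}")
      case True
      then show ?thesis using lM[of u] A0[of u] U0(3)[of u] u sub nr by auto
    next
      case False
      then have "\<not> real (load E1 E2 M1 u) > (2 / 100) * n" using U0(2)[of u] u sub by blast
      moreover have "\<forall>h\<in>B. real (deg E2 h) \<le> (85 / 100) * n"
        using dB
      proof
        assume *: "\<forall>x\<in>L. nb E1 x \<subseteq> Domain M1"
        obtain x where "x \<in> nb E1 u" "x \<in> L" using False by blast
        then have "u \<in> Domain M1" using * nb_sym[of x E1 u] by blast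
        then show ?thesis using u sub by blast
      qed
      then have "real (A u) \<le> (85 / 100) * n" using Abound[OF u False, of "(85 / 100) * n"] pos(2) nr by simp
      ultimately show ?thesis using lM[of u] nr by simp
    qed
    show "card {u \<in> V1 - Domain M. 3000 * deg E1 u < n \<and> (3 / 10) * real n < real (load E1 E2 M u)} \<le> 60"
    proof -
      \<comment> \<open>The threshold 0.3 n splits as 0.02 n from \<open>M1\<close> and 0.28 n from
        the hubs. At most 12 vertices exceed the first part and at most 12 / 0.28 < 43 the
        second.\<close>
      let ?T = "{u \<in> V1 - Domain M1. real (load E1 E2 M1 u) > (2 / 100) * n}"
      let ?S = "{u \<in> V1 - Domain M. (28 / 100) * n < real (A u)}"
      let ?X = "{u \<in> V1 - Domain M. 3000 * deg E1 u < n \<and> (3 / 10) * real n < real (load E1 E2 M u)}"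
      have "(28 / 100) * real n * real (card ?S) \<le> real k * (\<Sum>p\<in>M - M1. real (deg E2 (snd p)))"
      proof (rule card_high_load[OF sg1])
        show "finite (M - M1)" using fM by simp
        show "card (nb E1 x \<inter> ?S) \<le> k" if "(x, y) \<in> M - M1" for x y
        proof -
          have "card (nb E1 x \<inter> ?S) \<le> card (nb E1 x - Domain M1)"
            using fnb1 sub by (intro card_mono) auto
          then show ?thesis using k[of x] that M(3) by auto
        qed
      qed (auto simp: A_def)
      also have "\<dots> \<le> real k * real (\<Sum>h\<in>B. deg E2 h)" using sumM by (intro mult_left_mono) auto
      also have "\<dots> \<le> 12 * real n" using sumB by simp
      finally have "real n * ((28 / 100) * real (card ?S)) \<le> real n * 12" by (simp add: mult_ac)
      then have "(28 / 100) * real (card ?S) \<le> 12" using nr by simp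
      then have S: "card ?S \<le> 42" by simp
      have "?X \<subseteq> ?T \<union> ?S"
      proof
        fix u assume u: "u \<in> ?X"
        then have "(3 / 10) * real n < real (load E1 E2 M1 u) + real (A u)" using lM[of u] by simp
        then show "u \<in> ?T \<union> ?S" using u sub by auto
      qed
      then have "card ?X \<le> card (?T \<union> ?S)" using fin1 by (intro card_mono) auto
      also have "\<dots> \<le> card ?T + card ?S" by (rule card_Un_le)
      finally show ?thesis using U0(1) S by linarith
    qed
    show "real (load E1 E2 M u) + real (card E2) / 10 + (96 / 1000) * real (card E1) + 19 * sqrt (2 * real (card E1))
        + real (card M) + (25 / 1000) * real n \<le> real n"
      if u: "u \<in> V1 - Domain M" "n \<le> 3000 * deg E1 u" for u
    proof -
      have u1: "u \<in> V1 - Domain M1" using u sub by blast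
      have "real (A u) \<le> (if nb E1 u \<inter> L = {} then 0 else (54 / 100) * n)"
      proof (cases "nb E1 u \<inter> L = {}")
        case True then show ?thesis using A0 by simp
      next
        case False
        have "real (A u) \<le> (54 / 100) * n" using hubL[OF u1 u(2) False] by (intro Abound[OF u(1) False]) auto
        then show ?thesis using False by simp
      qed
      moreover have "real (load E1 E2 M u) = real (load E1 E2 M1 u) + real (A u)" using lM by simp
      moreover have "real (card M) \<le> 10 + real (card B)" using cM cM1 by linarith
      ultimately show ?thesis using h5[OF u1 u(2)] by linarith
    qed
    show "real (load E2 E1 (M\<inverse>) y) \<le> (1 / 100) * real n" if y: "y \<in> V2 - Range M" for y
    proof -
      have eq: "M\<inverse> - M1\<inverse> = (M - M1)\<inverse>" "M1\<inverse> \<subseteq> M\<inverse>" using M(2) by auto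
      then have 1: "load E2 E1 (M\<inverse>) y = load E2 E1 (M1\<inverse>) y + load E2 E1 ((M - M1)\<inverse>) y"
        using load_extend[of "M\<inverse>" "M1\<inverse>" E2 E1 y] fM by simp
      have ppd: "partial_packing V1 E1 V2 E2 (M - M1)" using partial_packing_subset[OF M(1)] by simp
      have "load E2 E1 ((M - M1)\<inverse>) y \<le> deg E2 y * 4"
      proof (rule load_bound[OF _ partial_packing_converseI[OF ppd]])
        show "finite ((M - M1)\<inverse>)" using fM by simp
        show "deg E1 x \<le> 4" if "(h, x) \<in> (M - M1)\<inverse>" for h x using d4[of x] that M(3) by auto
        show "card (Domain ((M - M1)\<inverse>) \<inter> nb E2 y) \<le> deg E2 y"
          using fnb2 by (intro card_mono) auto
      qed
      moreover have "3000 * deg E2 y < n" using y M(4) unfolding B hubs_def by auto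
      ultimately have "3000 * load E2 E1 ((M - M1)\<inverse>) y \<le> 4 * n" by linarith
      then have "3000 * real (load E2 E1 ((M - M1)\<inverse>) y) \<le> 4 * real n"
        by (metis of_nat_le_iff of_nat_mult of_nat_numeral)
      then show ?thesis using 1 F0[of y] y sub by auto
    qed
    show "real (deg E1 v) \<le> (85 / 100) * real n" if "v \<in> V1 - Domain M" for v
      using h7 that sub by blast
  qed
qed

lemma load_empty: "load E1 E2 {} u = 0"
  by (simp add: load_def)

lemma forb_empty: "forb E1 E2 {} u = {}"
  by (simp add: forb_def)

lemma sqrt_le_of_square:
  assumes "0 \<le> c" "0 \<le> x" "0 \<le> y" "x * (c * c) \<le> y * y"
  shows "c * sqrt x \<le> (y::real)"
proof -
  have "(c * sqrt x) * (c * sqrt x) \<le> y * y" using assms by (simp add: mult_ac)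
  then show ?thesis using assms by (metis abs_le_square_iff abs_of_nonneg mult_nonneg_nonneg power2_eq_square real_sqrt_ge_zero)
qed

text \<open>Every vertex has at most one neighbour in \<open>R\<close>, whence \<omega> = l = k = 1.
  The room consists of 18000 for the hubs themselves, 18000 for targets blocked by their neighbours,
  and a load term of 15; this is the origin of 36020.\<close>

lemma packs_of_leaf_representatives:
  assumes sg1: "simple_graph V1 E1" and sg2: "simple_graph V2 E2"
    and cV: "card V1 = n" "card V2 = n" and n: "261000 \<le> n"
    and tot: "\<And>v. card E1 + card E2 + deg E1 v \<le> 3 * n"
    and e: "2 * (real (card E1) + real (card E2)) * 92000 \<le> real n * real n"
    and d1: "\<And>v. real (deg E1 v) \<le> (85 / 100) * n" and d2: "\<And>v. real (deg E2 v) \<le> (85 / 100) * n"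
    and R: "R \<subseteq> V1 - hubs n V1 E1" "\<And>x. x \<in> R \<Longrightarrow> nb E1 x \<inter> hubs n V1 E1 = {} \<and> deg E1 x \<le> 1"
      "\<And>u. card (nb E1 u \<inter> R) \<le> 1" "36020 \<le> card R"
  shows "packs V1 E1 V2 E2"
proof -
  have nr: "261000 \<le> real n" using n by simp
  define B where "B = hubs n V2 E2"
  have cB: "real n * real (card B) \<le> 6000 * real (card E2)" unfolding B_def by (rule card_hubs[OF sg2])
  have er: "real (card E1) + real (card E2) + real (deg E1 v) \<le> 3 * real n" for v using tot[of v] by linarith
  have e3: "real (card E1) + real (card E2) \<le> 3 * real n" using er[of undefined] by linarith
  have cB1: "real (card B) \<le> 18000"
  proof -
    have "real n * real (card B) \<le> real n * 18000" using cB e3 by linarith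
    then show ?thesis using nr by simp
  qed
  have cB2: "real (card B) \<le> (33 / 1000) * real n"
  proof -
    have "real n * real (card B) \<le> real n * ((33 / 1000) * real n)" using cB e by (simp add: mult_ac)
    then show ?thesis using nr by simp
  qed
  have e1: "2 * real (card E1) * 92000 \<le> real n * real n" using e of_nat_0_le_iff[of "card E2", where ?'a = real] by (simp add: algebra_simps)
  have s: "303 * sqrt (2 * real (card E1)) \<le> real n" by (rule sqrt_le_of_square) (use e1 in auto)
  have sumB: "real (\<Sum>h\<in>B. deg E2 h) \<le> 6 * real n"
  proof -
    have "(\<Sum>h\<in>B. deg E2 h) \<le> 2 * card E2" by (rule sum_degree_le[OF sg2]) (auto simp: B_def hubs_def)
    then have "real (\<Sum>h\<in>B. deg E2 h) \<le> real (2 * card E2)" by (simp only: of_nat_le_iff)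
    then show ?thesis using e3 by linarith
  qed
  have hubR: "nb E1 u \<inter> R = {}" if "u \<in> V1" "n \<le> 3000 * deg E1 u" for u
  proof (rule ccontr)
    assume "nb E1 u \<inter> R \<noteq> {}"
    then obtain x where x: "x \<in> nb E1 u" "x \<in> R" by blast
    then have "u \<in> nb E1 x \<inter> hubs n V1 E1" using that nb_sym[of x E1 u] by (auto simp: hubs_def)
    then show False using R(2)[OF x(2)] by blast
  qed
  have pn: "0 < real n" using nr by linarith
  show ?thesis
  proof (rule packs_via_hub_placement[OF sg1 sg2 cV n tot e1, where ?M1.0 = "{}" and B = B and L = R
        and k = 1 and l = 1 and \<omega> = 1 and \<gamma> = "(8 / 10) * real n" and bb = "real (card B)"])
    show "partial_packing V1 E1 V2 E2 {}" by (rule partial_packing_empty)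
    show "B = hubs n V2 E2 - Range {}" by (simp add: B_def)
    show "real (card B) + 10 \<le> (34 / 1000) * real n" using cB2 nr by linarith
    show "R \<subseteq> V1 - Domain {}" using R(1) by auto
    show "card (nb E1 x - Domain {}) \<le> 1" "deg E1 x \<le> 4" if "x \<in> R" for x
      using R(2)[OF that] by auto
    show "card (nb E1 x \<inter> R) \<le> 1" for x using R(3) .
    show "real (\<Sum>u\<in>nb E1 x - Domain {}. card (nb E1 u \<inter> R)) \<le> 1" if "x \<in> R" for x
    proof -
      have "(\<Sum>u\<in>nb E1 x. card (nb E1 u \<inter> R)) \<le> (\<Sum>u\<in>nb E1 x. 1)" using R(3) by (intro sum_mono)
      also have "\<dots> \<le> 1" using R(2)[OF that] by simp
      finally have "real (\<Sum>u\<in>nb E1 x. card (nb E1 u \<inter> R)) \<le> real 1" unfolding of_nat_le_iff .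
      then show ?thesis by (simp only: Domain_empty Diff_empty of_nat_1)
    qed
    show "real (card (forb E2 E1 ({}\<inverse>) h \<inter> R)) + real (card B) + real 1 * real (card B) +
         2 / ((8 / 10) * real n) * 1 * real (\<Sum>h\<in>B. deg E2 h) \<le> real (card R)" for h
    proof -
      have "2 / ((8 / 10) * real n) * 1 * real (\<Sum>h\<in>B. deg E2 h) \<le> 2 / ((8 / 10) * real n) * 1 * (6 * real n)"
        using sumB pn by (intro mult_left_mono) auto
      also have "\<dots> = 15" using pn by (simp add: field_simps)
      finally have "2 / ((8 / 10) * real n) * 1 * real (\<Sum>h\<in>B. deg E2 h) \<le> 15" .
      moreover have "36020 \<le> real (card R)" using R(4) by simp
      ultimately show ?thesis using cB1 by (simp add: forb_empty)
    qed
    show "real 1 * real (\<Sum>h\<in>B. deg E2 h) \<le> real (12 * n)" using sumB by simp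
    show "(\<forall>x\<in>R. nb E1 x \<subseteq> Domain {}) \<or> (\<forall>h\<in>B. real (deg E2 h) \<le> (85 / 100) * real n)"
      using d2 by auto
    show "(8 / 10) * real n \<le> (54 / 100) * real n \<and> (\<forall>h\<in>B. real (deg E2 h) \<le> (54 / 100) * real n)"
      if "u \<in> V1 - Domain {}" "n \<le> 3000 * deg E1 u" "nb E1 u \<inter> R \<noteq> {}" for u
      using hubR that by blast
    show "real (load E1 E2 {} u) + (if nb E1 u \<inter> R = {} then 0 else (54 / 100) * real n) + real (card E2) / 10
        + (96 / 1000) * real (card E1) + 19 * sqrt (2 * real (card E1)) + real (card B) + 10 + (25 / 1000) * real n \<le> real n"
      if "u \<in> V1 - Domain {}" "n \<le> 3000 * deg E1 u" for u
      using hubR[of u] that s e3 cB2 nr by (simp add: load_empty)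
    show "real (deg E1 v) \<le> (85 / 100) * real n" for v using d1[of v] by simp
  qed (use nr in \<open>auto simp: load_empty\<close>)
qed

text \<open>All neighbours of \<open>w\<close> are placed, so the possibly huge degree of
  \<open>v0\<close> constrains no unplaced vertex; the other placed vertices have degree at most 8,
  and the reverse load is at most 10 * 8. Unplaced neighbours of candidates are at most three
  non-hubs, which gives \<omega> = 3 n / 3000.\<close>

lemma packs_of_hub_pair:
  assumes sg1: "simple_graph V1 E1" and sg2: "simple_graph V2 E2"
    and cV: "card V1 = n" "card V2 = n" and n: "261000 \<le> n"
    and tot: "\<And>v. card E1 + card E2 + deg E1 v \<le> 3 * n"
    and e1: "2 * real (card E1) * 180000 \<le> real n * real n"
    and e2: "2 * real (card E2) * 180000 \<le> real n * real n" "card E2 \<le> 2 * n"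
    and pp: "partial_packing V1 E1 V2 E2 M1" and cM1: "card M1 \<le> 10"
    and v0: "(v0, w) \<in> M1" "nb E2 w \<subseteq> Range M1"
    and d8: "\<And>x y. (x, y) \<in> M1 \<Longrightarrow> x \<noteq> v0 \<Longrightarrow> deg E1 x \<le> 8"
    and U0: "card {u \<in> V1 - Domain M1. real (load E1 E2 M1 u) > (2 / 100) * n} \<le> 12"
      "\<And>u. u \<in> V1 - Domain M1 \<Longrightarrow> real (load E1 E2 M1 u) > (2 / 100) * n \<Longrightarrow> nb E1 u \<inter> L = {}"
      "\<And>u. u \<in> V1 - Domain M1 \<Longrightarrow> real (load E1 E2 M1 u) \<le> (7 / 10) * n"
    and L: "L \<subseteq> V1 - Domain M1" "(367 / 10000) * n \<le> real (card L)"
      "\<And>x. x \<in> L \<Longrightarrow> card (nb E1 x - Domain M1) \<le> 3 \<and> deg E1 x \<le> 4"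
      "\<And>x u. x \<in> L \<Longrightarrow> u \<in> nb E1 x - Domain M1 \<Longrightarrow> 3000 * deg E1 u < n"
    and dB: "(\<forall>x\<in>L. nb E1 x \<subseteq> Domain M1) \<or> (\<forall>h. real (deg E2 h) \<le> (85 / 100) * n)"
    and h5: "\<And>u. u \<in> V1 - Domain M1 \<Longrightarrow> real (load E1 E2 M1 u) + card E2 / 10 + (96 / 1000) * card E1 \<le> (912 / 1000) * n"
    and h7: "\<And>v. v \<in> V1 - Domain M1 \<Longrightarrow> real (deg E1 v) \<le> (85 / 100) * n"
  shows "packs V1 E1 V2 E2"
proof -
  have fin1: "finite V1" and fin2: "finite V2" using sg1 sg2 simple_graph_finite by auto
  have fnb1: "finite (nb E1 v)" for v using simple_graph_nb_finite[OF sg1] .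
  have fM1: "finite M1" using partial_packing_finite[OF pp fin1 fin2] .
  have nr: "261000 \<le> real n" using n by simp
  have pn: "0 < real n" using nr by linarith
  define B where "B = hubs n V2 E2 - Range M1"
  have e1': "2 * real (card E1) * 92000 \<le> real n * real n"
    using e1 by linarith
  have s1: "424 * sqrt (2 * real (card E1)) \<le> real n" by (rule sqrt_le_of_square) (use e1 in auto)
  have s2: "424 * sqrt (2 * real (card E2)) \<le> real n" by (rule sqrt_le_of_square) (use e2 in auto)
  have cB: "60 * real (card B) \<le> real n"
  proof -
    have "card B \<le> card (hubs n V2 E2)" using fin2 by (intro card_mono) (auto simp: B_def hubs_def)
    then show ?thesis using few_hubs[OF sg2 _ e2(1)] pn by simp
  qed
  have sumB: "real (\<Sum>h\<in>B. deg E2 h) \<le> 4 * real n"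
  proof -
    have "(\<Sum>h\<in>B. deg E2 h) \<le> 2 * card E2" by (rule sum_degree_le[OF sg2]) (auto simp: B_def hubs_def)
    then have "real (\<Sum>h\<in>B. deg E2 h) \<le> real (2 * (2 * n))" using e2(2) unfolding of_nat_le_iff by linarith
    then show ?thesis by simp
  qed
  have F: "load E2 E1 (M1\<inverse>) y \<le> 80" if y: "y \<in> V2 - Range M1" for y
  proof -
    have "load E2 E1 (M1\<inverse>) y \<le> card (Domain (M1\<inverse>) \<inter> nb E2 y) * 8"
    proof (rule load_le_count[OF _ partial_packing_converseI[OF pp]])
      show "finite (M1\<inverse>)" using fM1 by simp
      fix y' x assume a: "(y', x) \<in> M1\<inverse>" "y' \<in> nb E2 y"
      have "x \<noteq> v0"
      proof
        assume "x = v0"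
        then have "y' = w" using a v0 pp unfolding partial_packing_def by blast
        then have "y \<in> nb E2 w" using a(2) nb_sym[of y' E2 y] by simp
        then show False using v0(2) y by blast
      qed
      then show "deg E1 x \<le> 8" using d8 a by blast
    qed
    moreover have "card (Domain (M1\<inverse>) \<inter> nb E2 y) \<le> card (Domain (M1\<inverse>))"
      using fM1 by (intro card_mono) (auto simp: Domain_fst)
    moreover have "card (Domain (M1\<inverse>)) \<le> 10" using partial_packing_card(2)[OF pp] cM1 by (simp add: Domain_converse)
    ultimately show ?thesis by linarith
  qed
  have nonhub: "nb E1 u \<inter> L = {}" if u: "u \<in> V1 - Domain M1" "n \<le> 3000 * deg E1 u" for u
  proof (rule ccontr)
    assume "nb E1 u \<inter> L \<noteq> {}"
    then obtain x where x: "x \<in> nb E1 u" "x \<in> L" by blast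
    then have "u \<in> nb E1 x - Domain M1" using u nb_sym[of x E1 u] by blast
    then show False using L(4)[OF x(2)] u by fastforce
  qed
  show ?thesis
  proof (rule packs_via_hub_placement[OF sg1 sg2 cV n tot e1' pp B_def cM1, where L = L
        and k = 3 and l = 3 and \<omega> = "real n / 1000" and \<gamma> = "(8 / 10) * real n" and bb = "sqrt (2 * real (card E2))"])
    show "real (card B) + 10 \<le> (34 / 1000) * real n" using cB nr by linarith
    show "L \<subseteq> V1 - Domain M1" by (rule L(1))
    show "card {u \<in> V1 - Domain M1. (2 / 100) * real n < real (load E1 E2 M1 u)} \<le> 12"
      using U0(1) by simp
    show "real (load E2 E1 (M1\<inverse>) y) \<le> (5 / 1000) * real n" if "y \<in> V2 - Range M1" for y
    proof -
      have "real (load E2 E1 (M1\<inverse>) y) \<le> 80" using F[OF that] by simp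
      then show ?thesis using nr by linarith
    qed
    show "card (nb E1 x - Domain M1) \<le> 3" "deg E1 x \<le> 4" if "x \<in> L" for x using L(3)[OF that] by auto
    show "card (nb E1 x \<inter> L) \<le> 3" if "x \<in> L" for x
    proof -
      have "card (nb E1 x \<inter> L) \<le> card (nb E1 x - Domain M1)" using fnb1 L(1) by (intro card_mono) auto
      then show ?thesis using L(3)[OF that] by linarith
    qed
    show "real (\<Sum>u\<in>nb E1 x - Domain M1. card (nb E1 u \<inter> L)) \<le> real n / 1000" if x: "x \<in> L" for x
    proof -
      have "real (\<Sum>u\<in>nb E1 x - Domain M1. card (nb E1 u \<inter> L)) = (\<Sum>u\<in>nb E1 x - Domain M1. real (card (nb E1 u \<inter> L)))"
        by simp
      also have "\<dots> \<le> (\<Sum>u\<in>nb E1 x - Domain M1. real n / 3000)"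
      proof (rule sum_mono)
        fix u assume u: "u \<in> nb E1 x - Domain M1"
        have "card (nb E1 u \<inter> L) \<le> deg E1 u" using fnb1 by (intro card_mono) auto
        then have "3000 * card (nb E1 u \<inter> L) \<le> n" using L(4)[OF x u] by linarith
        then have "real (3000 * card (nb E1 u \<inter> L)) \<le> real n" by (simp only: of_nat_le_iff)
        then show "real (card (nb E1 u \<inter> L)) \<le> real n / 3000" by simp
      qed
      also have "\<dots> = real (card (nb E1 x - Domain M1)) * (real n / 3000)" by simp
      also have "\<dots> \<le> 3 * (real n / 3000)" using L(3)[OF x] by (intro mult_right_mono) auto
      finally show ?thesis by simp
    qed
    show "2 * real (card E2) \<le> sqrt (2 * real (card E2)) * sqrt (2 * real (card E2)) \<or> real (card B) \<le> sqrt (2 * real (card E2))"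
      by simp
    show "real (card (forb E2 E1 (M1\<inverse>) h \<inter> L)) + real (card B) + real 3 * sqrt (2 * real (card E2)) +
         2 / ((8 / 10) * real n) * (real n / 1000) * real (\<Sum>h\<in>B. deg E2 h) \<le> real (card L)"
      if h: "h \<in> B" for h
    proof -
      have "2 / ((8 / 10) * real n) * (real n / 1000) * real (\<Sum>h\<in>B. deg E2 h)
          \<le> 2 / ((8 / 10) * real n) * (real n / 1000) * (4 * real n)"
        using sumB pn by (intro mult_left_mono) auto
      also have "\<dots> = real n / 100" using pn by (simp add: field_simps)
      finally have 1: "2 / ((8 / 10) * real n) * (real n / 1000) * real (\<Sum>h\<in>B. deg E2 h) \<le> real n / 100" .
      have "card (forb E2 E1 (M1\<inverse>) h \<inter> L) \<le> card (forb E2 E1 (M1\<inverse>) h)"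
        using fM1 fnb1 by (intro card_mono) (auto simp: forb_def)
      also have "\<dots> \<le> load E2 E1 (M1\<inverse>) h" using fM1 by (intro card_forb_le_load) auto
      also have "\<dots> \<le> 80" using F[of h] h by (auto simp: B_def hubs_def)
      finally have "real (card (forb E2 E1 (M1\<inverse>) h \<inter> L)) \<le> 80" by simp
      then show ?thesis using 1 cB s2 L(2) nr unfolding of_nat_numeral by linarith
    qed
    show "real 3 * real (\<Sum>h\<in>B. deg E2 h) \<le> real (12 * n)" using sumB by simp
    show "(\<forall>x\<in>L. nb E1 x \<subseteq> Domain M1) \<or> (\<forall>h\<in>B. real (deg E2 h) \<le> (85 / 100) * real n)"
      using dB by auto
    show "(8 / 10) * real n \<le> (54 / 100) * real n \<and> (\<forall>h\<in>B. real (deg E2 h) \<le> (54 / 100) * real n)"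
      if "u \<in> V1 - Domain M1" "n \<le> 3000 * deg E1 u" "nb E1 u \<inter> L \<noteq> {}" for u
      using nonhub that by blast
    \<comment> \<open>What 0.912 n leaves free covers 19 n / 424, n / 60, 0.025 n and the constant
      10.\<close>
    show "real (load E1 E2 M1 u) + (if nb E1 u \<inter> L = {} then 0 else (54 / 100) * real n) + real (card E2) / 10
        + (96 / 1000) * real (card E1) + 19 * sqrt (2 * real (card E1)) + real (card B) + 10 + (25 / 1000) * real n \<le> real n"
      if "u \<in> V1 - Domain M1" "n \<le> 3000 * deg E1 u" for u
      using nonhub[OF that] h5[OF that(1)] s1 cB nr by simp
    show "real (deg E1 v) \<le> (85 / 100) * real n" if "v \<in> V1 - Domain M1" for v using h7[OF that] by simp
  qed (use nr U0 in auto)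
qed

section \<open>A vertex with many light neighbours\<close>

lemma delete_vertex:
  assumes sg: "simple_graph V E"
  shows "simple_graph V {e \<in> E. v \<notin> e}"
    and "x \<noteq> v \<Longrightarrow> nb {e \<in> E. v \<notin> e} x = nb E x - {v}"
    and "card {e \<in> E. v \<notin> e} + deg E v = card E"
proof -
  show "simple_graph V {e \<in> E. v \<notin> e}" using sg by (auto simp: simple_graph_def)
  show "nb {e \<in> E. v \<notin> e} x = nb E x - {v}" if "x \<noteq> v" using that by (auto simp: nb_def)
  have "E = {e \<in> E. v \<notin> e} \<union> {e \<in> E. v \<in> e}" by auto
  moreover have "card ({e \<in> E. v \<notin> e} \<union> {e \<in> E. v \<in> e}) = card {e \<in> E. v \<notin> e} + card {e \<in> E. v \<in> e}"
    using simple_graph_finite_edges[OF sg] by (intro card_Un_disjoint) auto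
  ultimately show "card {e \<in> E. v \<notin> e} + deg E v = card E"
    using degree_card_nb[OF sg, of v] by (simp add: degree_def)
qed

lemma degree_le_edges:
  assumes sg: "simple_graph V E"
  shows "deg E x \<le> card E"
  using delete_vertex(3)[OF sg, of x] by linarith

lemma degree_pair_le:
  assumes sg: "simple_graph V E" and ne: "u \<noteq> v"
  shows "deg E u + deg E v \<le> card E + 1"
proof -
  have "card (nb {e \<in> E. v \<notin> e} u) \<le> card {e \<in> E. v \<notin> e}"
    by (rule degree_le_edges[OF delete_vertex(1)[OF sg]])
  moreover have "deg E u \<le> card (nb E u - {v}) + 1"
    using simple_graph_nb_finite[OF sg] by (auto simp: card_Diff_singleton_if)
  ultimately show ?thesis using delete_vertex(2)[OF sg ne] delete_vertex(3)[OF sg, of v] by simp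
qed

lemma card_nonneighbours:
  assumes sg: "simple_graph V E" and v: "v \<in> V"
  shows "card (V - nb E v - {v}) + deg E v + 1 = card V"
proof -
  have eq: "V - nb E v - {v} = V - insert v (nb E v)" by auto
  have sub: "insert v (nb E v) \<subseteq> V" using v simple_graph_nb_subset[OF sg] by blast
  have fnb: "finite (nb E v)" using simple_graph_nb_finite[OF sg] .
  have "card (insert v (nb E v)) = deg E v + 1"
    using fnb simple_graph_nb_self[OF sg] by simp
  moreover have "card (insert v (nb E v)) \<le> card V" using sub simple_graph_finite[OF sg] by (rule card_mono[rotated])
  moreover have "card (V - insert v (nb E v)) = card V - card (insert v (nb E v))"
    using fnb sub by (simp add: card_Diff_subset)
  ultimately show ?thesis unfolding eq by linarith
qed

text \<open>Non-neighbours of \<open>v\<close> keep their degrees when \<open>v\<close> is deleted,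
  so only the remaining edges pay for them.\<close>

lemma sum_degree_off_vertex:
  assumes sg: "simple_graph V E" and v: "v \<in> V"
    and S: "S \<subseteq> V - nb E v - {v}" and d: "\<And>x. x \<in> S \<Longrightarrow> d \<le> real (deg E x)"
  shows "d * real (card S) \<le> 2 * (real (card E) - real (deg E v))"
proof -
  let ?E = "{e \<in> E. v \<notin> e}"
  have "nb ?E x = nb E x" if "x \<in> S" for x
    using delete_vertex(2)[OF sg, of x v] that S nb_sym[of v E x] by auto
  then have "d * real (card S) \<le> 2 * real (card ?E)"
    by (intro card_high_degree[OF delete_vertex(1)[OF sg]]) (use d S in auto)
  moreover have "real (card ?E) = real (card E) - real (deg E v)"
    using delete_vertex(3)[OF sg, of v] by linarith
  ultimately show ?thesis by simp
qed

lemma partial_packing_singleton: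
  assumes sg: "simple_graph V1 E1" and mem: "x \<in> V1" "y \<in> V2"
  shows "partial_packing V1 E1 V2 E2 {(x, y)}"
  using simple_graph_nb_self[OF sg, of x] mem by (auto simp: partial_packing_def nb_def)

lemma partial_packing_pair:
  assumes sg1: "simple_graph V1 E1"
    and mem: "x \<in> V1" "y \<in> V2" "x' \<in> V1" "y' \<in> V2" and ne: "x \<noteq> x'" "y \<noteq> y'"
    and nadj: "x' \<notin> nb E1 x \<or> y' \<notin> nb E2 y"
  shows "partial_packing V1 E1 V2 E2 {(x, y), (x', y')}"
proof -
  have "partial_packing V1 E1 V2 E2 (insert (x, y) {(x', y')})"
    by (rule partial_packing_insert[OF partial_packing_singleton[OF sg1 mem(3,4)] sg1])
      (use mem ne nadj in \<open>auto simp: forb_def nb_sym[of x'] nb_sym[of y']\<close>)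
  then show ?thesis .
qed

text \<open>The neighbour \<open>v0\<close> that candidates may share goes to a vertex
  \<open>q\<close> of degree at most 4, and the neighbours of \<open>q\<close> are placed at once on
  non-neighbours of \<open>v0\<close>; afterwards \<open>v0\<close> constrains nothing. The price is
  the hub \<open>h\<close> that may be adjacent to \<open>q\<close>: it is put on a vertex
  \<open>p\<close> of degree at most 4, whose neighbours alone receive a large load.\<close>

lemma packs_of_popular_vertex:
  assumes sg1: "simple_graph V1 E1" and sg2: "simple_graph V2 E2"
    and cV: "card V1 = n" "card V2 = n" and n: "261000 \<le> n"
    and tot: "\<And>v. card E1 + card E2 + deg E1 v \<le> 3 * n"
    and e1: "2 * real (card E1) * 180000 \<le> real n * real n"
    and e2: "2 * real (card E2) * 180000 \<le> real n * real n" "card E2 \<le> 2 * n"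
    and v0: "v0 \<in> V1" "card E1 + deg E1 v0 + 2 \<le> 2 * n" "deg E1 v0 + 1001 \<le> n"
    and q: "q \<in> V2" "nb E2 q \<inter> hubs n V2 E2 \<subseteq> {h}" "card (nb E2 q - hubs n V2 E2) \<le> 3"
    and hd: "real (deg E2 h) + card E2 / 10 + (96 / 1000) * card E1 \<le> (91 / 100) * n"
      "real (deg E2 h) \<le> (69 / 100) * n"
    and L0: "L0 \<subseteq> V1" "(385 / 10000) * n \<le> real (card L0)"
      "\<And>x. x \<in> L0 \<Longrightarrow> card (nb E1 x - {v0}) \<le> 3"
      "\<And>x u. x \<in> L0 \<Longrightarrow> u \<in> nb E1 x - {v0} \<Longrightarrow> 3000 * deg E1 u < n"
    and dB: "(\<forall>x\<in>L0. nb E1 x \<subseteq> {v0}) \<or> (\<forall>h. real (deg E2 h) \<le> (85 / 100) * n)"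
    and h7: "\<And>v. v \<noteq> v0 \<Longrightarrow> real (deg E1 v) \<le> (85 / 100) * n"
  shows "packs V1 E1 V2 E2"
proof -
  have fin1: "finite V1" and fin2: "finite V2" using sg1 sg2 simple_graph_finite by auto
  have fnb1: "finite (nb E1 v)" for v using simple_graph_nb_finite[OF sg1] .
  have fnb2: "finite (nb E2 v)" for v using simple_graph_nb_finite[OF sg2] .
  have nr: "261000 \<le> real n" using n by simp
  define H where "H = hubs n V2 E2"
  define R where "R = V1 - nb E1 v0 - {v0}"
  have fR: "finite R" using fin1 by (simp add: R_def)
  have cR: "card R + deg E1 v0 + 1 = n" using card_nonneighbours[OF sg1 v0(1)] cV by (simp add: R_def)
  \<comment> \<open>The bound on |E1| + deg v0 makes the average degree of the non-neighbours of
    \<open>v0\<close> at most 4. Hence one of them has degree at most 4, and at least 5/9 of them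
    have degree at most 8.\<close>
  have off: "d * real (card S) \<le> 4 * real (card R)"
    if "S \<subseteq> R" "\<And>x. x \<in> S \<Longrightarrow> d \<le> real (deg E1 x)" for d S
  proof -
    have "d * real (card S) \<le> 2 * (real (card E1) - real (deg E1 v0))"
      by (rule sum_degree_off_vertex[OF sg1 v0(1)]) (use that in \<open>auto simp: R_def\<close>)
    moreover have "real (card E1) + real (deg E1 v0) + 2 \<le> 2 * real n" using v0(2) by linarith
    moreover have "real (card R) + real (deg E1 v0) + 1 = real n" using cR by linarith
    ultimately show ?thesis by (simp add: algebra_simps)
  qed
  define X where "X = {x \<in> R. deg E1 x \<le> 8}"
  have cX: "555 \<le> card X"
  proof -
    have "9 * real (card (R - X)) \<le> 4 * real (card R)" by (rule off) (auto simp: X_def)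
    moreover have "card X + card (R - X) = card R"
      using fR card_mono[of R X] by (simp add: X_def card_Diff_subset)
    moreover have "1000 \<le> card R" using cR v0(3) by linarith
    ultimately show ?thesis by linarith
  qed
  have "\<exists>p\<in>R. deg E1 p \<le> 4"
  proof (rule ccontr)
    assume *: "\<not> (\<exists>p\<in>R. deg E1 p \<le> 4)"
    have "5 * real (card R) \<le> 4 * real (card R)"
    proof (rule off)
      fix x assume "x \<in> R"
      then have "5 \<le> deg E1 x" using * by force
      then show "5 \<le> real (deg E1 x)" by simp
    qed simp
    then show False using cR v0(3) by linarith
  qed
  then obtain p where p: "p \<in> R" "deg E1 p \<le> 4" by blast
  have dq: "deg E2 q \<le> 4"
  proof -
    have "deg E2 q = card (nb E2 q \<inter> H) + card (nb E2 q - H)" using fnb2 card_Int_Diff by blast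
    moreover have "card (nb E2 q \<inter> H) \<le> card {h}" using q(2) by (intro card_mono) (auto simp: H_def)
    ultimately show ?thesis using q(3) by (simp add: H_def)
  qed
  have pv: "p \<in> V1" "p \<noteq> v0" "p \<notin> nb E1 v0" using p by (auto simp: R_def)
  \<comment> \<open>\<open>Np\<close> is the neighbourhood of \<open>p\<close>, or empty if
    \<open>q\<close> has no hub neighbour and \<open>p\<close> stays unplaced.\<close>
  obtain M0 Np where M0: "partial_packing V1 E1 V2 E2 M0" "(v0, q) \<in> M0" "card M0 \<le> 2"
      "nb E2 q \<inter> H \<subseteq> Range M0"
      "\<And>x y. (x, y) \<in> M0 \<Longrightarrow> x \<noteq> v0 \<Longrightarrow> deg E1 x \<le> 4"
      "\<And>y. forb E2 E1 (M0\<inverse>) y \<subseteq> nb E1 v0 \<union> Np"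
      "\<And>u. load E1 E2 M0 u \<le> (if u \<in> Np then deg E2 h else 0) + 4"
    and Np: "card Np \<le> 4" "finite Np"
  proof (cases "nb E2 q \<inter> H = {}")
    case True
    let ?M = "{(v0, q)}"
    have "partial_packing V1 E1 V2 E2 ?M" by (rule partial_packing_singleton[OF sg1 v0(1) q(1)])
    moreover have "load E1 E2 ?M u \<le> 4" for u
      using load_insert[of "{}" v0 q E1 E2 u] dq by (simp add: load_empty)
    moreover have "forb E2 E1 (?M\<inverse>) y \<subseteq> nb E1 v0" for y by (auto simp: forb_def)
    ultimately show ?thesis using that[of ?M "{}"] True by simp
  next
    case False
    then have h: "h \<in> nb E2 q" "h \<in> V2" using q(2) by (auto simp: H_def hubs_def)
    have hq: "h \<noteq> q" using h simple_graph_nb_self[OF sg2] by metis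
    let ?M = "{(v0, q), (p, h)}"
    have ppM: "partial_packing V1 E1 V2 E2 ?M"
      by (rule partial_packing_pair[OF sg1]) (use v0(1) q(1) pv h(2) hq in auto)
    have "load E1 E2 ?M u \<le> (if u \<in> nb E1 p then deg E2 h else 0) + 4" for u
      using load_insert[of "{(p, h)}" v0 q E1 E2 u] load_insert[of "{}" p h E1 E2 u] dq pv nb_sym[of p E1 u]
      by (auto simp: load_empty)
    moreover have "forb E2 E1 (?M\<inverse>) y \<subseteq> nb E1 v0 \<union> nb E1 p" for y by (auto simp: forb_def)
    moreover have "nb E2 q \<inter> H \<subseteq> Range ?M" using q(2) by (auto simp: H_def)
    moreover have "card ?M \<le> 2" by (simp add: card_insert_if)
    ultimately show ?thesis using that[of ?M "nb E1 p"] ppM p fnb1 by auto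
  qed
  have fM0: "finite M0" using partial_packing_finite[OF M0(1) fin1 fin2] .
  define Y where "Y = nb E2 q - Range M0"
  have YH: "Y \<subseteq> nb E2 q - H" using M0(4) by (auto simp: Y_def)
  have fY: "finite Y" using fnb2 by (simp add: Y_def)
  have cY: "card Y \<le> 3" using card_mono[OF _ YH] fnb2 q(3) by (auto simp: H_def)
  define X' where "X' = X - Domain M0"
  have cX': "553 \<le> card X'"
  proof -
    have "card (Domain M0) \<le> 2" using partial_packing_card(1)[OF M0(1)] M0(3) by simp
    moreover have "card X - card (Domain M0) \<le> card X'"
      unfolding X'_def using fM0 by (intro diff_card_le_card_Diff) (simp add: Domain_fst)
    ultimately show ?thesis using cX by linarith
  qed
  have "\<exists>M1. partial_packing V1 E1 V2 E2 M1 \<and> M0 \<subseteq> M1 \<and> M1 - M0 \<subseteq> X' \<times> Y \<and> Range M1 = Range M0 \<union> Y"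
  proof (rule greedy_embedding_few_conv[OF sg1 sg2 M0(1), where l = 8])
    show "X' \<subseteq> V1 - Domain M0" by (auto simp: X'_def X_def R_def)
    show "Y \<subseteq> V2 - Range M0" using simple_graph_nb_subset[OF sg2] by (auto simp: Y_def)
    show "deg E1 x \<le> 8" if "x \<in> X'" for x using that by (auto simp: X'_def X_def)
    fix y
    have "forb E2 E1 (M0\<inverse>) y \<inter> X' \<subseteq> Np" using M0(6)[of y] by (auto simp: X'_def X_def R_def)
    from card_mono[OF Np(2) this] have "card (forb E2 E1 (M0\<inverse>) y \<inter> X') \<le> 4" using Np(1) by linarith
    then show "card (forb E2 E1 (M0\<inverse>) y \<inter> X') + card Y + 8 * card Y < card X'" using cY cX' by linarith
  qed
  then obtain M1 where M1: "partial_packing V1 E1 V2 E2 M1" "M0 \<subseteq> M1" "M1 - M0 \<subseteq> X' \<times> Y"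
    "Range M1 = Range M0 \<union> Y" by (elim exE conjE)
  have fM1: "finite M1" using partial_packing_finite[OF M1(1) fin1 fin2] .
  have cM1: "card M1 \<le> 5"
    using card_add_placed(2)[OF fin1 fin2 M1(1) M0(1) M1(4)] M0(3) cY by linarith
  have load1: "real (load E1 E2 M1 u) \<le> real (if u \<in> Np then deg E2 h else 0) + 4 + real n / 1000" for u
  proof -
    have ppd: "partial_packing V1 E1 V2 E2 (M1 - M0)" using partial_packing_subset[OF M1(1)] by simp
    have "load E1 E2 (M1 - M0) u \<le> 3 * (n div 3000)"
    proof (rule load_bound[OF _ ppd])
      show "finite (M1 - M0)" using fM1 by simp
      show "deg E2 y \<le> n div 3000" if "(x, y) \<in> M1 - M0" for x y
      proof -
        have "y \<in> nb E2 q - H" using that M1(3) YH by blast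
        then have "3000 * deg E2 y < n"
          using simple_graph_nb_subset[OF sg2] by (auto simp: H_def hubs_def)
        then show ?thesis by linarith
      qed
      have "card (Domain (M1 - M0) \<inter> nb E1 u) \<le> card (Domain (M1 - M0))"
        using fM1 by (intro card_mono) (auto simp: Domain_fst)
      also have "\<dots> = card (Range (M1 - M0))" using partial_packing_card[OF ppd] by simp
      also have "\<dots> \<le> card Y" using M1(3) fY by (intro card_mono) auto
      finally show "card (Domain (M1 - M0) \<inter> nb E1 u) \<le> 3" using cY by linarith
    qed
    then have "1000 * load E1 E2 (M1 - M0) u \<le> n" by linarith
    then have "1000 * real (load E1 E2 (M1 - M0) u) \<le> real n" by (metis of_nat_le_iff of_nat_mult of_nat_numeral)
    moreover have "real (load E1 E2 M0 u) \<le> real (if u \<in> Np then deg E2 h else 0) + 4"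
      using M0(7)[of u] by (metis of_nat_add of_nat_le_iff of_nat_numeral)
    ultimately show ?thesis using load_extend[OF fM1 M1(2), of E1 E2 u] by simp
  qed
  \<comment> \<open>Candidates next to \<open>Np\<close> are dropped, since those vertices are
    already heavily loaded. It is enough to treat the non-hubs of \<open>Np\<close>, as candidates
    see no hub other than \<open>v0\<close>. So at most 4 n / 3000 are lost, which with the placed
    ones is covered by passing from 0.0385 n to 0.0367 n.\<close>
  define W where "W = (\<Union>u\<in>{u \<in> Np. 3000 * deg E1 u < n}. nb E1 u)"
  have cW: "real (card W) \<le> 4 * (real n / 3000)"
  proof -
    have "card W \<le> (\<Sum>u\<in>{u \<in> Np. 3000 * deg E1 u < n}. deg E1 u)"
      unfolding W_def using Np by (intro card_UN_le) auto
    then have "real (card W) \<le> (\<Sum>u\<in>{u \<in> Np. 3000 * deg E1 u < n}. real (deg E1 u))"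
      by (simp flip: of_nat_sum)
    also have "\<dots> \<le> (\<Sum>u\<in>{u \<in> Np. 3000 * deg E1 u < n}. real n / 3000)"
    proof (rule sum_mono)
      fix u assume "u \<in> {u \<in> Np. 3000 * deg E1 u < n}"
      then have "real (3000 * deg E1 u) \<le> real n" unfolding of_nat_le_iff by simp
      then show "real (deg E1 u) \<le> real n / 3000" by simp
    qed
    also have "\<dots> = real (card {u \<in> Np. 3000 * deg E1 u < n}) * (real n / 3000)" by simp
    also have "\<dots> \<le> 4 * (real n / 3000)"
    proof (rule mult_right_mono)
      have "card {u \<in> Np. 3000 * deg E1 u < n} \<le> card Np" using Np by (intro card_mono) auto
      then show "real (card {u \<in> Np. 3000 * deg E1 u < n}) \<le> 4" using Np by linarith
    qed simp
    finally show ?thesis .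
  qed
  have fW: "finite W" unfolding W_def using Np fnb1 by auto
  define L where "L = L0 - Domain M1 - W"
  have cL: "(367 / 10000) * n \<le> real (card L)"
  proof -
    have "card L0 - card (Domain M1) - card W \<le> card L"
      unfolding L_def using fM1 fW diff_card_le_card_Diff[of "Domain M1" L0] diff_card_le_card_Diff[of W "L0 - Domain M1"]
      by (simp add: Domain_fst)
    moreover have "card (Domain M1) \<le> 5" using partial_packing_card(1)[OF M1(1)] cM1 by simp
    ultimately have "real (card L0) \<le> real (card L) + 5 + real (card W)" by linarith
    then show ?thesis using L0(2) cW nr by linarith
  qed
  have v0D: "v0 \<in> Domain M1" using M0(2) M1(2) by blast
  have hot: "u \<in> Np" if "real (load E1 E2 M1 u) > (2 / 100) * n" for u
    using load1[of u] that nr by (auto split: if_splits)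
  show ?thesis
  proof (rule packs_of_hub_pair[OF sg1 sg2 cV n tot e1 e2 M1(1), where ?v0.0 = v0 and w = q and L = L])
    show "card M1 \<le> 10" using cM1 by simp
    show "(v0, q) \<in> M1" using M0(2) M1(2) by blast
    show "nb E2 q \<subseteq> Range M1" using M1(4) by (auto simp: Y_def)
    show "deg E1 x \<le> 8" if "(x, y) \<in> M1" "x \<noteq> v0" for x y
    proof (cases "(x, y) \<in> M0")
      case True then show ?thesis using M0(5)[OF True that(2)] by simp
    next
      case False then show ?thesis using that M1(3) by (auto simp: X'_def X_def)
    qed
    show "card {u \<in> V1 - Domain M1. (2 / 100) * real n < real (load E1 E2 M1 u)} \<le> 12"
    proof -
      have "card {u \<in> V1 - Domain M1. (2 / 100) * real n < real (load E1 E2 M1 u)} \<le> card Np"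
        using hot Np by (intro card_mono) auto
      then show ?thesis using Np by linarith
    qed
    show "nb E1 u \<inter> L = {}" if u: "u \<in> V1 - Domain M1" "(2 / 100) * real n < real (load E1 E2 M1 u)" for u
    proof (rule ccontr)
      assume "nb E1 u \<inter> L \<noteq> {}"
      then obtain x where x: "x \<in> nb E1 u" "x \<in> L" by blast
      have "u \<in> nb E1 x - {v0}" using x u v0D nb_sym[of x E1 u] by blast
      then have "3000 * deg E1 u < n" using L0(4)[of x u] x by (auto simp: L_def)
      then have "x \<in> W" using hot[of u] u(2) x by (auto simp: W_def)
      then show False using x by (simp add: L_def)
    qed
    show "real (load E1 E2 M1 u) \<le> (7 / 10) * real n" for u
      using load1[of u] hd(2) nr by (auto split: if_splits)
    show "L \<subseteq> V1 - Domain M1" using L0 by (auto simp: L_def)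
    show "(367 / 10000) * real n \<le> real (card L)" using cL by simp
    show "card (nb E1 x - Domain M1) \<le> 3 \<and> deg E1 x \<le> 4" if x: "x \<in> L" for x
    proof
      have x0: "card (nb E1 x - {v0}) \<le> 3" using L0(3)[of x] x by (auto simp: L_def)
      have "card (nb E1 x - Domain M1) \<le> card (nb E1 x - {v0})"
        using fnb1 v0D by (intro card_mono) auto
      then show "card (nb E1 x - Domain M1) \<le> 3" using x0 by linarith
      have "deg E1 x \<le> card (nb E1 x - {v0}) + 1"
        using fnb1[of x] by (auto simp: card_Diff_singleton_if)
      then show "deg E1 x \<le> 4" using x0 by linarith
    qed
    show "3000 * deg E1 u < n" if "x \<in> L" "u \<in> nb E1 x - Domain M1" for x u
      using L0(4)[of x u] that v0D by (auto simp: L_def)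
    show "(\<forall>x\<in>L. nb E1 x \<subseteq> Domain M1) \<or> (\<forall>h. real (deg E2 h) \<le> (85 / 100) * real n)"
      using dB v0D by (auto simp: L_def)
    show "real (load E1 E2 M1 u) + real (card E2) / 10 + (96 / 1000) * real (card E1) \<le> (912 / 1000) * real n" for u
      using load1[of u] hd(1) nr by (auto split: if_splits)
    show "real (deg E1 v) \<le> (85 / 100) * real n" if "v \<in> V1 - Domain M1" for v
      using h7[of v] that v0D by auto
  qed
qed

text \<open>Let \<open>hs\<close> be a hub of largest degree. If no vertex outside \<open>H\<close>
  and off the neighbourhood of \<open>hs\<close> had weight at most 3, the weights there would be at
  least 4 and those at neighbours of \<open>hs\<close> at least 2, more than the edges provide.
  Avoiding \<open>hs\<close> is what keeps the hub \<open>h\<close> next to \<open>q\<close>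
  moderate: deg h \<le> deg hs, and the two degrees add up to at most |E| + 1.\<close>

lemma light_vertex:
  assumes sg: "simple_graph V E" and H: "H \<subseteq> V" and e: "2 \<le> card E"
    and lt: "\<And>v. card E + deg E v + 2 * card H < 2 * card V"
  obtains q h where "q \<in> V" "nb E q \<inter> H \<subseteq> {h}" "card (nb E q - H) \<le> 3" "2 * deg E h \<le> card E + 4"
proof -
  have fin: "finite V" using simple_graph_finite[OF sg] .
  have fnb: "finite (nb E v)" for v using simple_graph_nb_finite[OF sg] .
  define W where "W = V - H"
  have fH: "finite H" using H fin finite_subset by blast
  have fW: "finite W" using fin by (simp add: W_def)
  have cW: "card W + card H = card V"
    using H fH card_mono[OF fin H] by (simp add: W_def card_Diff_subset)
  have nbW: "nb E x - W = nb E x \<inter> H" "nb E x \<inter> W = nb E x - H" for x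
    using simple_graph_nb_subset[OF sg, of x] H by (auto simp: W_def)
  have tot: "(\<Sum>x\<in>W. card (nb E x - H) + 2 * card (nb E x \<inter> H)) \<le> 2 * card E"
  proof -
    have "W \<subseteq> V" by (auto simp: W_def)
    from sum_degree_touching[OF sg this]
    have "(\<Sum>x\<in>W. card (nb E x - H) + 2 * card (nb E x \<inter> H)) = 2 * card {e \<in> E. e \<inter> W \<noteq> {}}"
      by (simp add: nbW)
    also have "\<dots> \<le> 2 * card E"
      using simple_graph_finite_edges[OF sg] by (intro mult_le_mono2 card_mono) auto
    finally show ?thesis .
  qed
  obtain N hs where N: "N \<subseteq> V" "\<And>x. x \<in> W \<Longrightarrow> x \<in> N \<Longrightarrow> 1 \<le> card (nb E x \<inter> H)"
      "card N \<le> deg E hs"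
    and hs: "\<And>x h. h \<in> H \<Longrightarrow> x \<notin> N \<Longrightarrow> h \<in> nb E x \<Longrightarrow> h \<noteq> hs \<and> deg E h \<le> deg E hs"
  proof (cases "H = {}")
    case True
    then show ?thesis using that[of "{}"] by simp
  next
    case False
    have "Max ((\<lambda>h. deg E h) ` H) \<in> (\<lambda>h. deg E h) ` H"
      using fH False by (intro Max_in) auto
    then obtain hs where hs: "hs \<in> H" "deg E hs = Max ((\<lambda>h. deg E h) ` H)" by auto
    have mx: "deg E h \<le> deg E hs" if "h \<in> H" for h
      unfolding hs(2) using fH that by (intro Max_ge) auto
    show ?thesis
    proof (rule that[of "nb E hs" hs])
      show "nb E hs \<subseteq> V" by (rule simple_graph_nb_subset[OF sg])
      show "1 \<le> card (nb E x \<inter> H)" if "x \<in> nb E hs" for x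
      proof -
        have "nb E x \<inter> H \<noteq> {}" using that hs(1) nb_sym[of x E hs] by blast
        then show ?thesis using fnb[of x] by (simp add: Suc_le_eq card_gt_0_iff)
      qed
      show "h \<noteq> hs \<and> deg E h \<le> deg E hs" if "h \<in> H" "x \<notin> nb E hs" "h \<in> nb E x" for x h
        using that mx nb_sym[of x E hs] by blast
    qed simp
  qed
  have "\<exists>q\<in>W - N. card (nb E q - H) + 2 * card (nb E q \<inter> H) \<le> 3"
  proof (rule ccontr)
    assume *: "\<not> (\<exists>q\<in>W - N. card (nb E q - H) + 2 * card (nb E q \<inter> H) \<le> 3)"
    have cWN: "card W = card (W - N) + card (W \<inter> N)"
      using card_Int_Diff[OF fW, of N] by linarith
    have "card (W - N) * 4 + card (W \<inter> N) * 2 = (\<Sum>x\<in>W - N. 4) + (\<Sum>x\<in>W \<inter> N. 2)" by simp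
    also have "\<dots> \<le> (\<Sum>x\<in>W - N. card (nb E x - H) + 2 * card (nb E x \<inter> H))
        + (\<Sum>x\<in>W \<inter> N. card (nb E x - H) + 2 * card (nb E x \<inter> H))"
    proof (intro add_mono sum_mono)
      show "4 \<le> card (nb E x - H) + 2 * card (nb E x \<inter> H)" if "x \<in> W - N" for x using * that by force
      show "2 \<le> card (nb E x - H) + 2 * card (nb E x \<inter> H)" if "x \<in> W \<inter> N" for x
        using N(2)[of x] that by simp
    qed
    also have "\<dots> = (\<Sum>x\<in>W. card (nb E x - H) + 2 * card (nb E x \<inter> H))"
      by (subst sum.Int_Diff[OF fW, of _ N]) (rule add.commute)
    finally have "card (W - N) * 4 + card (W \<inter> N) * 2 \<le> 2 * card E" using tot by linarith
    moreover have "card (W \<inter> N) \<le> card N" using finite_subset[OF N(1) fin] by (intro card_mono) auto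
    ultimately show False using cWN cW N(3) lt[of hs] by linarith
  qed
  then obtain q where q: "q \<in> W - N" "card (nb E q - H) + 2 * card (nb E q \<inter> H) \<le> 3" by blast
  show ?thesis
  proof (cases "nb E q \<inter> H = {}")
    case True
    then have "nb E q - H = nb E q" by blast
    \<comment> \<open>Without a hub neighbour \<open>h\<close> is a dummy; \<open>q\<close> itself,
      of degree at most 3, satisfies the bound because |E| \<ge> 2.\<close>
    then have "2 * deg E q \<le> card E + 4" using q(2) e by simp
    then show ?thesis using that[of q q] True q by (auto simp: W_def)
  next
    case False
    have "card (nb E q \<inter> H) \<noteq> 0" using False fnb[of q] by simp
    then have "card (nb E q \<inter> H) = 1" using q(2) by linarith
    then obtain h where h: "nb E q \<inter> H = {h}" by (auto simp: card_1_singleton_iff)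
    then have "h \<noteq> hs \<and> deg E h \<le> deg E hs" using hs[of h q] q by blast
    then have "2 * deg E h \<le> card E + 4" using degree_pair_le[OF sg, of h hs] by linarith
    then show ?thesis using that[of q h] h q by (auto simp: W_def)
  qed
qed

text \<open>Delete \<open>v\<close>. A vertex outside \<open>H\<close> that is not counted on the
  right still has a neighbour in \<open>H\<close>, of weight 2, or at least four others; so there
  are at most |E| - deg v such vertices.\<close>

lemma card_light_at_vertex:
  assumes sg: "simple_graph V E" and H: "H \<subseteq> V" and v: "v \<in> H"
  shows "card (V - H) + deg E v
    \<le> card {x \<in> V - H. nb E x \<inter> H \<subseteq> {v} \<and> card (nb E x - H) \<le> 3} + card E"
proof -
  have fin: "finite V" using simple_graph_finite[OF sg] .
  have fnb: "finite (nb E x)" for x using simple_graph_nb_finite[OF sg] .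
  let ?E = "{e \<in> E. v \<notin> e}"
  have sg': "simple_graph V ?E" by (rule delete_vertex(1)[OF sg])
  define W where "W = V - H"
  define L where "L = {x \<in> W. nb E x \<inter> H \<subseteq> {v} \<and> card (nb E x - H) \<le> 3}"
  have fW: "finite W" using fin by (simp add: W_def)
  have nbE: "nb ?E x = nb E x - {v}" if "x \<in> W" for x
    using delete_vertex(2)[OF sg, of x v] that v by (auto simp: W_def)
  have "2 * card (W - L) = (\<Sum>x\<in>W - L. 2)" by simp
  also have "\<dots> \<le> (\<Sum>x\<in>W - L. card (nb ?E x \<inter> W) + 2 * card (nb ?E x - W))"
  proof (rule sum_mono)
    fix x assume x: "x \<in> W - L"
    show "2 \<le> card (nb ?E x \<inter> W) + 2 * card (nb ?E x - W)"
    proof (cases "nb E x \<inter> H \<subseteq> {v}")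
      case True
      then have "\<not> card (nb E x - H) \<le> 3" using x by (auto simp: L_def)
      moreover have "nb E x - H = nb ?E x \<inter> W"
        using nbE[of x] x v simple_graph_nb_subset[OF sg, of x] by (auto simp: W_def)
      ultimately show ?thesis by simp
    next
      case False
      then have "nb ?E x - W \<noteq> {}" using nbE[of x] x by (auto simp: W_def)
      moreover have "finite (nb ?E x - W)" using nbE[of x] x fnb by simp
      ultimately have "0 < card (nb ?E x - W)" by (simp only: card_gt_0_iff simp_thms)
      then show ?thesis by linarith
    qed
  qed
  also have "\<dots> \<le> (\<Sum>x\<in>W. card (nb ?E x \<inter> W) + 2 * card (nb ?E x - W))"
    using fW by (intro sum_mono2) auto
  also have "\<dots> = 2 * card {e \<in> ?E. e \<inter> W \<noteq> {}}"
    by (rule sum_degree_touching[OF sg']) (auto simp: W_def)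
  also have "\<dots> \<le> 2 * card ?E"
    using simple_graph_finite_edges[OF sg'] by (intro mult_le_mono2 card_mono) auto
  finally have "card (W - L) \<le> card ?E" by simp
  moreover have "card W = card (W - L) + card L"
    using fW card_mono[of W L] by (simp add: L_def card_Diff_subset)
  ultimately show ?thesis using delete_vertex(3)[OF sg, of v] unfolding W_def[symmetric] L_def[symmetric] by linarith
qed

text \<open>Deleting \<open>v\<close> leaves |E| - deg v edges, hence at most twice as many
  non-isolated vertices; the isolated ones have no neighbour but \<open>v\<close>.\<close>

lemma card_pendant_at_vertex:
  assumes sg: "simple_graph V E"
  shows "card V + 2 * deg E v \<le> card {x \<in> V. x \<noteq> v \<and> nb E x \<subseteq> {v}} + 1 + 2 * card E"
proof -
  have fin: "finite V" using simple_graph_finite[OF sg] .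
  let ?E = "{e \<in> E. v \<notin> e}"
  let ?L = "{x \<in> V. x \<noteq> v \<and> nb E x \<subseteq> {v}}"
  have sg': "simple_graph V ?E" by (rule delete_vertex(1)[OF sg])
  have "1 * real (card (V - {v} - ?L)) \<le> 2 * real (card ?E)"
  proof (rule card_high_degree[OF sg'])
    fix x assume x: "x \<in> V - {v} - ?L"
    then have "nb ?E x \<noteq> {}" using delete_vertex(2)[OF sg, of x v] by auto
    then show "1 \<le> real (deg ?E x)"
      using simple_graph_nb_finite[OF sg', of x] by (simp add: Suc_le_eq card_gt_0_iff)
  qed auto
  then have "card (V - {v} - ?L) \<le> 2 * card ?E" by linarith
  moreover have "card V \<le> card (V - {v} - ?L) + card (insert v ?L)"
  proof -
    have "card V \<le> card ((V - {v} - ?L) \<union> insert v ?L)" using fin by (intro card_mono) auto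
    also have "\<dots> \<le> card (V - {v} - ?L) + card (insert v ?L)" by (rule card_Un_le)
    finally show ?thesis .
  qed
  moreover have "card (insert v ?L) = card ?L + 1" using fin by simp
  ultimately show ?thesis using delete_vertex(3)[OF sg, of v] by linarith
qed

section \<open>A vertex of degree more than 0.85 n\<close>

text \<open>The image of \<open>v\<close> has no neighbours, so the edges at \<open>v\<close>
  disappear from the problem and no pair becomes forbidden.\<close>

lemma packs_of_isolated_vertex:
  assumes sg1: "simple_graph V1 E1" and sg2: "simple_graph V2 E2"
    and cV: "card V1 = n" "card V2 = n"
    and v: "v \<in> V1" and w: "w \<in> V2" "nb E2 w = {}"
    and a: "card E1 = a + deg E1 v"
    and lt: "2 * a * card E2 < (n - 1) * (n - 2)"
  shows "packs V1 E1 V2 E2"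
proof (rule random_completion[OF sg1 sg2 _ partial_packing_singleton[OF sg1 v w(1)]])
  show "card V1 = card V2" using cV by simp
  show "n - 1 = card V1 - card {(v, w)}" using cV by simp
  have "{e \<in> E1. e \<inter> Domain {(v, w)} = {}} = {e \<in> E1. v \<notin> e}" by auto
  then show "card {e \<in> E1. e \<inter> Domain {(v, w)} = {}} \<le> a"
    using delete_vertex(3)[OF sg1, of v] a by simp
  show "card {e \<in> E2. e \<inter> Range {(v, w)} = {}} \<le> card E2"
    using simple_graph_finite_edges[OF sg2] by (intro card_mono) auto
  have "{(u, y). u \<in> V1 - Domain {(v, w)} \<and> y \<in> V2 - Range {(v, w)} \<and> y \<in> forb E1 E2 {(v, w)} u} = {}"
    using w by (auto simp: forb_def)
  then show "card {(u, y). u \<in> V1 - Domain {(v, w)} \<and> y \<in> V2 - Range {(v, w)} \<and> y \<in> forb E1 E2 {(v, w)} u} \<le> 0"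
    by (simp only: card.empty)
  show "2 * a * card E2 + 0 * (n - 1 - 1) < (n - 1) * (n - 1 - 1)" using lt by (simp add: numeral_2_eq_2)
qed

text \<open>Sending \<open>v\<close> to the leaf \<open>w\<close> only requires that the neighbour
  \<open>y\<close> of \<open>w\<close> come from a non-neighbour \<open>x\<close> of
  \<open>v\<close>. After that only \<open>x\<close> forbids pairs: its neighbours against the
  neighbours of \<open>y\<close> other than \<open>w\<close>, which is used; hence the factor deg y
  - 1.\<close>

lemma packs_of_leaf:
  assumes sg1: "simple_graph V1 E1" and sg2: "simple_graph V2 E2"
    and cV: "card V1 = n" "card V2 = n"
    and v: "v \<in> V1" and x: "x \<in> V1" "x \<noteq> v" "x \<notin> nb E1 v" and w: "w \<in> V2" "nb E2 w = {y}"
    and a: "card E1 = a + deg E1 x + deg E1 v"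
    and b: "card E2 = b + deg E2 y"
    and lt: "2 * a * b + deg E1 x * (deg E2 y - 1) * (n - 3) < (n - 2) * (n - 3)"
  shows "packs V1 E1 V2 E2"
proof -
  have fnb1: "finite (nb E1 v)" for v using simple_graph_nb_finite[OF sg1] .
  have fnb2: "finite (nb E2 v)" for v using simple_graph_nb_finite[OF sg2] .
  have y: "y \<in> V2" "y \<noteq> w" "w \<in> nb E2 y"
    using w simple_graph_nb_subset[OF sg2, of w] simple_graph_nb_self[OF sg2, of w] nb_sym[of w E2 y] by auto
  have pp: "partial_packing V1 E1 V2 E2 {(v, w), (x, y)}"
    by (rule partial_packing_pair[OF sg1]) (use v x w y in auto)
  let ?M = "{(v, w), (x, y)}"
  show ?thesis
  proof (rule random_completion[OF sg1 sg2 _ pp])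
    show "card V1 = card V2" using cV by simp
    show "n - 2 = card V1 - card ?M" using cV x by simp
    let ?E = "{e \<in> E1. v \<notin> e}"
    have "{e \<in> E1. e \<inter> Domain ?M = {}} = {e \<in> ?E. x \<notin> e}" by auto
    moreover have "nb ?E x = nb E1 x" using delete_vertex(2)[OF sg1 x(2)] x(3) nb_sym[of v E1 x] by auto
    ultimately show "card {e \<in> E1. e \<inter> Domain ?M = {}} \<le> a"
      using delete_vertex(3)[OF sg1, of v] delete_vertex(3)[OF delete_vertex(1)[OF sg1, of v], of x] a by simp
    have "card {e \<in> E2. e \<inter> Range ?M = {}} \<le> card {e \<in> E2. y \<notin> e}"
      using simple_graph_finite_edges[OF sg2] by (intro card_mono) auto
    then show "card {e \<in> E2. e \<inter> Range ?M = {}} \<le> b" using delete_vertex(3)[OF sg2, of y] b by linarith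
    have "card {(u, z). u \<in> V1 - Domain ?M \<and> z \<in> V2 - Range ?M \<and> z \<in> forb E1 E2 ?M u}
        \<le> card (nb E1 x \<times> (nb E2 y - {w}))"
    proof (rule card_mono)
      show "finite (nb E1 x \<times> (nb E2 y - {w}))" using fnb1 fnb2 by simp
      show "{(u, z). u \<in> V1 - Domain ?M \<and> z \<in> V2 - Range ?M \<and> z \<in> forb E1 E2 ?M u} \<subseteq> nb E1 x \<times> (nb E2 y - {w})"
        using w nb_sym by (fastforce simp: forb_def)
    qed
    then show "card {(u, z). u \<in> V1 - Domain ?M \<and> z \<in> V2 - Range ?M \<and> z \<in> forb E1 E2 ?M u}
        \<le> deg E1 x * (deg E2 y - 1)"
      using y fnb2 by (simp add: card_cartesian_product card_Diff_singleton_if)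
    show "2 * a * b + deg E1 x * (deg E2 y - 1) * (n - 2 - 1) < (n - 2) * (n - 2 - 1)"
      using lt by (simp add: numeral_3_eq_3 numeral_2_eq_2)
  qed
qed

text \<open>Case \<open>k \<ge> 100\<close> bounds both terms separately; for \<open>k < 100\<close> the left-hand side is linear in
  \<open>t \<in> [0, a]\<close>, so that only the two end points matter.\<close>

lemma leaf_inequality:
  fixes a b s t k \<zeta> N :: real
  assumes N: "261000 \<le> N" and nn: "0 \<le> s" "0 \<le> t" "0 \<le> a" "1 \<le> k" "200 \<le> \<zeta>" "s + 1 \<le> b"
    and k: "100 * k \<le> 15 * N" and ab: "a + b + 418000 \<le> N + 2 * k"
    and t: "t \<le> a" "t * k \<le> 2 * a" and z: "N \<le> \<zeta> + b" and s: "s * \<zeta> \<le> 2 * b - N" and b: "b \<le> N"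
  shows "2 * (a - t) * (b - (s + 1)) + t * s * (N - 3) < (N - 2) * (N - 3)"
proof -
  have z0: "0 < \<zeta>" "0 < k" "0 \<le> N" using nn N by auto
  have sq: "4 * (a * b) \<le> (a + b) * (a + b)"
    using zero_le_square[of "a - b"] by (simp add: algebra_simps)
  have le1: "2 * (a - t) * (b - (s + 1)) \<le> 2 * (a - t) * b"
    by (rule mult_left_mono) (use nn t in auto)
  have ts0: "0 \<le> t * s" using nn by simp
  have le2: "t * s * (N - 3) \<le> t * s * N" by (rule mult_left_mono[OF _ ts0]) simp
  show ?thesis
  proof (cases "100 \<le> k")
    case True
    \<comment> \<open>The first term is at most 1.69 N^2 / 2 = 0.845 N^2 and the second at most 0.04
      N^2, using k \<ge> 100 and \<zeta> \<ge> 200.\<close>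
    have "a + b \<le> (13 / 10) * N" using ab k by linarith
    then have "(a + b) * (a + b) \<le> ((13 / 10) * N) * ((13 / 10) * N)" using nn by (intro mult_mono) auto
    then have 1: "2 * (a * b) \<le> (845 / 1000) * (N * N)" using sq by linarith
    have "2 * (a - t) * b \<le> 2 * a * b" using nn by (intro mult_right_mono) auto
    then have 2: "2 * (a - t) * b \<le> (845 / 1000) * (N * N)" using 1 by linarith
    have a2: "2 * a \<le> 2 * \<zeta> + 4 * k" using ab z by linarith
    have sN: "s * \<zeta> \<le> N" using s b by linarith
    have "(t * k) * (s * \<zeta>) \<le> (2 * a) * N" by (rule mult_mono[OF t(2) sN]) (use nn z0 in auto)
    also have "\<dots> \<le> (2 * \<zeta> + 4 * k) * N" using a2 z0 by (intro mult_right_mono) auto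
    also have "\<dots> \<le> ((4 / 100) * (k * \<zeta>)) * N"
    proof (rule mult_right_mono)
      have "100 * \<zeta> \<le> k * \<zeta>" "k * 200 \<le> k * \<zeta>"
        using True nn z0 by (auto intro: mult_right_mono mult_left_mono)
      then show "2 * \<zeta> + 4 * k \<le> (4 / 100) * (k * \<zeta>)" by linarith
    qed (use z0 in auto)
    finally have "(k * \<zeta>) * (t * s) \<le> (k * \<zeta>) * ((4 / 100) * N)" by (simp add: mult_ac)
    then have "t * s \<le> (4 / 100) * N" using z0 by (simp add: mult_le_cancel_left_pos)
    then have "t * s * N \<le> (4 / 100) * N * N" using z0 by (intro mult_right_mono) auto
    then have "2 * (a - t) * (b - (s + 1)) + t * s * (N - 3) \<le> (885 / 1000) * (N * N)"
      using le1 le2 2 by linarith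
    also have "\<dots> < (N - 2) * (N - 3)"
    proof -
      have "261000 * N \<le> N * N" using N by (intro mult_right_mono) auto
      moreover have "(N - 2) * (N - 3) = N * N - 5 * N + 6" by (simp add: algebra_simps)
      ultimately show ?thesis using N by linarith
    qed
    finally show ?thesis .
  next
    case False
    then have ab2: "a + b + 417800 \<le> N" using ab by linarith
    have az: "a \<le> \<zeta>" using ab2 z by linarith
    have NN: "261000 * N \<le> N * N" using N by (intro mult_right_mono) auto
    have "s * a \<le> s * \<zeta>" using az nn by (intro mult_left_mono) auto
    then have sa: "a * s \<le> N - 6" using s ab2 nn by (simp add: mult.commute)
    have "(a + b) * (a + b) \<le> N * N" using ab2 nn by (intro mult_mono) auto
    then have "2 * (a * b) \<le> N * N - 6 * N" using sq NN N by linarith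
    then have P: "2 * a * b \<le> N * (N - 6)" by (simp add: algebra_simps)
    have Q: "a * s * N \<le> N * (N - 6)" using mult_right_mono[OF sa z0(3)] by (simp add: mult.commute)
    have "2 * (a - t) * b + t * s * N \<le> N * (N - 6)"
    proof (cases "a = 0")
      case True
      then have "t = 0" using t nn by simp
      then show ?thesis using True N by simp
    next
      case a0: False
      then have a0: "0 < a" using nn by simp
      \<comment> \<open>\<open>P\<close> and \<open>Q\<close> are the bounds at t = 0 and t = a;
        their convex combination is multiplied by \<open>a\<close> to avoid a division.\<close>
      have "(a - t) * (2 * a * b) + t * (a * s * N) \<le> (a - t) * (N * (N - 6)) + t * (N * (N - 6))"
        using P Q t nn by (intro add_mono mult_left_mono) auto
      then have "a * (2 * (a - t) * b + t * s * N) \<le> a * (N * (N - 6))" by (simp add: algebra_simps)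
      then show ?thesis using a0 by simp
    qed
    also have "N * (N - 6) < (N - 2) * (N - 3)" using N by (simp add: algebra_simps)
    finally show ?thesis using le1 le2 by linarith
  qed
qed

lemma obtain_min_nat:
  fixes f :: "'a \<Rightarrow> nat"
  assumes "S \<noteq> {}"
  obtains x where "x \<in> S" "\<And>y. y \<in> S \<Longrightarrow> f x \<le> f y"
  using assms ex_has_least_nat[of "\<lambda>x. x \<in> S" _ f] by blast

text \<open>Without an isolated vertex, the few edges of the second graph give at least 200 leaves
  with distinct neighbours. The leaf whose neighbour has least degree s + 1 and the non-neighbour of
  \<open>v\<close> of least degree t are used: minimality yields s |R| \<le> 2 |E2| - n and t |X|
  \<le> 2 a, as \<open>leaf_inequality\<close> demands.\<close>

lemma packs_of_dominating_vertex_sparse: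
  assumes sg1: "simple_graph V1 E1" and sg2: "simple_graph V2 E2"
    and cV: "card V1 = n" "card V2 = n" and n: "261000 \<le> n"
    and v: "v \<in> V1" "deg E1 v + 2 \<le> n" "85 * n < 100 * deg E1 v"
    and tot: "card E1 + card E2 + deg E1 v + 418275 \<le> 3 * n"
    and sparse: "card E2 + 200 \<le> n \<or> (\<exists>w\<in>V2. nb E2 w = {})"
  shows "packs V1 E1 V2 E2"
proof -
  have fin2: "finite V2" using simple_graph_finite[OF sg2] .
  have fnb2: "finite (nb E2 v)" for v using simple_graph_nb_finite[OF sg2] .
  have nr: "261000 \<le> real n" using n by simp
  have dn: "real (n - 1) = real n - 1" "real (n - 2) = real n - 2" "real (n - 3) = real n - 3"
    using n by (auto simp: of_nat_diff)
  define a where "a = card E1 - deg E1 v"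
  have a: "card E1 = a + deg E1 v" using degree_le_edges[OF sg1, of v] by (simp add: a_def)
  show ?thesis
  proof (cases "\<exists>w\<in>V2. nb E2 w = {}")
    case True
    then obtain w where w: "w \<in> V2" "nb E2 w = {}" by blast
    have "2 * a * card E2 < (n - 1) * (n - 2)"
    proof -
      have ab: "real a + real (card E2) \<le> (13 / 10) * real n" using tot v(3) a by linarith
      have "(real a + real (card E2)) * (real a + real (card E2)) \<le> ((13 / 10) * real n) * ((13 / 10) * real n)"
        by (rule mult_mono[OF ab ab]) auto
      moreover have "4 * (real a * real (card E2)) \<le> (real a + real (card E2)) * (real a + real (card E2))"
        using zero_le_square[of "real a - real (card E2)"] by (simp add: algebra_simps)
      moreover have "261000 * real n \<le> real n * real n" using nr by (intro mult_right_mono) auto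
      moreover have "real ((n - 1) * (n - 2)) = real n * real n - 3 * real n + 2"
        unfolding of_nat_mult dn by (simp add: algebra_simps)
      ultimately have "2 * (real a * real (card E2)) < real ((n - 1) * (n - 2))" using nr by linarith
      then have "real (2 * a * card E2) < real ((n - 1) * (n - 2))" by simp
      then show ?thesis by (simp only: of_nat_less_iff)
    qed
    then show ?thesis using packs_of_isolated_vertex[OF sg1 sg2 cV v(1) w a] by simp
  next
    case noiso: False
    then have e2: "card E2 + 200 \<le> n" using sparse by blast
    obtain R where R: "R \<subseteq> V2 - {}" "\<And>x. x \<in> R \<Longrightarrow> nb E2 x \<inter> {} = {} \<and> deg E2 x \<le> 1"
        "\<And>u. card (nb E2 u \<inter> R) \<le> 1" "card (V2 - {}) \<le> card R + card {e \<in> E2. \<not> e \<subseteq> {}}"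
      by (rule leaf_representatives[OF sg2, of "{}"]) auto
    have "card {e \<in> E2. \<not> e \<subseteq> {}} \<le> card E2" using simple_graph_finite_edges[OF sg2] by (intro card_mono) auto
    then have cR: "n \<le> card R + card E2" using R(4) cV by simp
    have "\<exists>y. nb E2 x = {y}" if "x \<in> R" for x
    proof -
      have "deg E2 x \<noteq> 0" using noiso R(1) that fnb2[of x] by auto
      then have "deg E2 x = 1" using R(2)[OF that] by linarith
      then show ?thesis by (simp add: card_1_singleton_iff)
    qed
    then obtain f where f: "\<And>x. x \<in> R \<Longrightarrow> nb E2 x = {f x}" by metis
    have inj: "inj_on f R"
    proof (rule inj_onI)
      fix x x' assume x: "x \<in> R" "x' \<in> R" "f x = f x'"
      have "x \<in> nb E2 (f x)" "x' \<in> nb E2 (f x)"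
        using f[OF x(1)] f[OF x(2)] x(3) nb_sym[of _ E2 "f x"] by auto
      then have "{x, x'} \<subseteq> nb E2 (f x) \<inter> R" using x by blast
      then have "card {x, x'} \<le> 1" using card_mono[of "nb E2 (f x) \<inter> R" "{x, x'}"] R(3)[of "f x"] fnb2 by fastforce
      then show "x = x'" by (cases "x = x'") auto
    qed
    have fV: "f ` R \<subseteq> V2" using f simple_graph_nb_subset[OF sg2] by blast
    have "R \<noteq> {}" using cR e2 by auto
    then obtain w where w: "w \<in> R" "\<And>x. x \<in> R \<Longrightarrow> deg E2 (f w) \<le> deg E2 (f x)"
      using obtain_min_nat[of R "\<lambda>x. deg E2 (f x)"] by blast
    define s where "s = deg E2 (f w) - 1"
    have deg1: "1 \<le> deg E2 z" if "z \<in> V2" for z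
      using noiso that fnb2[of z] by (simp add: Suc_le_eq card_gt_0_iff)
    have sw: "deg E2 (f w) = s + 1" using deg1[of "f w"] fV w(1) by (auto simp: s_def)
    have sz: "n + s * card R \<le> 2 * card E2"
    proof -
      have "n + s * card R = (\<Sum>z\<in>V2. 1) + (\<Sum>z\<in>f ` R. s)" using cV card_image[OF inj] by simp
      also have "\<dots> = (\<Sum>z\<in>V2. 1 + (if z \<in> f ` R then s else 0))"
        unfolding sum.distrib sum.inter_restrict[OF fin2, symmetric] Int_absorb1[OF fV] ..
      also have "\<dots> \<le> (\<Sum>z\<in>V2. deg E2 z)"
      proof (rule sum_mono)
        fix z assume z: "z \<in> V2"
        show "1 + (if z \<in> f ` R then s else 0) \<le> deg E2 z" using deg1[OF z] w(2) sw by auto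
      qed
      also have "\<dots> = 2 * card E2" by (rule handshake[OF sg2])
      finally show ?thesis .
    qed
    define X where "X = V1 - nb E1 v - {v}"
    have cX: "card X + deg E1 v + 1 = n" using card_nonneighbours[OF sg1 v(1)] cV by (simp add: X_def)
    then have "X \<noteq> {}" using v(2) by auto
    then obtain x where x: "x \<in> X" "\<And>z. z \<in> X \<Longrightarrow> deg E1 x \<le> deg E1 z"
      using obtain_min_nat[of X "\<lambda>x. deg E1 x"] by blast
    have xv: "x \<in> V1" "x \<noteq> v" "x \<notin> nb E1 v" using x(1) by (auto simp: X_def)
    define t where "t = deg E1 x"
    have ta: "t \<le> a"
    proof -
      have "nb {e \<in> E1. v \<notin> e} x = nb E1 x"
        using delete_vertex(2)[OF sg1 xv(2)] xv(3) nb_sym[of v E1 x] by auto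
      then have "t \<le> card {e \<in> E1. v \<notin> e}"
        using degree_le_edges[OF delete_vertex(1)[OF sg1, of v], of x] by (simp add: t_def)
      then show ?thesis using delete_vertex(3)[OF sg1, of v] a by linarith
    qed
    have tk: "real t * real (card X) \<le> 2 * real a"
    proof -
      have "real t * real (card X) \<le> 2 * (real (card E1) - real (deg E1 v))"
        by (rule sum_degree_off_vertex[OF sg1 v(1)]) (use x(2) in \<open>auto simp: X_def t_def\<close>)
      then show ?thesis using a by simp
    qed
    have sb: "s + 1 \<le> card E2" using degree_le_edges[OF sg2, of "f w"] sw by linarith
    have szr: "real s * real (card R) \<le> 2 * real (card E2) - real n"
      using sz by (simp flip: of_nat_mult)
    have main: "2 * (real a - real t) * (real (card E2) - (real s + 1)) + real t * real s * (real n - 3)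
        < (real n - 2) * (real n - 3)"
    proof (rule leaf_inequality[OF nr, where k = "real (card X)" and \<zeta> = "real (card R)"])
      show "0 \<le> real s" "0 \<le> real t" "0 \<le> real a" by auto
      show "1 \<le> real (card X)" using cX v(2) by linarith
      show "200 \<le> real (card R)" using cR e2 by linarith
      show "real s + 1 \<le> real (card E2)" using sb by linarith
      show "100 * real (card X) \<le> 15 * real n" using cX v(3) by linarith
      show "real a + real (card E2) + 418000 \<le> real n + 2 * real (card X)" using tot a cX by linarith
      show "real t \<le> real a" using ta by simp
      show "real t * real (card X) \<le> 2 * real a" by (rule tk)
      show "real n \<le> real (card R) + real (card E2)" using cR by linarith
      show "real s * real (card R) \<le> 2 * real (card E2) - real n" by (rule szr)
      show "real (card E2) \<le> real n" using e2 by simp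
    qed
    define a' b' where "a' = a - t" and "b' = card E2 - (s + 1)"
    have a': "real a' = real a - real t" and b': "real b' = real (card E2) - (real s + 1)"
      using ta sb by (auto simp: a'_def b'_def of_nat_diff)
    have "real (2 * a' * b' + t * s * (n - 3)) < real ((n - 2) * (n - 3))"
      using main unfolding of_nat_add of_nat_mult of_nat_numeral a' b' dn .
    then have lt: "2 * a' * b' + t * s * (n - 3) < (n - 2) * (n - 3)" by (simp only: of_nat_less_iff)
    show ?thesis
    proof (rule packs_of_leaf[OF sg1 sg2 cV v(1) xv, where w = w and y = "f w" and a = a' and b = b'])
      show "w \<in> V2" using w(1) R(1) by blast
      show "nb E2 w = {f w}" by (rule f[OF w(1)])
      show "card E1 = a' + deg E1 x + deg E1 v" using a ta by (simp add: a'_def t_def)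
      show "card E2 = b' + deg E2 (f w)" using sb sw by (simp add: b'_def)
      show "2 * a' * b' + deg E1 x * (deg E2 (f w) - 1) * (n - 3) < (n - 2) * (n - 3)"
        using lt sw by (simp add: t_def)
    qed
  qed
qed

text \<open>\<open>v\<close> goes to a vertex \<open>w\<close> of degree at most 6 that is not
  adjacent to a vertex \<open>hs\<close> of largest degree, so the neighbours of \<open>w\<close>
  have degree at most (|E2| + 1) / 2. They are placed on vertices of degree at most one with
  distinct neighbours, so every vertex sees at most one of them and its load stays below 0.65 n. The
  remaining hubs go to vertices adjacent to nothing but possibly \<open>v\<close>.\<close>

lemma packs_of_pendant_representatives:
  assumes sg1: "simple_graph V1 E1" and sg2: "simple_graph V2 E2"
    and cV: "card V1 = n" "card V2 = n" and n: "261000 \<le> n"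
    and v: "v \<in> V1" "100 * (n - 1 - deg E1 v) \<le> 15 * n" "deg E1 v + 2 \<le> n"
    and mx: "\<And>u. deg E2 u \<le> deg E1 v"
    and tot: "card E1 + card E2 + deg E1 v + 418275 \<le> 3 * n"
    and few: "card E1 + 1000 < n - 1"
    and tot1: "\<And>v. card E1 + card E2 + deg E1 v \<le> 3 * n"
    and e1: "2 * real (card E1) * 180000 \<le> real n * real n"
    and e2: "2 * real (card E2) * 180000 \<le> real n * real n" "card E2 \<le> 2 * n"
    and h7: "\<And>u. u \<noteq> v \<Longrightarrow> real (deg E1 u) \<le> (85 / 100) * n"
  shows "packs V1 E1 V2 E2"
proof -
  have fin1: "finite V1" and fin2: "finite V2" using sg1 sg2 simple_graph_finite by auto
  have fnb1: "finite (nb E1 v)" for v using simple_graph_nb_finite[OF sg1] .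
  have fnb2: "finite (nb E2 v)" for v using simple_graph_nb_finite[OF sg2] .
  have nr: "261000 \<le> real n" using n by simp
  define R where "R = V1 - nb E1 v - {v}"
  have cR: "card R + deg E1 v + 1 = n" using card_nonneighbours[OF sg1 v(1)] cV by (simp add: R_def)
  have kn: "100 * card R \<le> 15 * n" using v(2) cR by simp
  have e2n: "card E2 + 418273 \<le> n + 2 * card R" using tot cR degree_le_edges[OF sg1, of v] by linarith

  have "V2 \<noteq> {}" using cV n by auto
  then obtain hs where hs: "hs \<in> V2" "deg E2 hs = max_degree V2 E2"
    using max_degree_attained[OF sg2] by blast
  define S where "S = V2 - nb E2 hs - {hs}"
  have cS: "card S + deg E2 hs + 1 = n" using card_nonneighbours[OF sg2 hs(1)] cV by (simp add: S_def)
  \<comment> \<open>Otherwise 7 |S| + 2 deg hs \<le> 2 |E2|. But |E2| is at most n + 2 |R| minus a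
    constant, and |S| \<ge> |R| because deg hs \<le> deg v.\<close>
  have "\<exists>w\<in>S. deg E2 w \<le> 6"
  proof (rule ccontr)
    assume *: "\<not> (\<exists>w\<in>S. deg E2 w \<le> 6)"
    have "7 * real (card S) \<le> 2 * (real (card E2) - real (deg E2 hs))"
    proof (rule sum_degree_off_vertex[OF sg2 hs(1)])
      show "S \<subseteq> V2 - nb E2 hs - {hs}" by (simp add: S_def)
      fix w assume "w \<in> S"
      then have "7 \<le> deg E2 w" using * by force
      then show "7 \<le> real (deg E2 w)" by simp
    qed
    then have "7 * real (card S) + 2 * real (deg E2 hs) \<le> 2 * real (card E2)" by (simp add: algebra_simps)
    then have "7 * card S + 2 * deg E2 hs \<le> 2 * card E2" by linarith
    then show False using e2n cS cR mx[of hs] v(3) by linarith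
  qed
  then obtain w where w: "w \<in> V2" "w \<noteq> hs" "w \<notin> nb E2 hs" "deg E2 w \<le> 6" by (auto simp: S_def)
  have dy: "2 * deg E2 y \<le> card E2 + 1" if "y \<in> nb E2 w" for y
  proof -
    have "y \<noteq> hs" using that w nb_sym[of w E2 hs] by blast
    then show ?thesis using degree_pair_le[OF sg2, of y hs] max_degree_ge[OF sg2, of y] hs(2) by simp
  qed

  \<comment> \<open>With V1 - R in the role of \<open>H\<close>, edges not inside it meet
    \<open>R\<close> and therefore miss \<open>v\<close>. There are at most |E1| - deg v of them, so
    |X| \<ge> n - 1 - |E1| > 1000.\<close>
  obtain X where X: "X \<subseteq> V1 - (V1 - R)" "\<And>x. x \<in> X \<Longrightarrow> nb E1 x \<inter> (V1 - R) = {} \<and> deg E1 x \<le> 1"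
      "\<And>u. card (nb E1 u \<inter> X) \<le> 1" "card (V1 - (V1 - R)) \<le> card X + card {e \<in> E1. \<not> e \<subseteq> V1 - R}"
    by (rule leaf_representatives[OF sg1, of "V1 - R"]) auto
  have XR: "X \<subseteq> R" using X(1) by blast
  have cX: "1000 < card X"
  proof -
    have "V1 - (V1 - R) = R" by (auto simp: R_def)
    moreover have "card {e \<in> E1. \<not> e \<subseteq> V1 - R} \<le> card {e \<in> E1. v \<notin> e}"
    proof (rule card_mono)
      show "finite {e \<in> E1. v \<notin> e}" using simple_graph_finite_edges[OF sg1] by simp
      show "{e \<in> E1. \<not> e \<subseteq> V1 - R} \<subseteq> {e \<in> E1. v \<notin> e}"
      proof
        fix e assume e: "e \<in> {e \<in> E1. \<not> e \<subseteq> V1 - R}"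
        have e2: "e \<subseteq> V1" "card e = 2" using sg1 e by (auto simp: simple_graph_def)
        then obtain x where x: "x \<in> e" "x \<in> R" using e by blast
        have "v \<notin> e"
        proof
          assume ve: "v \<in> e"
          have "x \<noteq> v" using x(2) by (auto simp: R_def)
          then have "e = {v, x}" using e2(2) x(1) ve by (auto simp: card_2_iff)
          then have "x \<in> nb E1 v" using e by (simp add: nb_iff)
          then show False using x(2) by (simp add: R_def)
        qed
        then show "e \<in> {e \<in> E1. v \<notin> e}" using e by simp
      qed
    qed
    ultimately show ?thesis using X(4) delete_vertex(3)[OF sg1, of v] few cR by simp
  qed
  have fX: "finite X" using X(1) fin1 finite_subset[of X V1] by blast

  let ?M0 = "{(v, w)}"
  have pp0: "partial_packing V1 E1 V2 E2 ?M0" by (rule partial_packing_singleton[OF sg1 v(1) w(1)])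
  have "\<exists>M1. partial_packing V1 E1 V2 E2 M1 \<and> ?M0 \<subseteq> M1 \<and> M1 - ?M0 \<subseteq> X \<times> nb E2 w \<and> Range M1 = Range ?M0 \<union> nb E2 w"
  proof (rule greedy_embedding_few_conv[OF sg1 sg2 pp0, where l = 1])
    show "X \<subseteq> V1 - Domain ?M0" using XR by (auto simp: R_def)
    show "nb E2 w \<subseteq> V2 - Range ?M0"
      using simple_graph_nb_subset[OF sg2] simple_graph_nb_self[OF sg2] by auto
    show "deg E1 x \<le> 1" if "x \<in> X" for x using X(2)[OF that] by blast
    fix y
    have "forb E2 E1 (?M0\<inverse>) y \<inter> X = {}" using XR by (auto simp: forb_def R_def)
    then show "card (forb E2 E1 (?M0\<inverse>) y \<inter> X) + deg E2 w + 1 * deg E2 w < card X"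
      using w(4) cX by simp
  qed
  then obtain M1 where M1: "partial_packing V1 E1 V2 E2 M1" "?M0 \<subseteq> M1" "M1 - ?M0 \<subseteq> X \<times> nb E2 w"
    "Range M1 = Range ?M0 \<union> nb E2 w" by (elim exE conjE)
  have fM1: "finite M1" using partial_packing_finite[OF M1(1) fin1 fin2] .
  have cM1: "card M1 \<le> 7"
    using card_add_placed(2)[OF fin1 fin2 M1(1) pp0 M1(4)] w(4) by simp
  define D where "D = Domain (M1 - ?M0)"
  have fD: "finite D" using fM1 by (simp add: D_def Domain_fst)
  have DX: "D \<subseteq> X" using M1(3) by (auto simp: D_def)
  have ppd: "partial_packing V1 E1 V2 E2 (M1 - ?M0)" using partial_packing_subset[OF M1(1)] by simp
  have cD: "card D \<le> 6"
  proof -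
    have "card D = card (Range (M1 - ?M0))" using partial_packing_card[OF ppd] by (simp add: D_def)
    also have "\<dots> \<le> deg E2 w" using M1(3) fnb2 by (intro card_mono) auto
    finally show ?thesis using w(4) by linarith
  qed
  have load0: "load E1 E2 ?M0 u \<le> 6" for u using w(4) load_insert[of "{}" v w E1 E2 u] by (simp add: load_empty)
  have load1: "load E1 E2 M1 u \<le> 6 + (if nb E1 u \<inter> D = {} then 0 else (card E2 + 1) div 2)" for u
  proof -
    have "load E1 E2 (M1 - ?M0) u \<le> (if nb E1 u \<inter> D = {} then 0 else 1) * ((card E2 + 1) div 2)"
    proof (rule load_bound[OF _ ppd])
      show "finite (M1 - ?M0)" using fM1 by simp
      show "deg E2 y \<le> (card E2 + 1) div 2" if "(x, y) \<in> M1 - ?M0" for x y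
        using dy[of y] that M1(3) by auto
      have "card (D \<inter> nb E1 u) \<le> card (nb E1 u \<inter> X)" using fX DX by (intro card_mono) auto
      then show "card (Domain (M1 - ?M0) \<inter> nb E1 u) \<le> (if nb E1 u \<inter> D = {} then 0 else 1)"
        using X(3)[of u] by (auto simp: D_def[symmetric] Int_commute)
    qed
    then show ?thesis using load_extend[OF fM1 M1(2), of E1 E2 u] load0[of u] by (auto split: if_splits)
  qed
  have half: "real ((card E2 + 1) div 2) \<le> (65 / 100) * n - 10" using e2n kn by linarith
  have load2: "real (load E1 E2 M1 u) \<le> (65 / 100) * n - 4" for u
  proof -
    have "load E1 E2 M1 u \<le> 6 + (card E2 + 1) div 2" using load1[of u] by (auto split: if_splits)
    then show ?thesis using half by linarith
  qed
  define L where "L = {x \<in> V1. x \<noteq> v \<and> nb E1 x \<subseteq> {v}} - Domain M1"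
  have vD: "v \<in> Domain M1" using M1(2) by blast
  have cL: "(367 / 10000) * n \<le> real (card L)"
  proof -
    have "card {x \<in> V1. x \<noteq> v \<and> nb E1 x \<subseteq> {v}} - card (Domain M1) \<le> card L"
      unfolding L_def using fM1 by (intro diff_card_le_card_Diff) (simp add: Domain_fst)
    moreover have "card (Domain M1) \<le> 7" using partial_packing_card(1)[OF M1(1)] cM1 by simp
    ultimately show ?thesis using card_pendant_at_vertex[OF sg1, of v] cV few kn cR nr by linarith
  qed
  have hot: "u \<in> (\<Union>x\<in>D. nb E1 x)" if "real (load E1 E2 M1 u) > (2 / 100) * n" for u
  proof (rule ccontr)
    assume "u \<notin> (\<Union>x\<in>D. nb E1 x)"
    then have "nb E1 u \<inter> D = {}" using nb_sym[of _ E1 u] by blast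
    then have "load E1 E2 M1 u \<le> 6" using load1[of u] by simp
    then show False using that nr by linarith
  qed
  show ?thesis
  proof (rule packs_of_hub_pair[OF sg1 sg2 cV n tot1 e1 e2 M1(1), where ?v0.0 = v and w = w and L = L])
    show "card M1 \<le> 10" using cM1 by simp
    show "(v, w) \<in> M1" using M1(2) by blast
    show "nb E2 w \<subseteq> Range M1" using M1(4) by blast
    show "deg E1 x \<le> 8" if "(x, y) \<in> M1" "x \<noteq> v" for x y
    proof -
      have "x \<in> X" using that M1(3) by blast
      then show ?thesis using X(2)[of x] by linarith
    qed
    show "card {u \<in> V1 - Domain M1. (2 / 100) * real n < real (load E1 E2 M1 u)} \<le> 12"
    proof -
      have "card {u \<in> V1 - Domain M1. (2 / 100) * real n < real (load E1 E2 M1 u)} \<le> card (\<Union>x\<in>D. nb E1 x)"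
        using hot fD fnb1 by (intro card_mono) auto
      also have "\<dots> \<le> (\<Sum>x\<in>D. deg E1 x)" by (rule card_UN_le[OF fD])
      also have "\<dots> \<le> (\<Sum>x\<in>D. 1)" using X(2) DX by (intro sum_mono) auto
      finally show ?thesis using cD by simp
    qed
    show "nb E1 u \<inter> L = {}" if u: "u \<in> V1 - Domain M1" for u
    proof (rule ccontr)
      assume "nb E1 u \<inter> L \<noteq> {}"
      then obtain x where x: "x \<in> nb E1 u" "x \<in> L" by blast
      then have "u \<in> {v}" using nb_sym[of x E1 u] by (auto simp: L_def)
      then show False using u vD by simp
    qed
    show "real (load E1 E2 M1 u) \<le> (7 / 10) * real n" for u using load2[of u] nr by linarith
    show "L \<subseteq> V1 - Domain M1" by (auto simp: L_def)
    show "(367 / 10000) * real n \<le> real (card L)" by (rule cL)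
    show "card (nb E1 x - Domain M1) \<le> 3 \<and> deg E1 x \<le> 4" if x: "x \<in> L" for x
    proof
      have sub: "nb E1 x \<subseteq> {v}" using x by (simp add: L_def)
      then have "nb E1 x - Domain M1 = {}" using vD by blast
      then show "card (nb E1 x - Domain M1) \<le> 3" by (simp only: card.empty zero_le)
      have "deg E1 x \<le> card {v}" using sub by (intro card_mono) auto
      then show "deg E1 x \<le> 4" by simp
    qed
    show "3000 * deg E1 u < n" if "x \<in> L" "u \<in> nb E1 x - Domain M1" for x u
      using that vD by (auto simp: L_def)
    show "(\<forall>x\<in>L. nb E1 x \<subseteq> Domain M1) \<or> (\<forall>h. real (deg E2 h) \<le> (85 / 100) * real n)"
      using vD by (auto simp: L_def)
    show "real (load E1 E2 M1 u) + real (card E2) / 10 + (96 / 1000) * real (card E1) \<le> (912 / 1000) * real n" for u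
      using load2[of u] e2n kn few nr by linarith
    show "real (deg E1 u) \<le> (85 / 100) * real n" if "u \<in> V1 - Domain M1" for u
      using h7[of u] that vD by auto
  qed
qed

lemma card_hubs_le:
  assumes sg: "simple_graph V E" and n: "0 < n" and e: "card E \<le> 3 * n"
  shows "card (hubs n V E) \<le> 18000"
proof -
  have "real n * real (card (hubs n V E)) \<le> 6000 * real (card E)" by (rule card_hubs[OF sg])
  also have "\<dots> \<le> real n * 18000" using e by linarith
  finally show ?thesis using n by simp
qed

text \<open>4 n - 720000 is the tangent of n^2 / 180000 at n = 360000.\<close>

lemma edge_square_bound:
  assumes "2 * e + 720000 \<le> 4 * n"
  shows "2 * real e * 180000 \<le> real n * real n"
proof -
  have "2 * real e * 180000 \<le> (4 * real n - 720000) * 180000"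
  proof (rule mult_right_mono)
    show "2 * real e \<le> 4 * real n - 720000" using assms by linarith
  qed simp
  also have "\<dots> \<le> real n * real n"
    using zero_le_square[of "real n - 360000"] by (simp add: algebra_simps)
  finally show ?thesis .
qed

text \<open>If the second graph has more than n - 200 edges, then |E1| + deg v < 2 n - 418075. When
  \<open>E1\<close> has nearly n edges as well, \<open>light_vertex\<close> applies to the second
  graph; otherwise the first graph has many vertices of degree at most one away from
  \<open>v\<close>. In both cases the candidates are adjacent to nothing but possibly
  \<open>v\<close>.\<close>

lemma packs_of_dominating_vertex:
  assumes sg1: "simple_graph V1 E1" and sg2: "simple_graph V2 E2"
    and cV: "card V1 = n" "card V2 = n" and n: "261000 \<le> n"
    and v: "v \<in> V1" "deg E1 v + 2 \<le> n" "85 * n < 100 * deg E1 v"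
    and mx: "\<And>u. deg E1 u \<le> deg E1 v" "\<And>u. deg E2 u \<le> deg E1 v"
    and tot: "card E1 + card E2 + deg E1 v + 418275 \<le> 3 * n"
  shows "packs V1 E1 V2 E2"
proof (cases "card E2 + 200 \<le> n \<or> (\<exists>w\<in>V2. nb E2 w = {})")
  case True
  then show ?thesis using packs_of_dominating_vertex_sparse[OF sg1 sg2 cV n v tot] by blast
next
  case False
  then have dense: "n < card E2 + 200" by auto
  have vE: "deg E1 v \<le> card E1" by (rule degree_le_edges[OF sg1])
  have tot1: "card E1 + card E2 + deg E1 u \<le> 3 * n" for u using tot mx(1)[of u] by linarith
  have s1: "2 * real (card E1) * 180000 \<le> real n * real n"
    by (rule edge_square_bound) (use tot dense v(3) in linarith)
  have s2: "2 * real (card E2) * 180000 \<le> real n * real n"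
    by (rule edge_square_bound) (use tot vE v(3) in linarith)
  have e2: "card E2 \<le> 2 * n" using tot vE v(3) by linarith
  have h7: "real (deg E1 u) \<le> (85 / 100) * n" if "u \<noteq> v" for u
    using degree_pair_le[OF sg1 that] tot dense v(3) by linarith
  show ?thesis
  proof (cases "card E1 + 1000 < n - 1")
    case True
    show ?thesis
      by (rule packs_of_pendant_representatives[OF sg1 sg2 cV n v(1) _ v(2) mx(2) tot True tot1 s1 s2 e2 h7])
        (use v(3) in linarith)
  next
    case few: False
    have hub: "card (hubs n V2 E2) \<le> 18000" by (rule card_hubs_le[OF sg2]) (use n e2 in auto)
    obtain q h where q: "q \<in> V2" "nb E2 q \<inter> hubs n V2 E2 \<subseteq> {h}" "card (nb E2 q - hubs n V2 E2) \<le> 3"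
      "2 * deg E2 h \<le> card E2 + 4"
    proof (rule light_vertex[OF sg2, of "hubs n V2 E2"])
      show "hubs n V2 E2 \<subseteq> V2" by (auto simp: hubs_def)
      show "2 \<le> card E2" using dense n by linarith
      show "card E2 + deg E2 u + 2 * card (hubs n V2 E2) < 2 * card V2" for u
        using tot few mx(2)[of u] hub cV n by linarith
    qed
    let ?L = "{x \<in> V1. x \<noteq> v \<and> nb E1 x \<subseteq> {v}}"
    show ?thesis
    proof (rule packs_of_popular_vertex[OF sg1 sg2 cV n tot1 s1 s2 e2 v(1) _ _ q(1-3), where ?L0.0 = ?L])
      show "card E1 + deg E1 v + 2 \<le> 2 * n" using tot dense v(3) n by linarith
      show "deg E1 v + 1001 \<le> n" using tot dense vE n by linarith
      show "real (deg E2 h) + real (card E2) / 10 + (96 / 1000) * real (card E1) \<le> (91 / 100) * real n"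
        using q(4) tot vE v(3) few dense n by linarith
      show "real (deg E2 h) \<le> (69 / 100) * real n" using q(4) tot vE v(3) by linarith
      show "(385 / 10000) * real n \<le> real (card ?L)"
        using card_pendant_at_vertex[OF sg1, of v] cV tot dense v(3) by linarith
      show "card (nb E1 x - {v}) \<le> 3" if "x \<in> ?L" for x
      proof -
        have "nb E1 x - {v} = {}" using that by blast
        then show ?thesis by (simp only: card.empty zero_le)
      qed
    qed (use h7 in auto)
  qed
qed

section \<open>Moderate degrees\<close>

text \<open>The edge total gives |E1| < 2 n - deg v, so \<open>card_light_at_vertex\<close> provides
  at least 2 deg v - n > 0.08 n candidates; hence the threshold 0.54.\<close>

lemma packs_of_large_degree:
  assumes sg1: "simple_graph V1 E1" and sg2: "simple_graph V2 E2"
    and cV: "card V1 = n" "card V2 = n" and n: "261000 \<le> n"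
    and v: "v \<in> V1" "54 * n < 100 * deg E1 v"
    and mx: "\<And>u. deg E1 u \<le> deg E1 v" "\<And>u. deg E2 u \<le> deg E1 v"
    and d: "100 * deg E1 v \<le> 85 * n"
    and tot: "card E1 + card E2 + deg E1 v + 418275 \<le> 3 * n"
    and low: "n \<le> card E1 + 54020" "n \<le> card E2 + 54020"
  shows "packs V1 E1 V2 E2"
proof -
  have tot1: "card E1 + card E2 + deg E1 u \<le> 3 * n" for u using tot mx(1)[of u] by linarith
  have s1: "2 * real (card E1) * 180000 \<le> real n * real n"
    by (rule edge_square_bound) (use tot low in linarith)
  have s2: "2 * real (card E2) * 180000 \<le> real n * real n"
    by (rule edge_square_bound) (use tot low in linarith)
  have e2: "card E2 \<le> 2 * n" using tot low by linarith
  have d1: "real (deg E1 u) \<le> (85 / 100) * n" for u using mx(1)[of u] d by linarith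
  have d2: "real (deg E2 u) \<le> (85 / 100) * n" for u using mx(2)[of u] d by linarith
  have hub1: "card (hubs n V1 E1) \<le> 18000" by (rule card_hubs_le[OF sg1]) (use n tot in auto)
  have hub2: "card (hubs n V2 E2) \<le> 18000" by (rule card_hubs_le[OF sg2]) (use n tot in auto)
  obtain q h where q: "q \<in> V2" "nb E2 q \<inter> hubs n V2 E2 \<subseteq> {h}" "card (nb E2 q - hubs n V2 E2) \<le> 3"
    "2 * deg E2 h \<le> card E2 + 4"
  proof (rule light_vertex[OF sg2, of "hubs n V2 E2"])
    show "hubs n V2 E2 \<subseteq> V2" by (auto simp: hubs_def)
    show "2 \<le> card E2" using low n by linarith
    show "card E2 + deg E2 u + 2 * card (hubs n V2 E2) < 2 * card V2" for u
      using tot low mx(2)[of u] hub2 cV n by linarith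
  qed
  let ?H = "hubs n V1 E1"
  let ?L = "{x \<in> V1 - ?H. nb E1 x \<inter> ?H \<subseteq> {v} \<and> card (nb E1 x - ?H) \<le> 3}"
  have HV: "?H \<subseteq> V1" by (auto simp: hubs_def)
  have vH: "v \<in> ?H" using v by (auto simp: hubs_def)
  have fin1: "finite V1" using simple_graph_finite[OF sg1] .
  have fnb1: "finite (nb E1 x)" for x using simple_graph_nb_finite[OF sg1] .
  have cW: "n \<le> card (V1 - ?H) + 18000"
    using diff_card_le_card_Diff[OF finite_subset[OF HV fin1], of V1] hub1 cV by linarith
  \<comment> \<open>Adding 2 deg h \<le> |E2| + 4 and deg h \<le> deg v gives 3 deg h \<le> |E2| +
    deg v + 4, and the lower bound on |E1| keeps |E2| + deg v below 2 n by a constant.\<close>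
  have dh: "real (deg E2 h) \<le> (2 / 3) * n - 100000"
    using q(4) mx(2)[of h] tot low by linarith
  show ?thesis
  proof (rule packs_of_popular_vertex[OF sg1 sg2 cV n tot1 s1 s2 e2 v(1) _ _ q(1-3), where ?L0.0 = ?L])
    show "card E1 + deg E1 v + 2 \<le> 2 * n" using tot low by linarith
    show "deg E1 v + 1001 \<le> n" using d n by linarith
    show "real (deg E2 h) + real (card E2) / 10 + (96 / 1000) * real (card E1) \<le> (91 / 100) * real n"
      using dh tot low v(2) by linarith
    show "real (deg E2 h) \<le> (69 / 100) * real n" using dh by linarith
    show "(385 / 10000) * real n \<le> real (card ?L)"
      using card_light_at_vertex[OF sg1 HV vH] cW tot low v(2) by linarith
    show "card (nb E1 x - {v}) \<le> 3" if "x \<in> ?L" for x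
    proof -
      have "card (nb E1 x - {v}) \<le> card (nb E1 x - ?H)" using that fnb1 by (intro card_mono) auto
      then show ?thesis using that by simp
    qed
    show "3000 * deg E1 u < n" if "x \<in> ?L" "u \<in> nb E1 x - {v}" for x u
    proof -
      have "u \<in> V1 - ?H" using that simple_graph_nb_subset[OF sg1, of x] by blast
      then show ?thesis by (auto simp: hubs_def)
    qed
  qed (use d1 d2 in auto)
qed

text \<open>Here the many candidates at \<open>v\<close> are assumed instead of derived from its
  degree, and the bound 0.54 n on all degrees already makes the hub next to \<open>q\<close>
  harmless enough.\<close>

lemma packs_of_common_neighbour:
  assumes sg1: "simple_graph V1 E1" and sg2: "simple_graph V2 E2"
    and cV: "card V1 = n" "card V2 = n" and n: "261000 \<le> n"
    and mx: "\<And>u. 100 * deg E1 u \<le> 54 * n" "\<And>u. 100 * deg E2 u \<le> 54 * n"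
    and tot1: "\<And>u. card E1 + card E2 + deg E1 u + 418275 \<le> 3 * n"
    and tot2: "\<And>u. card E1 + card E2 + deg E2 u + 418275 \<le> 3 * n"
    and low: "n \<le> card E1 + 54020" "n \<le> card E2 + 54020"
    and v: "v \<in> V1" and L: "L \<subseteq> V1 - hubs n V1 E1" "(385 / 10000) * n \<le> real (card L)"
      "\<And>x. x \<in> L \<Longrightarrow> nb E1 x \<inter> hubs n V1 E1 \<subseteq> {v} \<and> card (nb E1 x - hubs n V1 E1) \<le> 3"
  shows "packs V1 E1 V2 E2"
proof -
  have tot: "card E1 + card E2 + 418275 \<le> 3 * n" using tot1[of v] by linarith
  have tot1': "card E1 + card E2 + deg E1 u \<le> 3 * n" for u using tot1[of u] by linarith
  have s1: "2 * real (card E1) * 180000 \<le> real n * real n"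
    by (rule edge_square_bound) (use tot low in linarith)
  have s2: "2 * real (card E2) * 180000 \<le> real n * real n"
    by (rule edge_square_bound) (use tot low in linarith)
  have e2: "card E2 \<le> 2 * n" using tot low by linarith
  have d1: "real (deg E1 u) \<le> (85 / 100) * n" for u using mx(1)[of u] by linarith
  have d2: "real (deg E2 u) \<le> (85 / 100) * n" for u using mx(2)[of u] by linarith
  have hub2: "card (hubs n V2 E2) \<le> 18000" by (rule card_hubs_le[OF sg2]) (use n tot in auto)
  have fnb1: "finite (nb E1 x)" for x using simple_graph_nb_finite[OF sg1] .
  obtain q h where q: "q \<in> V2" "nb E2 q \<inter> hubs n V2 E2 \<subseteq> {h}" "card (nb E2 q - hubs n V2 E2) \<le> 3"
  proof (rule light_vertex[OF sg2, of "hubs n V2 E2"])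
    show "hubs n V2 E2 \<subseteq> V2" by (auto simp: hubs_def)
    show "2 \<le> card E2" using low n by linarith
    show "card E2 + deg E2 u + 2 * card (hubs n V2 E2) < 2 * card V2" for u
      using tot2[of u] low hub2 cV n by linarith
  qed
  show ?thesis
  proof (rule packs_of_popular_vertex[OF sg1 sg2 cV n tot1' s1 s2 e2 v _ _ q, where ?L0.0 = L])
    show "card E1 + deg E1 v + 2 \<le> 2 * n" using tot1[of v] low by linarith
    show "deg E1 v + 1001 \<le> n" using mx(1)[of v] n by linarith
    show "real (deg E2 h) + real (card E2) / 10 + (96 / 1000) * real (card E1) \<le> (91 / 100) * real n"
      using mx(2)[of h] tot by linarith
    show "real (deg E2 h) \<le> (69 / 100) * real n" using mx(2)[of h] by linarith
    show "L \<subseteq> V1" using L(1) by blast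
    show "card (nb E1 x - {v}) \<le> 3" if "x \<in> L" for x
    proof -
      have "card (nb E1 x - {v}) \<le> card (nb E1 x - hubs n V1 E1)"
        using L(3)[OF that] fnb1 by (intro card_mono) auto
      then show ?thesis using L(3)[OF that] by linarith
    qed
    show "3000 * deg E1 u < n" if "x \<in> L" "u \<in> nb E1 x - {v}" for x u
    proof -
      have "u \<in> V1 - hubs n V1 E1" using that L(3)[of x] simple_graph_nb_subset[OF sg1, of x] by blast
      then show ?thesis by (auto simp: hubs_def)
    qed
  qed (use L(2) d1 d2 in auto)
qed

text \<open>Candidates have exactly one hub neighbour and at most one other; discharging yields
  about 2 n - |E1| of them. By \<open>spread\<close> a hub sees at most 0.0385 n candidates and a
  non-hub at most n / 3000, which gives \<omega>.\<close>

lemma packs_of_spread_candidates: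
  assumes sg1: "simple_graph V1 E1" and sg2: "simple_graph V2 E2"
    and cV: "card V1 = n" "card V2 = n" and n: "261000 \<le> n"
    and mx: "\<And>u. 100 * deg E1 u \<le> 54 * n" "\<And>u. 100 * deg E2 u \<le> 54 * n"
    and tot1: "\<And>u. card E1 + card E2 + deg E1 u + 418275 \<le> 3 * n"
    and low: "n \<le> card E1 + 54020" "n \<le> card E2 + 54020" and e12: "card E1 \<le> card E2"
    and outer: "n < 36020 + card {e \<in> E2. \<not> e \<subseteq> hubs n V2 E2} + card (hubs n V2 E2)"
    and spread: "\<And>v. v \<in> V1 \<Longrightarrow> real (card {x \<in> V1 - hubs n V1 E1.
      nb E1 x \<inter> hubs n V1 E1 \<subseteq> {v} \<and> card (nb E1 x - hubs n V1 E1) \<le> 3}) < (385 / 10000) * n"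
  shows "packs V1 E1 V2 E2"
proof -
  have fin1: "finite V1" and fin2: "finite V2" using sg1 sg2 simple_graph_finite by auto
  have fnb1: "finite (nb E1 v)" for v using simple_graph_nb_finite[OF sg1] .
  have nr: "261000 \<le> real n" using n by simp
  have pn: "0 < real n" using nr by linarith
  have tot: "card E1 + card E2 + 418275 \<le> 3 * n" using tot1[of undefined] by linarith
  have tot1': "card E1 + card E2 + deg E1 u \<le> 3 * n" for u using tot1[of u] by linarith
  have s1: "2 * real (card E1) * 180000 \<le> real n * real n"
    by (rule edge_square_bound) (use tot low in linarith)
  have s2: "2 * real (card E2) * 180000 \<le> real n * real n"
    by (rule edge_square_bound) (use tot low in linarith)
  have q1: "424 * sqrt (2 * real (card E1)) \<le> real n" by (rule sqrt_le_of_square) (use s1 in auto)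
  have q2: "424 * sqrt (2 * real (card E2)) \<le> real n" by (rule sqrt_le_of_square) (use s2 in auto)
  define H where "H = hubs n V1 E1"
  define B where "B = hubs n V2 E2"
  have cH: "60 * real (card H) \<le> real n" unfolding H_def using few_hubs[OF sg1 _ s1] pn by simp
  have cB: "60 * real (card B) \<le> real n" unfolding B_def using few_hubs[OF sg2 _ s2] pn by simp
  have HV: "H \<subseteq> V1" and BV: "B \<subseteq> V2" by (auto simp: H_def B_def hubs_def)
  define W where "W = V1 - H"
  have fW: "finite W" using fin1 by (simp add: W_def)
  have cW: "card W + card H = n"
    using HV card_mono[OF fin1 HV] finite_subset[OF HV fin1] cV by (simp add: W_def card_Diff_subset)
  have nbW: "nb E1 x \<inter> W = nb E1 x - H" "nb E1 x - W = nb E1 x \<inter> H" for x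
    using simple_graph_nb_subset[OF sg1, of x] HV by (auto simp: W_def)
  define T where "T v = {x \<in> W. nb E1 x \<inter> H \<subseteq> {v} \<and> card (nb E1 x - H) \<le> 3}" for v
  have cT: "real (card (T v)) \<le> (385 / 10000) * n" if "v \<in> V1" for v
    using spread[OF that] by (simp add: T_def W_def H_def)
  define L where "L = {x \<in> W. card (nb E1 x \<inter> H) = 1 \<and> card (nb E1 x - H) \<le> 1}"
  have LW: "L \<subseteq> W" by (auto simp: L_def)
  have cL: "2 * real n \<le> real (card L) + real (card E1) + 2 * (385 / 10000) * n + 2 * real (card H)"
  proof -
    obtain v where v: "v \<in> V1" using cV n by (metis all_not_in_conv card.empty not_numeral_le_zero)
    \<comment> \<open>A vertex of weight below 4 lies in \<open>L\<close>, with weight at least 2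
      and credit 2, or in \<open>T v\<close>, with credit 4. Any \<open>v\<close> will do, since
      vertices without hub neighbour and with at most 3 others lie in every
      \<open>T v\<close>.\<close>
    have "card W * 4 = (\<Sum>x\<in>W. 4)" by simp
    also have "\<dots> \<le> (\<Sum>x\<in>W. (card (nb E1 x - H) + 2 * card (nb E1 x \<inter> H))
        + ((if x \<in> L then 2 else 0) + (if x \<in> T v then 4 else 0)))"
    proof (rule sum_mono)
      fix x assume x: "x \<in> W"
      show "4 \<le> (card (nb E1 x - H) + 2 * card (nb E1 x \<inter> H))
        + ((if x \<in> L then 2 else 0) + (if x \<in> T v then 4 else 0))"
      proof (cases "nb E1 x \<inter> H = {}")
        case True
        then have "x \<in> T v \<or> 4 \<le> card (nb E1 x - H)" using x by (auto simp: T_def)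
        then show ?thesis by auto
      next
        case False
        then have "card (nb E1 x \<inter> H) \<noteq> 0" using fnb1[of x] by simp
        moreover have "x \<in> L \<or> card (nb E1 x \<inter> H) \<noteq> 1 \<or> 2 \<le> card (nb E1 x - H)" using x by (auto simp: L_def)
        ultimately show ?thesis by auto
      qed
    qed
    also have "\<dots> = (\<Sum>x\<in>W. card (nb E1 x - H) + 2 * card (nb E1 x \<inter> H))
        + (2 * card L + 4 * card (T v))"
    proof -
      have "(\<Sum>x\<in>W. if x \<in> L then 2 else 0 :: nat) = 2 * card L"
        unfolding sum.inter_restrict[OF fW, symmetric] Int_absorb1[OF LW] by simp
      moreover have "(\<Sum>x\<in>W. if x \<in> T v then 4 else 0 :: nat) = 4 * card (T v)"
      proof -
        have "W \<inter> T v = T v" by (auto simp: T_def)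
        then show ?thesis unfolding sum.inter_restrict[OF fW, symmetric] by simp
      qed
      ultimately show ?thesis by (simp only: sum.distrib)
    qed
    also have "(\<Sum>x\<in>W. card (nb E1 x - H) + 2 * card (nb E1 x \<inter> H)) \<le> 2 * card E1"
    proof -
      have "W \<subseteq> V1" by (auto simp: W_def)
      from sum_degree_touching[OF sg1 this]
      have "(\<Sum>x\<in>W. card (nb E1 x - H) + 2 * card (nb E1 x \<inter> H)) = 2 * card {e \<in> E1. e \<inter> W \<noteq> {}}"
        by (simp add: nbW)
      also have "\<dots> \<le> 2 * card E1"
        using simple_graph_finite_edges[OF sg1] by (intro mult_le_mono2 card_mono) auto
      finally show ?thesis .
    qed
    finally have "card W * 4 \<le> 2 * card E1 + (2 * card L + 4 * card (T v))" by simp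
    then show ?thesis using cW cT[OF v] by linarith
  qed
  \<comment> \<open>By \<open>outer\<close>, more than n - 36020 - |B| edges have an end outside
    \<open>B\<close>, and each uses up at least one of the 2 |E2| incidences there.\<close>
  have sumB: "(\<Sum>h\<in>B. deg E2 h) + n \<le> 2 * card E2 + card B + 36020"
  proof -
    have fnb2: "finite (nb E2 v)" for v using simple_graph_nb_finite[OF sg2] .
    have "(\<Sum>x\<in>V2 - B. card (nb E2 x \<inter> (V2 - B)) + 2 * card (nb E2 x - (V2 - B)))
        \<le> (\<Sum>x\<in>V2 - B. 2 * deg E2 x)"
    proof (rule sum_mono)
      fix x
      show "card (nb E2 x \<inter> (V2 - B)) + 2 * card (nb E2 x - (V2 - B)) \<le> 2 * deg E2 x"
        using card_Int_Diff[OF fnb2[of x], of "V2 - B"] by linarith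
    qed
    then have "card {e \<in> E2. e \<inter> (V2 - B) \<noteq> {}} \<le> (\<Sum>x\<in>V2 - B. deg E2 x)"
      using sum_degree_touching[OF sg2, of "V2 - B"] by (simp flip: sum_distrib_left)
    moreover have "{e \<in> E2. \<not> e \<subseteq> B} \<subseteq> {e \<in> E2. e \<inter> (V2 - B) \<noteq> {}}"
      using sg2 by (auto simp: simple_graph_def)
    then have "card {e \<in> E2. \<not> e \<subseteq> B} \<le> card {e \<in> E2. e \<inter> (V2 - B) \<noteq> {}}"
      using simple_graph_finite_edges[OF sg2] by (intro card_mono) auto
    moreover have "(\<Sum>x\<in>V2 - B. deg E2 x) + (\<Sum>h\<in>B. deg E2 h) = 2 * card E2"
      using sum.subset_diff[OF BV fin2, of "\<lambda>x. deg E2 x"] handshake[OF sg2] by linarith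
    ultimately show ?thesis using outer unfolding B_def[symmetric] by linarith
  qed
  define \<omega> where "\<omega> = (385 / 10000) * real n + real n / 3000"
  have coef: "2 / ((54 / 100) * real n) * \<omega> = 233 / 1620" using pn by (simp add: \<omega>_def field_simps)
  show ?thesis
  proof (rule packs_via_hub_placement[OF sg1 sg2 cV n tot1', where ?M1.0 = "{}" and B = B and L = L
        and k = 2 and l = 1 and \<omega> = \<omega> and \<gamma> = "(54 / 100) * real n" and bb = "sqrt (2 * real (card E2))"])
    show "2 * real (card E1) * 92000 \<le> real n * real n" using s1 by linarith
    show "partial_packing V1 E1 V2 E2 {}" by (rule partial_packing_empty)
    show "B = hubs n V2 E2 - Range {}" by (simp add: B_def)
    show "card {} \<le> (10 :: nat)" by simp
    show "real (card B) + 10 \<le> (34 / 1000) * real n" using cB nr by linarith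
    show "L \<subseteq> V1 - Domain {}" using LW by (auto simp: W_def)
    show "card {u \<in> V1 - Domain {}. (2 / 100) * real n < real (load E1 E2 {} u)} \<le> 12" using pn by (simp add: load_empty)
    show "nb E1 u \<inter> L = {}" if "(2 / 100) * real n < real (load E1 E2 {} u)" for u using that pn by (simp add: load_empty)
    show "real (load E1 E2 {} u) \<le> (7 / 10) * real n" for u by (simp add: load_empty)
    show "real (load E2 E1 ({}\<inverse>) y) \<le> (5 / 1000) * real n" for y by (simp add: load_empty)
    have nbL: "deg E1 x \<le> 2" if "x \<in> L" for x
      using that card_Int_Diff[OF fnb1[of x], of H] by (simp add: L_def)
    show "card (nb E1 x - Domain {}) \<le> 2" "deg E1 x \<le> 4" if "x \<in> L" for x using nbL[OF that] by auto
    show "card (nb E1 x \<inter> L) \<le> 1" if "x \<in> L" for x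
    proof -
      have "card (nb E1 x \<inter> L) \<le> card (nb E1 x - H)" using LW fnb1 by (intro card_mono) (auto simp: W_def)
      then show ?thesis using that by (simp add: L_def)
    qed
    show "real (\<Sum>u\<in>nb E1 x - Domain {}. card (nb E1 u \<inter> L)) \<le> \<omega>" if x: "x \<in> L" for x
    proof -
      obtain h where h: "nb E1 x \<inter> H = {h}" using x by (auto simp: L_def card_1_singleton_iff)
      have hub: "real (card (nb E1 h \<inter> L)) \<le> (385 / 10000) * real n"
      proof -
        have "nb E1 h \<inter> L \<subseteq> T h"
        proof
          fix z assume z: "z \<in> nb E1 h \<inter> L"
          then have "h \<in> nb E1 z \<inter> H" using h nb_sym[of z E1 h] by blast
          moreover obtain h' where "nb E1 z \<inter> H = {h'}" using z by (auto simp: L_def card_1_singleton_iff)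
          ultimately show "z \<in> T h" using z by (auto simp: T_def L_def)
        qed
        then have "card (nb E1 h \<inter> L) \<le> card (T h)" using fW by (intro card_mono) (auto simp: T_def)
        moreover have "h \<in> V1" using h HV by blast
        ultimately show ?thesis using cT[of h] by linarith
      qed
      have rest: "real (\<Sum>u\<in>nb E1 x - H. card (nb E1 u \<inter> L)) \<le> real n / 3000"
      proof -
        have "(\<Sum>u\<in>nb E1 x - H. card (nb E1 u \<inter> L)) \<le> card (nb E1 x - H) * (n div 3000)"
        proof (rule sum_bounded_above[where K = "n div 3000", simplified])
          fix u assume "u \<in> nb E1 x - H"
          then have "3000 * deg E1 u < n" using simple_graph_nb_subset[OF sg1, of x] by (auto simp: H_def hubs_def)
          moreover have "card (nb E1 u \<inter> L) \<le> deg E1 u" using fnb1 by (intro card_mono) auto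
          ultimately show "card (nb E1 u \<inter> L) \<le> n div 3000" by linarith
        qed
        also have "\<dots> \<le> 1 * (n div 3000)" using x by (intro mult_le_mono1) (simp add: L_def)
        finally have "(\<Sum>u\<in>nb E1 x - H. card (nb E1 u \<inter> L)) \<le> n div 3000" by simp
        then have "3000 * (\<Sum>u\<in>nb E1 x - H. card (nb E1 u \<inter> L)) \<le> n" by linarith
        then have "real (3000 * (\<Sum>u\<in>nb E1 x - H. card (nb E1 u \<inter> L))) \<le> real n" by (simp only: of_nat_le_iff)
        then show ?thesis by simp
      qed
      have "(\<Sum>u\<in>nb E1 x. card (nb E1 u \<inter> L)) = card (nb E1 h \<inter> L) + (\<Sum>u\<in>nb E1 x - H. card (nb E1 u \<inter> L))"
        using sum.Int_Diff[OF fnb1[of x], of "\<lambda>u. card (nb E1 u \<inter> L)" H] h by simp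
      then have "real (\<Sum>u\<in>nb E1 x. card (nb E1 u \<inter> L))
          = real (card (nb E1 h \<inter> L)) + real (\<Sum>u\<in>nb E1 x - H. card (nb E1 u \<inter> L))" by linarith
      then show ?thesis using hub rest by (simp add: \<omega>_def)
    qed
    show "0 < (54 / 100) * real n" "(54 / 100) * real n \<le> (8 / 10) * real n" "0 \<le> \<omega>"
      using pn by (auto simp: \<omega>_def)
    show "0 \<le> sqrt (2 * real (card E2))" by simp
    show "2 * real (card E2) \<le> sqrt (2 * real (card E2)) * sqrt (2 * real (card E2)) \<or>
        real (card B) \<le> sqrt (2 * real (card E2))" by simp
    show "real (card (forb E2 E1 ({}\<inverse>) h \<inter> L)) + real (card B) + real 1 * sqrt (2 * real (card E2))
      + 2 / ((54 / 100) * real n) * \<omega> * real (\<Sum>h\<in>B. deg E2 h) \<le> real (card L)" for h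
    proof -
      \<comment> \<open>By \<open>sumB\<close> the coefficient of |E2| becomes 2 * 233 / 1620 < 1,
        that of |E1| is 1. So under |E1| \<le> |E2| the worst case is |E1| = |E2|, about 1.5 n; this
        is why the candidates are taken in the graph with fewer edges.\<close>
      have "real (card B) + sqrt (2 * real (card E2)) + 233 / 1620 * real (\<Sum>h\<in>B. deg E2 h) \<le> real (card L)"
        using sumB cL cB cH q2 tot low e12 by linarith
      then show ?thesis unfolding coef by (simp add: forb_empty)
    qed
    show "real 2 * real (\<Sum>h\<in>B. deg E2 h) \<le> real (12 * n)"
      using sumB tot low cB by linarith
    show "(\<forall>x\<in>L. nb E1 x \<subseteq> Domain {}) \<or> (\<forall>h\<in>B. real (deg E2 h) \<le> (85 / 100) * real n)"
    proof (intro disjI2 ballI)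
      show "real (deg E2 h) \<le> (85 / 100) * real n" for h using mx(2)[of h] by linarith
    qed
    have d2: "real (deg E2 h) \<le> (54 / 100) * real n" for h using mx(2)[of h] by linarith
    show "(54 / 100) * real n \<le> (54 / 100) * real n \<and> (\<forall>h\<in>B. real (deg E2 h) \<le> (54 / 100) * real n)"
      using d2 by blast
    show "real (load E1 E2 {} u) + (if nb E1 u \<inter> L = {} then 0 else (54 / 100) * real n) + real (card E2) / 10
        + (96 / 1000) * real (card E1) + 19 * sqrt (2 * real (card E1)) + real (card B) + 10 + (25 / 1000) * real n
        \<le> real n" for u
    proof -
      have "(if nb E1 u \<inter> L = {} then 0 else (54 / 100) * real n) \<le> (54 / 100) * real n" using pn by simp
      then show ?thesis using q1 cB tot nr unfolding load_empty by linarith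
    qed
    show "real (deg E1 v) \<le> (85 / 100) * real n" for v using mx(1)[of v] by linarith
  qed
qed

lemma packs_of_small_degrees:
  assumes sg1: "simple_graph V1 E1" and sg2: "simple_graph V2 E2"
    and cV: "card V1 = n" "card V2 = n" and n: "261000 \<le> n"
    and mx: "\<And>u. 100 * deg E1 u \<le> 54 * n" "\<And>u. 100 * deg E2 u \<le> 54 * n"
    and tot1: "\<And>u. card E1 + card E2 + deg E1 u + 418275 \<le> 3 * n"
    and tot2: "\<And>u. card E1 + card E2 + deg E2 u + 418275 \<le> 3 * n"
    and low: "n \<le> card E1 + 54020" "n \<le> card E2 + 54020" and e12: "card E1 \<le> card E2"
    and outer: "n < 36020 + card {e \<in> E2. \<not> e \<subseteq> hubs n V2 E2} + card (hubs n V2 E2)"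
  shows "packs V1 E1 V2 E2"
proof (cases "\<exists>v\<in>V1. (385 / 10000) * n \<le> real (card {x \<in> V1 - hubs n V1 E1.
      nb E1 x \<inter> hubs n V1 E1 \<subseteq> {v} \<and> card (nb E1 x - hubs n V1 E1) \<le> 3})")
  case True
  then obtain v where v: "v \<in> V1" "(385 / 10000) * n \<le> real (card {x \<in> V1 - hubs n V1 E1.
      nb E1 x \<inter> hubs n V1 E1 \<subseteq> {v} \<and> card (nb E1 x - hubs n V1 E1) \<le> 3})" by blast
  show ?thesis
    by (rule packs_of_common_neighbour[OF sg1 sg2 cV n mx tot1 tot2 low v(1) _ v(2)]) auto
next
  case False
  show ?thesis
    by (rule packs_of_spread_candidates[OF sg1 sg2 cV n mx tot1 low e12 outer])
      (use False in \<open>meson not_le\<close>)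
qed

text \<open>Either there are enough leaf representatives to place the hubs of the other graph, or
  \<open>leaf_representatives\<close> turns their scarcity into edges.\<close>

lemma outer_edges_or_packs:
  assumes sg1: "simple_graph V1 E1" and sg2: "simple_graph V2 E2"
    and cV: "card V1 = n" "card V2 = n" and n: "261000 \<le> n"
    and d: "\<And>u. 100 * deg E1 u \<le> 85 * n" "\<And>u. 100 * deg E2 u \<le> 85 * n"
    and tot1: "\<And>u. card E1 + card E2 + deg E1 u + 418275 \<le> 3 * n"
  shows "packs V1 E1 V2 E2 \<or> n < 36020 + card {e \<in> E1. \<not> e \<subseteq> hubs n V1 E1} + card (hubs n V1 E1)"
proof -
  let ?H = "hubs n V1 E1"
  have HV: "?H \<subseteq> V1" by (auto simp: hubs_def)
  obtain R where R: "R \<subseteq> V1 - ?H" "\<And>x. x \<in> R \<Longrightarrow> nb E1 x \<inter> ?H = {} \<and> deg E1 x \<le> 1"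
    "\<And>u. card (nb E1 u \<inter> R) \<le> 1" "card (V1 - ?H) \<le> card R + card {e \<in> E1. \<not> e \<subseteq> ?H}"
    using leaf_representatives[OF sg1 HV] by blast
  show ?thesis
  proof (cases "36020 \<le> card R")
    case True
    have "2 * (real (card E1) + real (card E2)) * 92000 \<le> (6 * real n - 836550) * 92000"
    proof (rule mult_right_mono)
      have "real (card E1) + real (card E2) + 418275 \<le> 3 * real n" using tot1[of undefined] by linarith
      then show "2 * (real (card E1) + real (card E2)) \<le> 6 * real n - 836550" by (simp add: algebra_simps)
    qed simp
    \<comment> \<open>6 n - 828000 is the tangent of n^2 / 92000 at n = 276000, and 836550 = 2 *
      418275 exceeds 828000.\<close>
    also have "\<dots> \<le> real n * real n"
      using zero_le_square[of "real n - 276000"] by (simp add: algebra_simps)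
    finally have e: "2 * (real (card E1) + real (card E2)) * 92000 \<le> real n * real n" .
    have "packs V1 E1 V2 E2"
    proof (rule packs_of_leaf_representatives[OF sg1 sg2 cV n _ e _ _ R(1-3) True])
      show "card E1 + card E2 + deg E1 u \<le> 3 * n" for u using tot1[of u] by linarith
      show "real (deg E1 u) \<le> (85 / 100) * real n" for u using d(1)[of u] by linarith
      show "real (deg E2 u) \<le> (85 / 100) * real n" for u using d(2)[of u] by linarith
    qed
    then show ?thesis by blast
  next
    case False
    have "n - card ?H \<le> card (V1 - ?H)"
      using diff_card_le_card_Diff[OF finite_subset[OF HV simple_graph_finite[OF sg1]], of V1] cV by linarith
    then show ?thesis using R(4) False by linarith
  qed
qed

text \<open>Arguing by contradiction, \<open>outer_edges_or_packs\<close> applies in both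
  directions, so both graphs have at least n - 54020 edges, where 54020 = 36020 + 18000.\<close>

lemma packs_of_moderate_degrees:
  assumes sg1: "simple_graph V1 E1" and sg2: "simple_graph V2 E2"
    and cV: "card V1 = n" "card V2 = n" and n: "261000 \<le> n"
    and v: "v \<in> V1" and mx: "\<And>u. deg E1 u \<le> deg E1 v" "\<And>u. deg E2 u \<le> deg E1 v"
    and d: "100 * deg E1 v \<le> 85 * n"
    and tot: "card E1 + card E2 + deg E1 v + 418275 \<le> 3 * n"
  shows "packs V1 E1 V2 E2"
proof (rule ccontr)
  assume np: "\<not> packs V1 E1 V2 E2"
  have np': "\<not> packs V2 E2 V1 E1" using np packs_sym[of V2 E2 V1 E1] by blast
  have d1: "100 * deg E1 u \<le> 85 * n" for u using mx(1)[of u] d by linarith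
  have d2: "100 * deg E2 u \<le> 85 * n" for u using mx(2)[of u] d by linarith
  have tot1: "card E1 + card E2 + deg E1 u + 418275 \<le> 3 * n" for u using tot mx(1)[of u] by linarith
  have tot2: "card E1 + card E2 + deg E2 u + 418275 \<le> 3 * n" for u using tot mx(2)[of u] by linarith
  have tot1': "card E2 + card E1 + deg E1 u + 418275 \<le> 3 * n" for u using tot1[of u] by linarith
  have tot2': "card E2 + card E1 + deg E2 u + 418275 \<le> 3 * n" for u using tot2[of u] by linarith
  have o1: "n < 36020 + card {e \<in> E1. \<not> e \<subseteq> hubs n V1 E1} + card (hubs n V1 E1)"
    using outer_edges_or_packs[OF sg1 sg2 cV n d1 d2 tot1] np by blast
  have o2: "n < 36020 + card {e \<in> E2. \<not> e \<subseteq> hubs n V2 E2} + card (hubs n V2 E2)"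
    using outer_edges_or_packs[OF sg2 sg1 cV(2,1) n d2 d1 tot2'] np' by blast
  have h: "card (hubs n V1 E1) \<le> 18000" "card (hubs n V2 E2) \<le> 18000"
    using card_hubs_le[OF sg1] card_hubs_le[OF sg2] n tot by auto
  have low1: "n \<le> card E1 + 54020"
  proof -
    have "card {e \<in> E1. \<not> e \<subseteq> hubs n V1 E1} \<le> card E1"
      using simple_graph_finite_edges[OF sg1] by (intro card_mono) auto
    then show ?thesis using o1 h by linarith
  qed
  have low2: "n \<le> card E2 + 54020"
  proof -
    have "card {e \<in> E2. \<not> e \<subseteq> hubs n V2 E2} \<le> card E2"
      using simple_graph_finite_edges[OF sg2] by (intro card_mono) auto
    then show ?thesis using o2 h by linarith
  qed
  show False
  proof (cases "54 * n < 100 * deg E1 v")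
    case True
    then show False using packs_of_large_degree[OF sg1 sg2 cV n v True mx d tot low1 low2] np by blast
  next
    case False
    have m1: "100 * deg E1 u \<le> 54 * n" for u using mx(1)[of u] False by linarith
    have m2: "100 * deg E2 u \<le> 54 * n" for u using mx(2)[of u] False by linarith
    show False
    proof (cases "card E1 \<le> card E2")
      case True
      then show False using packs_of_small_degrees[OF sg1 sg2 cV n m1 m2 tot1 tot2 low1 low2 True o2] np by blast
    next
      case False
      then have "card E2 \<le> card E1" by linarith
      then show False
        using packs_of_small_degrees[OF sg2 sg1 cV(2,1) n m2 m1 tot2' tot1' low2 low1 _ o1] np' by blast
    qed
  qed
qed

text \<open>|E1| |E2| \<le> (0.7 n)^2, so a random bijection has on average at most 0.98 n / (n - 1)
  < 1 conflicts.\<close>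

lemma packs_of_few_edges:
  assumes sg1: "simple_graph V1 E1" and sg2: "simple_graph V2 E2"
    and cV: "card V1 = n" "card V2 = n" and n: "100 \<le> n"
    and few: "10 * (card E1 + card E2) \<le> 14 * n"
  shows "packs V1 E1 V2 E2"
proof (rule random_completion[OF sg1 sg2 _ partial_packing_empty])
  show "card V1 = card V2" using cV by simp
  show "n = card V1 - card {}" using cV by simp
  show "card {e \<in> E1. e \<inter> Domain {} = {}} \<le> card E1" "card {e \<in> E2. e \<inter> Range {} = {}} \<le> card E2"
    by auto
  show "card {(u, y). u \<in> V1 - Domain {} \<and> y \<in> V2 - Range {} \<and> y \<in> forb E1 E2 {} u} \<le> 0"
    by (simp add: forb_empty)
  have ab: "real (card E1) + real (card E2) \<le> (14 / 10) * real n"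
    using few unfolding add_mult_distrib2 by linarith
  have "(real (card E1) + real (card E2)) * (real (card E1) + real (card E2)) \<le> ((14 / 10) * real n) * ((14 / 10) * real n)"
    by (rule mult_mono[OF ab ab]) auto
  moreover have "4 * (real (card E1) * real (card E2)) \<le> (real (card E1) + real (card E2)) * (real (card E1) + real (card E2))"
    using zero_le_square[of "real (card E1) - real (card E2)"] by (simp add: algebra_simps)
  moreover have "100 * real n \<le> real n * real n" using n by (intro mult_right_mono) auto
  moreover have "real (n * (n - 1)) = real n * real n - real n"
  proof -
    have "real (n - 1) = real n - 1" using n by (simp add: of_nat_diff)
    then show ?thesis unfolding of_nat_mult by (simp add: algebra_simps)
  qed
  ultimately have "2 * (real (card E1) * real (card E2)) < real (n * (n - 1))" using n by linarith
  then have "real (2 * card E1 * card E2 + 0 * (n - 1)) < real (n * (n - 1))" by simp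
  then show "2 * card E1 * card E2 + 0 * (n - 1) < n * (n - 1)" by (simp only: of_nat_less_iff)
qed

lemma packs_of_max_degree_left:
  assumes sg1: "simple_graph V1 E1" and sg2: "simple_graph V2 E2"
    and cV: "card V1 = n" "card V2 = n" and d: "max_degree V1 E1 + 2 \<le> n"
    and le: "max_degree V2 E2 \<le> max_degree V1 E1"
    and tot: "card E1 + card E2 + max_degree V1 E1 + 418275 \<le> 3 * n"
  shows "packs V1 E1 V2 E2"
proof (cases "10 * (card E1 + card E2) \<le> 14 * n")
  case True
  then show ?thesis using packs_of_few_edges[OF sg1 sg2 cV] tot by simp
next
  case False
  \<comment> \<open>1.4 n < 3 n - 418275 gives n > 261421.\<close>
  then have n: "261000 \<le> n" using tot unfolding add_mult_distrib2 by linarith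
  then have "V1 \<noteq> {}" using cV by auto
  then obtain v where v: "v \<in> V1" "deg E1 v = max_degree V1 E1"
    using max_degree_attained[OF sg1] by blast
  have mx1: "deg E1 u \<le> deg E1 v" for u using max_degree_ge[OF sg1, of u] v(2) by simp
  have mx2: "deg E2 u \<le> deg E1 v" for u using max_degree_ge[OF sg2, of u] le v(2) by simp
  have tot': "card E1 + card E2 + deg E1 v + 418275 \<le> 3 * n" using tot v(2) by simp
  show ?thesis
  proof (cases "100 * deg E1 v \<le> 85 * n")
    case True
    then show ?thesis using packs_of_moderate_degrees[OF sg1 sg2 cV n v(1) mx1 mx2 _ tot'] by blast
  next
    case False
    then have "85 * n < 100 * deg E1 v" by linarith
    then show ?thesis using packs_of_dominating_vertex[OF sg1 sg2 cV n v(1) _ _ mx1 mx2 tot'] d v(2) by simp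
  qed
qed

theorem mainTheorem1:
  fixes V1 :: "'a set" and E1 :: "'a set set" and V2 :: "'b set" and E2 :: "'b set set"
    and n :: nat
  assumes "simple_graph V1 E1" and "simple_graph V2 E2"
    and "card V1 = n" and "card V2 = n"
    and "int (max_degree V1 E1) \<le> int n - 2" and "int (max_degree V2 E2) \<le> int n - 2"
    and "int (card E1) + int (card E2) + int (max (max_degree V1 E1) (max_degree V2 E2))
           \<le> 3 * int n - 11 * 195^2"
  shows "packs V1 E1 V2 E2"
proof (cases "max_degree V2 E2 \<le> max_degree V1 E1")
  case True
  then have "card E1 + card E2 + max_degree V1 E1 + 418275 \<le> 3 * n" using assms(7) by simp
  then show ?thesis using packs_of_max_degree_left[OF assms(1-4) _ True] assms(5) by simp
next
  case False
  then have le: "max_degree V1 E1 \<le> max_degree V2 E2" by simp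
  then have "card E2 + card E1 + max_degree V2 E2 + 418275 \<le> 3 * n" using assms(7) by simp
  then have "packs V2 E2 V1 E1" using packs_of_max_degree_left[OF assms(2,1,4,3) _ le] assms(6) by simp
  then show ?thesis using packs_sym[of V2 E2 V1 E1] by blast
qed

end
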